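(* Let $\mathbb K$ be a field, $s,d\in\mathbb N$, and let $\mathcal R$ be a nc Fornasini--Marchesini realization centred at $\underline Y=(Y_1,\ldots,Y_d)\in(\mathbb K^{s\times s})^d$ and described by $(L;D,C,\underline{\mathbf A},\underline{\mathbf B})$. Suppose $\mathcal R$ is controllable and observable, and its coefficients satisfy the linearized lost-abbey conditions. Let $\mathbb K\langle\!\langle\!\langle\underline x\rangle\!\rangle\!\rangle$ denote the free skew field of nc rational functions of $x_1,\ldots,x_d$ over $\mathbb K$. Then the matrix $$\delta_{\mathcal R}=I_L-\sum_{k=1}^d\big[\mathbf A_k(I_s)x_k-\mathbf A_k(Y_k)\big]$$ is invertible over the free skew field, and there exists a nc rational function $f\in\mathbb K\langle\!\langle\!\langle\underline x\rangle\!\rangle\!\rangle$ such that the $s\times s$ matrix over the free skew field $$\mathfrak r_{\mathcal R}=D+C\,\delta_{\mathcal R}^{-1}\sum_{k=1}^d\big[\mathbf B_k(I_s)x_k-\mathbf B_k(Y_k)\big]$$ satisfies $\mathfrak r_{\mathcal R}=I_s\otimes f$ (i.e. it is the diagonal matrix with all diagonal entries equal to $f$). Moreover, $\Omega_{sm}(\mathcal R)\subseteq dom_{sm}(f)$ and $\mathcal R(\underline X)=f(\underline X)$ for every $m\in\mathbb N$ and $\underline X\in\Omega_{sm}(\mathcal R)$. In particular, $\underline Y\in dom_s(f)$.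
   Context: Rational functions. Nc rational expressions in $x_1,\ldots,x_d$ over $\mathbb K$ are obtained from nc polynomials by successive additions, multiplications and inversions; $dom_n(R)$ is the set of $d$-tuples of $n\times n$ matrices over $\mathbb K$ at which all inverses in $R$ exist, $dom(R)=\coprod_n dom_n(R)$. $R_1,R_2$ are equivalent if they agree on $dom(R_1)\cap dom(R_2)$. A nc rational function $f$ is an equivalence class of expressions with nonempty domain; these form a skew field, the free skew field. $dom(f)=\bigcup_{R\in f}dom(R)$, $dom_n(f)$ is its part of $n\times n$ matrices, and $f(\underline X)=R(\underline X)$ for any $R\in f$ with $\underline X\in dom(R)$. Realizations. A nc Fornasini--Marchesini realization $\mathcal R$ centred at $\underline Y\in(\mathbb K^{s\times s})^d$, described by $(L;D,C,\underline{\mathbf A},\underline{\mathbf B})$, consists of $L\in\mathbb N$, linear maps $\mathbf A_k:\mathbb K^{s\times s}\to\mathbb K^{L\times L}$, $\mathbf B_k:\mathbb K^{s\times s}\to\mathbb K^{L\times s}$ ($1\le k\le d$), and matrices $C\in\mathbb K^{s\times L}$, $D\in\mathbb K^{s\times s}$. A linear map $\mathbf T$ on $\mathbb K^{s\times s}$ is extended to $X=[X_{ij}]\in\mathbb K^{sm\times sm}$ with $s\times s$ blocks by $(X)\mathbf T=[\mathbf T(X_{ij})]$. For $\underline X\in(\mathbb K^{sm\times sm})^d$ put $\Lambda_{\underline{\mathbf A},\underline Y}(\underline X)=I_{Lm}-\sum_k(X_k-I_m\otimes Y_k)\mathbf A_k$, $\Omega_{sm}(\mathcal R)=\{\underline X\in(\mathbb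 K^{sm\times sm})^d:\det\Lambda_{\underline{\mathbf A},\underline Y}(\underline X)\ne0\}$ and, on this set, $\mathcal R(\underline X)=I_m\otimes D+(I_m\otimes C)\Lambda_{\underline{\mathbf A},\underline Y}(\underline X)^{-1}\sum_k(X_k-I_m\otimes Y_k)\mathbf B_k$. $\otimes$ is the Kronecker product $P\otimes Q=[p_{ij}Q]$. Controllable: the sum of the column spaces of all matrices $\mathbf A_{i_1}(X_1)\cdots\mathbf A_{i_\ell}(X_\ell)\mathbf B_k(X_{\ell+1})$ ($\ell\ge0$, $1\le i_1,\ldots,i_\ell,k\le d$, $X_j\in\mathbb K^{s\times s}$) is $\mathbb K^L$. Observable: the intersection of the kernels of all $C\mathbf A_{i_1}(X_1)\cdots\mathbf A_{i_\ell}(X_\ell)$ ($\ell\ge0$) is $\{0\}$. Linearized lost-abbey conditions: with $[S,Y]=SY-YS$, for all $S,Z_1,Z_2\in\mathbb K^{s\times s}$ and $1\le i_1,i_2\le d$: $SD-DS=C\sum_k\mathbf B_k([S,Y_k])$; $SC\mathbf B_{i_1}(Z_1)-C\mathbf B_{i_1}(SZ_1)=C\big(\sum_k\mathbf A_k([S,Y_k])\big)\mathbf B_{i_1}(Z_1)$; $SC\mathbf A_{i_1}(Z_1)-C\mathbf A_{i_1}(SZ_1)=C\big(\sum_k\mathbf A_k([S,Y_k])\big)\mathbf A_{i_1}(Z_1)$; $\mathbf B_{i_1}(Z_1S)-\mathbf B_{i_1}(Z_1)S=\mathbf A_{i_1}(Z_1)\sum_k\mathbf B_k([S,Y_k])$;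 $\mathbf A_{i_1}(Z_1S)\mathbf B_{i_2}(Z_2)-\mathbf A_{i_1}(Z_1)\mathbf B_{i_2}(SZ_2)=\mathbf A_{i_1}(Z_1)\big(\sum_k\mathbf A_k([S,Y_k])\big)\mathbf B_{i_2}(Z_2)$; $\mathbf A_{i_1}(Z_1S)\mathbf A_{i_2}(Z_2)-\mathbf A_{i_1}(Z_1)\mathbf A_{i_2}(SZ_2)=\mathbf A_{i_1}(Z_1)\big(\sum_k\mathbf A_k([S,Y_k])\big)\mathbf A_{i_2}(Z_2)$ (sums over $k=1,\ldots,d$). *)

theory Defs
  imports
    "Jordan_Normal_Form.Matrix_Kernel"
    "Jordan_Normal_Form.VS_Connect"
    "Jordan_Normal_Form.Gauss_Jordan_Elimination"
begin

text \<open>The ground field is a type \<open>'a :: field\<close>; the variables \<open>x\<^sub>1, \<dots>, x\<^sub>d\<close> are indexed by a finite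
  type \<open>'d\<close> with \<open>d = CARD('d)\<close>.  Matrices whose size varies are those of \<open>Jordan_Normal_Form\<close>.\<close>

section \<open>Noncommutative rational expressions and functions\<close>

datatype ('a, 'd) nc_expr =
    NC_Const 'a
  | NC_Var 'd
  | NC_Add "('a, 'd) nc_expr" "('a, 'd) nc_expr"
  | NC_Mult "('a, 'd) nc_expr" "('a, 'd) nc_expr"
  | NC_Inv "('a, 'd) nc_expr"

text \<open>The value is only meaningful on \<open>nc_dom\<close>.\<close>
primrec nc_eval :: "nat \<Rightarrow> ('d \<Rightarrow> 'a :: field mat) \<Rightarrow> ('a, 'd) nc_expr \<Rightarrow> 'a mat" where
  "nc_eval n X (NC_Const c) = c \<cdot>\<^sub>m 1\<^sub>m n"
| "nc_eval n X (NC_Var k) = X k"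
| "nc_eval n X (NC_Add R S) = nc_eval n X R + nc_eval n X S"
| "nc_eval n X (NC_Mult R S) = nc_eval n X R * nc_eval n X S"
| "nc_eval n X (NC_Inv R) = the (mat_inverse (nc_eval n X R))"

primrec nc_defined :: "nat \<Rightarrow> ('d \<Rightarrow> 'a :: field mat) \<Rightarrow> ('a, 'd) nc_expr \<Rightarrow> bool" where
  "nc_defined n X (NC_Const c) = True"
| "nc_defined n X (NC_Var k) = True"
| "nc_defined n X (NC_Add R S) = (nc_defined n X R \<and> nc_defined n X S)"
| "nc_defined n X (NC_Mult R S) = (nc_defined n X R \<and> nc_defined n X S)"
| "nc_defined n X (NC_Inv R) = (nc_defined n X R \<and> invertible_mat (nc_eval n X R))"

definition mat_tuples :: "nat \<Rightarrow> ('d \<Rightarrow> 'a mat) set" where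
  "mat_tuples n = {X. \<forall>k. X k \<in> carrier_mat n n}"

definition nc_dom :: "nat \<Rightarrow> ('a :: field, 'd) nc_expr \<Rightarrow> ('d \<Rightarrow> 'a mat) set" where
  "nc_dom n R = {X \<in> mat_tuples n. nc_defined n X R}"

text \<open>Matrix sizes are positive: at \<open>0 \<times> 0\<close> matrices every expression (even the inverse of zero)
  would be defined.\<close>
definition nc_nondegenerate :: "('a :: field, 'd) nc_expr \<Rightarrow> bool" where
  "nc_nondegenerate R \<longleftrightarrow> (\<exists>n\<ge>1. nc_dom n R \<noteq> {})"

definition nc_equiv :: "('a :: field, 'd) nc_expr \<Rightarrow> ('a, 'd) nc_expr \<Rightarrow> bool" where
  "nc_equiv R S \<longleftrightarrow> (\<forall>n\<ge>1. \<forall>X \<in> nc_dom n R \<inter> nc_dom n S. nc_eval n X R = nc_eval n X S)"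

type_synonym ('a, 'd) nc_ratfun = "('a, 'd) nc_expr set"

definition nc_class :: "('a :: field, 'd) nc_expr \<Rightarrow> ('a, 'd) nc_ratfun" where
  "nc_class R = {S. nc_nondegenerate S \<and> nc_equiv R S}"

definition free_skew_field :: "('a :: field, 'd) nc_ratfun ring" where
  "free_skew_field =
    \<lparr> carrier = {nc_class R | R. nc_nondegenerate R},
      mult = (\<lambda>f g. \<Union>R\<in>f. \<Union>S\<in>g. nc_class (NC_Mult R S)),
      one = nc_class (NC_Const 1),
      zero = nc_class (NC_Const 0),
      add = (\<lambda>f g. \<Union>R\<in>f. \<Union>S\<in>g. nc_class (NC_Add R S)) \<rparr>"

definition ratfun_dom :: "nat \<Rightarrow> ('a :: field, 'd) nc_ratfun \<Rightarrow> ('d \<Rightarrow> 'a mat) set" where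
  "ratfun_dom n f = (\<Union>R\<in>f. nc_dom n R)"

definition ratfun_eval :: "nat \<Rightarrow> ('a :: field, 'd) nc_ratfun \<Rightarrow> ('d \<Rightarrow> 'a mat) \<Rightarrow> 'a mat" where
  "ratfun_eval n f X = (THE M. \<exists>R\<in>f. X \<in> nc_dom n R \<and> M = nc_eval n X R)"

section \<open>Matrices over a (noncommutative) ring given by a record\<close>

definition rmat_carrier :: "('r, 'b) ring_scheme \<Rightarrow> nat \<Rightarrow> nat \<Rightarrow> 'r mat set" where
  "rmat_carrier R p q = {M \<in> carrier_mat p q. elements_mat M \<subseteq> carrier R}"

definition rmat_add :: "('r, 'b) ring_scheme \<Rightarrow> 'r mat \<Rightarrow> 'r mat \<Rightarrow> 'r mat" where
  "rmat_add R M N = mat (dim_row M) (dim_col M) (\<lambda>(i, j). M $$ (i, j) \<oplus>\<^bsub>R\<^esub> N $$ (i, j))"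

definition rmat_minus :: "('r, 'b) ring_scheme \<Rightarrow> 'r mat \<Rightarrow> 'r mat \<Rightarrow> 'r mat" where
  "rmat_minus R M N = mat (dim_row M) (dim_col M) (\<lambda>(i, j). M $$ (i, j) \<ominus>\<^bsub>R\<^esub> N $$ (i, j))"

definition rmat_mult :: "('r, 'b) ring_scheme \<Rightarrow> 'r mat \<Rightarrow> 'r mat \<Rightarrow> 'r mat" where
  "rmat_mult R M N = mat (dim_row M) (dim_col N)
     (\<lambda>(i, j). \<Oplus>\<^bsub>R\<^esub>k\<in>{..<dim_col M}. M $$ (i, k) \<otimes>\<^bsub>R\<^esub> N $$ (k, j))"

text \<open>The matrix \<open>I\<^sub>n \<otimes> a\<close>.\<close>
definition rmat_scalar :: "('r, 'b) ring_scheme \<Rightarrow> nat \<Rightarrow> 'r \<Rightarrow> 'r mat" where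
  "rmat_scalar R n a = mat n n (\<lambda>(i, j). if i = j then a else \<zero>\<^bsub>R\<^esub>)"

definition rmat_ring :: "('r, 'b) ring_scheme \<Rightarrow> nat \<Rightarrow> 'r mat ring" where
  "rmat_ring R n =
    \<lparr> carrier = rmat_carrier R n n,
      mult = rmat_mult R,
      one = rmat_scalar R n \<one>\<^bsub>R\<^esub>,
      zero = rmat_scalar R n \<zero>\<^bsub>R\<^esub>,
      add = rmat_add R \<rparr>"

section \<open>Fornasini--Marchesini realizations\<close>

definition linear_mat_map :: "nat \<Rightarrow> nat \<Rightarrow> nat \<Rightarrow> ('a :: field mat \<Rightarrow> 'a mat) \<Rightarrow> bool" where
  "linear_mat_map s p q T \<longleftrightarrow>
     (\<forall>X \<in> carrier_mat s s. T X \<in> carrier_mat p q) \<and>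
     (\<forall>X \<in> carrier_mat s s. \<forall>Z \<in> carrier_mat s s. T (X + Z) = T X + T Z) \<and>
     (\<forall>c. \<forall>X \<in> carrier_mat s s. T (c \<cdot>\<^sub>m X) = c \<cdot>\<^sub>m T X)"

definition fm_realization :: "nat \<Rightarrow> nat \<Rightarrow> 'a :: field mat \<Rightarrow> 'a mat \<Rightarrow>
    ('d \<Rightarrow> 'a mat \<Rightarrow> 'a mat) \<Rightarrow> ('d \<Rightarrow> 'a mat \<Rightarrow> 'a mat) \<Rightarrow> ('d \<Rightarrow> 'a mat) \<Rightarrow> bool" where
  "fm_realization s L D C A B Y \<longleftrightarrow>
     D \<in> carrier_mat s s \<and> C \<in> carrier_mat s L \<and>
     (\<forall>k. linear_mat_map s L L (A k)) \<and> (\<forall>k. linear_mat_map s L s (B k)) \<and>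
     Y \<in> mat_tuples s"

definition kron :: "'a :: times mat \<Rightarrow> 'a mat \<Rightarrow> 'a mat" where
  "kron P Q = mat (dim_row P * dim_row Q) (dim_col P * dim_col Q)
     (\<lambda>(i, j). P $$ (i div dim_row Q, j div dim_col Q) * Q $$ (i mod dim_row Q, j mod dim_col Q))"

definition mat_sum :: "nat \<Rightarrow> nat \<Rightarrow> ('d :: finite \<Rightarrow> 'a :: comm_monoid_add mat) \<Rightarrow> 'a mat" where
  "mat_sum p q M = mat p q (\<lambda>(i, j). \<Sum>k\<in>UNIV. M k $$ (i, j))"

definition mat_block :: "nat \<Rightarrow> 'a mat \<Rightarrow> nat \<Rightarrow> nat \<Rightarrow> 'a mat" where
  "mat_block s X i j = mat s s (\<lambda>(a, b). X $$ (i * s + a, j * s + b))"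

text \<open>The extension \<open>(X)T\<close> of \<open>T : K\<^sup>s\<^sup>\<times>\<^sup>s \<rightarrow> K\<^sup>p\<^sup>\<times>\<^sup>q\<close> to \<open>X\<close> consisting of \<open>m \<times> m\<close> blocks of size \<open>s \<times> s\<close>.\<close>
definition block_ext :: "nat \<Rightarrow> nat \<Rightarrow> nat \<Rightarrow> nat \<Rightarrow> 'a mat \<Rightarrow> ('a mat \<Rightarrow> 'a mat) \<Rightarrow> 'a mat" where
  "block_ext s p q m X T = mat (p * m) (q * m)
     (\<lambda>(i, j). T (mat_block s X (i div p) (j div q)) $$ (i mod p, j mod q))"

definition fm_pencil :: "nat \<Rightarrow> nat \<Rightarrow> nat \<Rightarrow> ('d :: finite \<Rightarrow> 'a :: field mat \<Rightarrow> 'a mat) \<Rightarrow>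
    ('d \<Rightarrow> 'a mat) \<Rightarrow> nat \<Rightarrow> ('d \<Rightarrow> 'a mat) \<Rightarrow> 'a mat" where
  "fm_pencil s p q T Y m X =
     mat_sum (p * m) (q * m) (\<lambda>k. block_ext s p q m (X k - kron (1\<^sub>m m) (Y k)) (T k))"

definition fm_Lambda :: "nat \<Rightarrow> nat \<Rightarrow> ('d :: finite \<Rightarrow> 'a :: field mat \<Rightarrow> 'a mat) \<Rightarrow>
    ('d \<Rightarrow> 'a mat) \<Rightarrow> nat \<Rightarrow> ('d \<Rightarrow> 'a mat) \<Rightarrow> 'a mat" where
  "fm_Lambda s L A Y m X = 1\<^sub>m (L * m) - fm_pencil s L L A Y m X"

definition fm_Omega :: "nat \<Rightarrow> nat \<Rightarrow> ('d :: finite \<Rightarrow> 'a :: field mat \<Rightarrow> 'a mat) \<Rightarrow>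
    ('d \<Rightarrow> 'a mat) \<Rightarrow> nat \<Rightarrow> ('d \<Rightarrow> 'a mat) set" where
  "fm_Omega s L A Y m = {X \<in> mat_tuples (s * m). det (fm_Lambda s L A Y m X) \<noteq> 0}"

definition fm_eval :: "nat \<Rightarrow> nat \<Rightarrow> 'a :: field mat \<Rightarrow> 'a mat \<Rightarrow>
    ('d :: finite \<Rightarrow> 'a mat \<Rightarrow> 'a mat) \<Rightarrow> ('d \<Rightarrow> 'a mat \<Rightarrow> 'a mat) \<Rightarrow> ('d \<Rightarrow> 'a mat) \<Rightarrow>
    nat \<Rightarrow> ('d \<Rightarrow> 'a mat) \<Rightarrow> 'a mat" where
  "fm_eval s L D C A B Y m X =
     kron (1\<^sub>m m) D +
     kron (1\<^sub>m m) C * the (mat_inverse (fm_Lambda s L A Y m X)) * fm_pencil s L s B Y m X"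

inductive_set ctrl_words :: "nat \<Rightarrow> ('d \<Rightarrow> 'a :: field mat \<Rightarrow> 'a mat) \<Rightarrow>
    ('d \<Rightarrow> 'a mat \<Rightarrow> 'a mat) \<Rightarrow> 'a mat set"
  for s :: nat and A B :: "'d \<Rightarrow> 'a :: field mat \<Rightarrow> 'a mat" where
  base: "X \<in> carrier_mat s s \<Longrightarrow> B k X \<in> ctrl_words s A B"
| step: "W \<in> ctrl_words s A B \<Longrightarrow> X \<in> carrier_mat s s \<Longrightarrow> A i X * W \<in> ctrl_words s A B"

inductive_set obs_words :: "nat \<Rightarrow> 'a :: field mat \<Rightarrow> ('d \<Rightarrow> 'a mat \<Rightarrow> 'a mat) \<Rightarrow> 'a mat set"
  for s :: nat and C :: "'a :: field mat" and A :: "'d \<Rightarrow> 'a mat \<Rightarrow> 'a mat" where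
  base: "C \<in> obs_words s C A"
| step: "W \<in> obs_words s C A \<Longrightarrow> X \<in> carrier_mat s s \<Longrightarrow> W * A i X \<in> obs_words s C A"

text \<open>The sum of a family of subspaces is the span of their union.\<close>
definition fm_controllable :: "nat \<Rightarrow> nat \<Rightarrow> ('d \<Rightarrow> 'a :: field mat \<Rightarrow> 'a mat) \<Rightarrow>
    ('d \<Rightarrow> 'a mat \<Rightarrow> 'a mat) \<Rightarrow> bool" where
  "fm_controllable s L A B \<longleftrightarrow>
     LinearCombinations.module.span class_ring (module_vec TYPE('a) L)
       (\<Union>W \<in> ctrl_words s A B. vec_space.col_space L W) = carrier_vec L"

definition fm_observable :: "nat \<Rightarrow> nat \<Rightarrow> 'a :: field mat \<Rightarrow> ('d \<Rightarrow> 'a mat \<Rightarrow> 'a mat) \<Rightarrow> bool" where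
  "fm_observable s L C A \<longleftrightarrow> (\<Inter>W \<in> obs_words s C A. mat_kernel W) = {0\<^sub>v L}"

definition mat_comm :: "'a :: ring mat \<Rightarrow> 'a mat \<Rightarrow> 'a mat" where
  "mat_comm S Z = S * Z - Z * S"

definition linearized_lost_abbey :: "nat \<Rightarrow> nat \<Rightarrow> 'a :: field mat \<Rightarrow> 'a mat \<Rightarrow>
    ('d :: finite \<Rightarrow> 'a mat \<Rightarrow> 'a mat) \<Rightarrow> ('d \<Rightarrow> 'a mat \<Rightarrow> 'a mat) \<Rightarrow> ('d \<Rightarrow> 'a mat) \<Rightarrow> bool" where
  "linearized_lost_abbey s L D C A B Y \<longleftrightarrow>
    (\<forall>S \<in> carrier_mat s s. \<forall>Z1 \<in> carrier_mat s s. \<forall>Z2 \<in> carrier_mat s s. \<forall>i1 i2.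
      let AS = mat_sum L L (\<lambda>k. A k (mat_comm S (Y k)));
          BS = mat_sum L s (\<lambda>k. B k (mat_comm S (Y k)))
      in
        S * D - D * S = C * BS \<and>
        S * C * B i1 Z1 - C * B i1 (S * Z1) = C * AS * B i1 Z1 \<and>
        S * C * A i1 Z1 - C * A i1 (S * Z1) = C * AS * A i1 Z1 \<and>
        B i1 (Z1 * S) - B i1 Z1 * S = A i1 Z1 * BS \<and>
        A i1 (Z1 * S) * B i2 Z2 - A i1 Z1 * B i2 (S * Z2) = A i1 Z1 * AS * B i2 Z2 \<and>
        A i1 (Z1 * S) * A i2 Z2 - A i1 Z1 * A i2 (S * Z2) = A i1 Z1 * AS * A i2 Z2)"

section \<open>The realization over the free skew field\<close>

text \<open>The \<open>p \<times> q\<close> matrix \<open>\<Sum>\<^sub>k [T\<^sub>k(I\<^sub>s) x\<^sub>k - T\<^sub>k(Y\<^sub>k)]\<close>.\<close>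
definition skew_pencil :: "nat \<Rightarrow> nat \<Rightarrow> nat \<Rightarrow> ('d :: finite \<Rightarrow> 'a :: field mat \<Rightarrow> 'a mat) \<Rightarrow>
    ('d \<Rightarrow> 'a mat) \<Rightarrow> ('a, 'd) nc_ratfun mat" where
  "skew_pencil s p q T Y = mat p q (\<lambda>(i, j). \<Oplus>\<^bsub>free_skew_field\<^esub>k\<in>UNIV.
     nc_class (NC_Const (T k (1\<^sub>m s) $$ (i, j))) \<otimes>\<^bsub>free_skew_field\<^esub> nc_class (NC_Var k)
       \<ominus>\<^bsub>free_skew_field\<^esub> nc_class (NC_Const (T k (Y k) $$ (i, j))))"

definition skew_delta :: "nat \<Rightarrow> nat \<Rightarrow> ('d :: finite \<Rightarrow> 'a :: field mat \<Rightarrow> 'a mat) \<Rightarrow>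
    ('d \<Rightarrow> 'a mat) \<Rightarrow> ('a, 'd) nc_ratfun mat" where
  "skew_delta s L A Y =
     rmat_minus free_skew_field (rmat_scalar free_skew_field L \<one>\<^bsub>free_skew_field\<^esub>)
       (skew_pencil s L L A Y)"

definition skew_realization :: "nat \<Rightarrow> nat \<Rightarrow> 'a :: field mat \<Rightarrow> 'a mat \<Rightarrow>
    ('d :: finite \<Rightarrow> 'a mat \<Rightarrow> 'a mat) \<Rightarrow> ('d \<Rightarrow> 'a mat \<Rightarrow> 'a mat) \<Rightarrow> ('d \<Rightarrow> 'a mat) \<Rightarrow>
    ('a, 'd) nc_ratfun mat" where
  "skew_realization s L D C A B Y =
     rmat_add free_skew_field (map_mat (\<lambda>c. nc_class (NC_Const c)) D)
       (rmat_mult free_skew_field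
         (rmat_mult free_skew_field (map_mat (\<lambda>c. nc_class (NC_Const c)) C)
           (inv\<^bsub>rmat_ring free_skew_field L\<^esub> (skew_delta s L A Y)))
         (skew_pencil s L s B Y))"

end

theory Submission
  imports Defs
begin

text \<open>Controllability, observability and the lost-abbey conditions yield, for every
  \<open>s \<times> s\<close> matrix \<open>S\<close>, matrices \<open>U\<^sub>S\<close> and \<open>T\<^sub>S = U\<^sub>S + \<Sum>\<^sub>k A\<^sub>k([S, Y\<^sub>k])\<close> with
  \<open>U\<^sub>S A\<^sub>i(Z) = A\<^sub>i(S Z)\<close>, \<open>U\<^sub>S B\<^sub>i(Z) = B\<^sub>i(S Z)\<close>, \<open>A\<^sub>i(Z) T\<^sub>S = A\<^sub>i(Z S)\<close> and
  \<open>C T\<^sub>S = S C\<close>.  These intertwine \<open>\<delta>\<close>, that is \<open>U\<^sub>S \<delta> = \<delta> T\<^sub>S\<close>, so that the realization over the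
  free skew field commutes with every scalar matrix \<open>S\<close> and is therefore of the form \<open>I\<^sub>s \<otimes> f\<close>.  Taking for \<open>S\<close> the matrix units, they also relate the
  value of \<open>\<delta>\<close> at a point \<open>X\<close> to \<open>\<Lambda>(X)\<close>: if \<open>\<Lambda>(X)\<close> is invertible, then so is \<open>\<delta>(X)\<close>, and
  \<open>f(X)\<close> is the value of the realization.

  Amitsur's theorem is not needed to invert \<open>\<delta>\<close>.  If a matrix \<open>\<delta>\<close> of rational functions defined at \<open>X\<close>
  has an invertible value there, the inverse of this value is a polynomial \<open>p\<close> in it, so \<open>p(\<delta>) \<delta>\<close>
  has the value \<open>I\<close>, and Gaussian elimination on it only divides by pivots with value \<open>I\<close> at \<open>X\<close>.
  The same argument shows that the entries of \<open>\<delta>\<^sup>-\<^sup>1\<close> are defined at every such \<open>X\<close>.\<close>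

section \<open>Block matrices over a ring with a matrix representation\<close>

text \<open>Two obstacles shape the development. Equivalence of expressions means agreement on the
  common domain, so even its transitivity needs a point shared by several domains. Over a finite
  field there may be none of a given size; larger points arise by substituting a square matrix for
  the parameter of a line. Only then do the operations on classes form a ring, realized as the type
  \<open>ratf\<close>. Its elements do not commute, so determinants are taken only over commutative
  rings, after evaluation. The second obstacle is that \<delta>(X) has size
  \<open>L * (s * m)\<close> whereas \<Lambda>(X) has size \<open>L * m\<close>, so no similarity
  can relate them. Rectangular matrices assembled from \<open>U\<close> and \<open>T\<close> at the
  matrix units \<open>E_pr\<close> do, one pair for each \<open>r < s\<close>, and invertibility
  passes from \<Lambda>(X) to \<delta>(X) through the kernel. The operators \<open>U\<close> and
  \<open>T\<close> differ because \<open>S\<close> need not commute with the centre. The centre also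
  supplies the point to start from: \<Lambda>(Y) is the identity, so \<delta> has an invertible
  value at \<open>Y\<close>.\<close>

lemma sum_div_mod:
  fixes f :: "nat \<Rightarrow> nat \<Rightarrow> 'b :: comm_monoid_add"
  shows "(\<Sum>x<n * k. f (x div k) (x mod k)) = (\<Sum>i<n. \<Sum>a<k. f i a)"
proof -
  have "(\<Sum>x<n * k. f (x div k) (x mod k)) = (\<Sum>i<n. \<Sum>x\<in>{i * k..<i * k + k}. f (x div k) (x mod k))"
    by (rule sum.nat_group[symmetric])
  also have "\<dots> = (\<Sum>i<n. \<Sum>a<k. f i a)"
  proof (rule sum.cong[OF refl])
    fix i
    have "(\<Sum>x\<in>{i * k..<i * k + k}. f (x div k) (x mod k))
        = (\<Sum>a\<in>{0..<k}. f ((a + i * k) div k) ((a + i * k) mod k))"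
      using sum.shift_bounds_nat_ivl[of "\<lambda>x. f (x div k) (x mod k)" 0 "i * k" k]
      by (simp add: add.commute)
    also have "\<dots> = (\<Sum>a<k. f i a)"
      by (rule sum.cong) auto
    finally show "(\<Sum>x\<in>{i * k..<i * k + k}. f (x div k) (x mod k)) = (\<Sum>a<k. f i a)" .
  qed
  finally show ?thesis .
qed

lemma index_mult_mat_sum:
  assumes "M \<in> carrier_mat p q" "N \<in> carrier_mat q r" "i < p" "j < r"
  shows "(M * N) $$ (i, j) = (\<Sum>k<q. M $$ (i, k) * N $$ (k, j))"
  using assms by (auto simp: scalar_prod_def lessThan_atLeast0 intro!: sum.cong)

lemma block_index_less: "i < n * k \<Longrightarrow> i div k < n \<and> i mod k < k" for i n k :: nat
  by (metis less_mult_imp_div_less mod_less_divisor mult_0_right neq0_conv not_less_zero)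

text \<open>Four representations are fed to \<open>blk\<close>: evaluation of polynomials at a
  scalar, \<open>K[t] / (q)\<close>, scalars as scalar matrices, and rational functions at a point.
  In the flattened index \<open>i * k + a\<close> the index \<open>i\<close> of \<open>M\<close> is
  outermost.\<close>

definition blk :: "nat \<Rightarrow> ('r \<Rightarrow> 'b mat) \<Rightarrow> 'r mat \<Rightarrow> 'b mat" where
  "blk k h M = mat (dim_row M * k) (dim_col M * k)
     (\<lambda>(i, j). h (M $$ (i div k, j div k)) $$ (i mod k, j mod k))"

definition mats :: "'r set \<Rightarrow> nat \<Rightarrow> nat \<Rightarrow> 'r mat set" where
  "mats S p q = {M \<in> carrier_mat p q. \<forall>i<p. \<forall>j<q. M $$ (i, j) \<in> S}"

lemma matsD: "M \<in> mats S p q \<Longrightarrow> M \<in> carrier_mat p q"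
  "M \<in> mats S p q \<Longrightarrow> i < p \<Longrightarrow> j < q \<Longrightarrow> M $$ (i, j) \<in> S"
  unfolding mats_def by auto

lemma matsI: "M \<in> carrier_mat p q \<Longrightarrow> (\<And>i j. i < p \<Longrightarrow> j < q \<Longrightarrow> M $$ (i, j) \<in> S) \<Longrightarrow> M \<in> mats S p q"
  unfolding mats_def by auto

lemma mats_UNIV: "mats UNIV p q = carrier_mat p q"
  unfolding mats_def by auto

lemma blk_carrier [simp]: "M \<in> carrier_mat p q \<Longrightarrow> blk k h M \<in> carrier_mat (p * k) (q * k)"
  unfolding blk_def by auto

lemma blk_dim [simp]: "dim_row (blk k h M) = dim_row M * k" "dim_col (blk k h M) = dim_col M * k"
  unfolding blk_def by auto

lemma blk_index: "M \<in> carrier_mat p q \<Longrightarrow> i < p * k \<Longrightarrow> j < q * k \<Longrightarrow>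
  blk k h M $$ (i, j) = h (M $$ (i div k, j div k)) $$ (i mod k, j mod k)"
  unfolding blk_def by auto

lemma block_index_combine: "i < n \<Longrightarrow> a < k \<Longrightarrow> i * k + a < n * k" for i n a k :: nat
proof -
  assume "i < n" "a < k"
  then have "i * k + a < Suc i * k" by simp
  also have "\<dots> \<le> n * k" using \<open>i < n\<close> by (intro mult_le_mono1) simp
  finally show ?thesis .
qed

lemma blk_index': "M \<in> carrier_mat p q \<Longrightarrow> i < p \<Longrightarrow> j < q \<Longrightarrow> a < k \<Longrightarrow> b < k \<Longrightarrow>
  blk k h M $$ (i * k + a, j * k + b) = h (M $$ (i, j)) $$ (a, b)"
  by (subst blk_index) (auto simp: block_index_combine)

lemma block_matrix_eqI:
  assumes "M \<in> carrier_mat (p * k) (q * l)" "N \<in> carrier_mat (p * k) (q * l)"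
    and "\<And>i j a b. i < p \<Longrightarrow> j < q \<Longrightarrow> a < k \<Longrightarrow> b < l \<Longrightarrow>
      M $$ (i * k + a, j * l + b) = N $$ (i * k + a, j * l + b)"
  shows "M = N"
proof (rule eq_matI)
  fix x y assume "x < dim_row N" "y < dim_col N"
  then have "x < p * k" "y < q * l" using assms by auto
  then have "M $$ ((x div k) * k + x mod k, (y div l) * l + y mod l)
      = N $$ ((x div k) * k + x mod k, (y div l) * l + y mod l)"
    using block_index_less[of x p k] block_index_less[of y q l] by (intro assms(3)) auto
  then show "M $$ (x, y) = N $$ (x, y)" by simp
qed (use assms in auto)

text \<open>The set \<open>S\<close> is there for rational functions: evaluation at a point is a
  homomorphism on those defined at the point, and meaningless elsewhere.\<close>

locale matrix_rep =
  fixes k :: nat and h :: "'r :: ring_1 \<Rightarrow> 'b :: comm_ring_1 mat" and S :: "'r set"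
  assumes h_dim: "x \<in> S \<Longrightarrow> h x \<in> carrier_mat k k"
    and one_in: "1 \<in> S"
    and add_in: "x \<in> S \<Longrightarrow> y \<in> S \<Longrightarrow> x + y \<in> S"
    and mult_in: "x \<in> S \<Longrightarrow> y \<in> S \<Longrightarrow> x * y \<in> S"
    and uminus_in: "x \<in> S \<Longrightarrow> - x \<in> S"
    and h_one: "h 1 = 1\<^sub>m k"
    and h_add: "x \<in> S \<Longrightarrow> y \<in> S \<Longrightarrow> h (x + y) = h x + h y"
    and h_mult: "x \<in> S \<Longrightarrow> y \<in> S \<Longrightarrow> h (x * y) = h x * h y"
begin

lemma zero_in: "0 \<in> S"
  using add_in[OF one_in uminus_in[OF one_in]] by simp

lemma minus_in: "x \<in> S \<Longrightarrow> y \<in> S \<Longrightarrow> x - y \<in> S"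
  using add_in[of x "- y"] uminus_in[of y] by simp

lemma sum_in: "(\<And>i. i \<in> I \<Longrightarrow> f i \<in> S) \<Longrightarrow> sum f I \<in> S"
  by (induction I rule: infinite_finite_induct) (auto simp: zero_in add_in)

lemma h_zero: "h 0 = 0\<^sub>m k k"
proof -
  have "h (0 + 0) = h 0 + h 0" by (rule h_add[OF zero_in zero_in])
  then have "h 0 + h 0 = h 0" by simp
  then have "h 0 + h 0 - h 0 = h 0 - h 0" by simp
  moreover have "h 0 + h 0 - h 0 = h 0" "h 0 - h 0 = 0\<^sub>m k k"
    using h_dim[OF zero_in] by (auto intro!: eq_matI)
  ultimately show ?thesis by simp
qed

lemma h_uminus: "x \<in> S \<Longrightarrow> h (- x) = - h x"
proof -
  assume x: "x \<in> S"
  have "h (x + - x) = h x + h (- x)" by (rule h_add[OF x uminus_in[OF x]])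
  then have e: "h x + h (- x) = 0\<^sub>m k k" by (simp add: h_zero)
  show ?thesis
  proof (rule eq_matI)
    fix i j assume ij: "i < dim_row (- h x)" "j < dim_col (- h x)"
    have "(h x + h (- x)) $$ (i, j) = 0" unfolding e using ij h_dim[OF x] by auto
    then show "h (- x) $$ (i, j) = (- h x) $$ (i, j)"
      using ij h_dim[OF x] h_dim[OF uminus_in[OF x]] by (simp add: add_eq_0_iff)
  qed (use h_dim[OF x] h_dim[OF uminus_in[OF x]] in auto)
qed

lemma h_minus: "x \<in> S \<Longrightarrow> y \<in> S \<Longrightarrow> h (x - y) = h x - h y"
  using h_add[of x "- y"] h_uminus[of y] uminus_in[of y] h_dim[of x] h_dim[of y]
  by (auto simp: add_uminus_minus_mat)

lemma h_sum: "(\<And>i. i \<in> I \<Longrightarrow> f i \<in> S) \<Longrightarrow> a < k \<Longrightarrow> b < k \<Longrightarrow>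
  h (sum f I) $$ (a, b) = (\<Sum>i\<in>I. h (f i) $$ (a, b))"
proof (induction I rule: infinite_finite_induct)
  case (insert x F)
  then show ?case
    using h_dim[of "f x"] h_dim[of "sum f F"] sum_in[of F f] by (auto simp: h_add)
qed (auto simp: h_zero)

lemma mats_add: "M \<in> mats S p q \<Longrightarrow> N \<in> mats S p q \<Longrightarrow> M + N \<in> mats S p q"
  by (rule matsI) (auto simp: mats_def add_in)

lemma mats_mult: "M \<in> mats S p q \<Longrightarrow> N \<in> mats S q r \<Longrightarrow> M * N \<in> mats S p r"
  by (rule matsI) (auto simp: mats_def index_mult_mat_sum[of M p q N r] simp del: index_mult_mat(1)
    intro!: sum_in mult_in)

lemma mats_one: "1\<^sub>m p \<in> mats S p p"
  by (rule matsI) (auto simp: one_in zero_in)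

lemma blk_one: "blk k h (1\<^sub>m p) = 1\<^sub>m (p * k)"
  by (rule block_matrix_eqI[of _ p k p k])
    (auto simp: blk_index'[of _ p p] h_one h_zero block_index_combine,
      metis div_mult_self3 div_less add.right_neutral add_diff_cancel_left' gr_implies_not0)

lemma blk_add: "M \<in> mats S p q \<Longrightarrow> N \<in> mats S p q \<Longrightarrow> blk k h (M + N) = blk k h M + blk k h N"
proof -
  assume M: "M \<in> mats S p q" and N: "N \<in> mats S p q"
  note c = matsD(1)[OF M] matsD(1)[OF N]
  show ?thesis
  proof (rule block_matrix_eqI[of _ p k q k])
    fix i j a b assume *: "i < p" "j < q" "a < k" "b < k"
    have S: "M $$ (i, j) \<in> S" "N $$ (i, j) \<in> S" using matsD(2)[OF M] matsD(2)[OF N] * by auto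
    show "blk k h (M + N) $$ (i * k + a, j * k + b) = (blk k h M + blk k h N) $$ (i * k + a, j * k + b)"
      using * c blk_carrier[OF c(1), of k h] blk_carrier[OF c(2), of k h]
        block_index_combine[OF *(1,3)] block_index_combine[OF *(2,4)] h_dim[OF S(1)] h_dim[OF S(2)]
      by (auto simp: blk_index'[of _ p q] h_add S)
  qed (use c in auto)
qed

lemma blk_mult: "M \<in> mats S p q \<Longrightarrow> N \<in> mats S q r \<Longrightarrow> blk k h (M * N) = blk k h M * blk k h N"
proof -
  assume M: "M \<in> mats S p q" and N: "N \<in> mats S q r"
  note c = matsD(1)[OF M] matsD(1)[OF N]
  note bc = blk_carrier[OF c(1), of k h] blk_carrier[OF c(2), of k h]
  have mc: "M * N \<in> carrier_mat p r" using c by auto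
  show ?thesis
  proof (rule block_matrix_eqI[of _ p k r k])
    fix i j a b assume *: "i < p" "j < r" "a < k" "b < k"
    have S: "M $$ (i, l) \<in> S" "N $$ (l, j) \<in> S" if "l < q" for l
      using matsD(2)[OF M] matsD(2)[OF N] * that by auto
    have "(blk k h M * blk k h N) $$ (i * k + a, j * k + b)
       = (\<Sum>x<q * k. blk k h M $$ (i * k + a, x) * blk k h N $$ (x, j * k + b))"
      using * bc by (intro index_mult_mat_sum) (auto simp: block_index_combine)
    also have "\<dots> = (\<Sum>x<q * k. h (M $$ (i, x div k)) $$ (a, x mod k) * h (N $$ (x div k, j)) $$ (x mod k, b))"
      using * c by (intro sum.cong) (auto simp: blk_index block_index_combine)
    also have "\<dots> = (\<Sum>l<q. \<Sum>e<k. h (M $$ (i, l)) $$ (a, e) * h (N $$ (l, j)) $$ (e, b))"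
      by (rule sum_div_mod)
    also have "\<dots> = (\<Sum>l<q. h (M $$ (i, l) * N $$ (l, j)) $$ (a, b))"
      using * S h_dim by (intro sum.cong) (auto simp: h_mult index_mult_mat_sum[of _ k k _ k] simp del: index_mult_mat(1))
    also have "\<dots> = h (\<Sum>l<q. M $$ (i, l) * N $$ (l, j)) $$ (a, b)"
      using * S by (intro h_sum[symmetric]) (auto simp: mult_in)
    also have "\<dots> = blk k h (M * N) $$ (i * k + a, j * k + b)"
      using * c mc by (simp add: blk_index'[of _ p r] index_mult_mat_sum[of M p q N r] del: index_mult_mat(1))
    finally show "blk k h (M * N) $$ (i * k + a, j * k + b) = (blk k h M * blk k h N) $$ (i * k + a, j * k + b)"
      by simp
  qed (use bc mc in auto)
qed

end

section \<open>Evaluation of rational expressions along lines\<close>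

lemma the_mat_inverse_eq:
  fixes M :: "'a :: field mat"
  assumes M: "M \<in> carrier_mat n n" and N: "N \<in> carrier_mat n n" and MN: "M * N = 1\<^sub>m n"
  shows "invertible_mat M" and "the (mat_inverse M) = N"
proof -
  have NM: "N * M = 1\<^sub>m n" by (rule mat_mult_left_right_inverse[OF M N MN])
  show "invertible_mat M"
    unfolding invertible_mat_def inverts_mat_def square_mat.simps using M N MN NM by auto
  have "M \<in> Units (ring_mat TYPE('a) n ())"
    unfolding Units_def ring_mat_def using M N MN NM by auto
  then obtain N' where N': "mat_inverse M = Some N'"
    using mat_inverse(1)[OF M, of "()"] by (cases "mat_inverse M") auto
  from mat_inverse(2)[OF M N'] have *: "N' * M = 1\<^sub>m n" "N' \<in> carrier_mat n n" by auto
  have "N' = N' * (M * N)" using * MN by simp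
  also have "\<dots> = N" using * M N by (subst assoc_mult_mat[symmetric, of _ n n _ n _ n]) auto
  finally show "the (mat_inverse M) = N" using N' by simp
qed

lemma invertible_mat_the_inverse:
  fixes M :: "'a :: field mat"
  assumes M: "M \<in> carrier_mat n n" and "invertible_mat M"
  shows "the (mat_inverse M) \<in> carrier_mat n n" "M * the (mat_inverse M) = 1\<^sub>m n"
    "the (mat_inverse M) * M = 1\<^sub>m n"
proof -
  from assms obtain N where N: "M * N = 1\<^sub>m n" "N * M = 1\<^sub>m (dim_row N)"
    unfolding invertible_mat_def inverts_mat_def by auto
  have "N \<in> carrier_mat n n"
    using arg_cong[OF N(1), of dim_col] arg_cong[OF N(2), of dim_col] M by auto
  with the_mat_inverse_eq[OF M this N(1)] N show "the (mat_inverse M) \<in> carrier_mat n n"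
    "M * the (mat_inverse M) = 1\<^sub>m n" "the (mat_inverse M) * M = 1\<^sub>m n" by auto
qed

lemma nc_eval_carrier:
  "X \<in> mat_tuples n \<Longrightarrow> nc_defined n X R \<Longrightarrow> nc_eval n X R \<in> carrier_mat n n"
  by (induction R) (auto simp: mat_tuples_def invertible_mat_the_inverse)

text \<open>Such an \<open>h\<close> amounts to substituting the square matrix
  \<open>h [:0, 1:]\<close> for the variable. By \<open>h_const\<close> it is linear over the ground
  field, in agreement with the value of a constant expression.\<close>

locale poly_rep = matrix_rep k h UNIV for k and h :: "'a :: field poly \<Rightarrow> 'a mat" +
  assumes h_const: "h [:c:] = c \<cdot>\<^sub>m 1\<^sub>m k"
begin

lemma h_carrier: "h x \<in> carrier_mat k k"
  by (rule h_dim) simp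

text \<open>A factor sent to the identity can be inserted or dropped without changing the value;
  this is how numerators are brought to a common denominator.\<close>

lemma blk_smult_one:
  assumes "M \<in> carrier_mat p q" "h e = 1\<^sub>m k"
  shows "blk k h (e \<cdot>\<^sub>m M) = blk k h M"
  using assms h_carrier
  by (intro eq_matI) (auto simp: blk_index[of _ p q] h_mult left_mult_one_mat[OF h_carrier] block_index_less)

end

definition ev_rep :: "'a :: field \<Rightarrow> 'a poly \<Rightarrow> 'a mat" where
  "ev_rep t p = mat 1 1 (\<lambda>_. poly p t)"

lemma blk_ev_rep: "blk 1 (ev_rep t) M = map_mat (\<lambda>p. poly p t) M"
  unfolding blk_def ev_rep_def by (intro eq_matI) auto

lemma poly_rep_ev_rep: "poly_rep 1 (ev_rep t)"
  by unfold_locales (auto simp: ev_rep_def scalar_prod_def intro!: eq_matI)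

text \<open>A denominator \<open>g\<close> and a numerator \<open>Q\<close> for \<open>R\<close> along the polynomial curve \<open>P\<close>; \<open>t\<close> may be replaced
  by any square matrix at which \<open>g\<close> is invertible.\<close>
lemma lift_to_line:
  fixes P :: "'d \<Rightarrow> 'a :: field poly mat"
  assumes P: "\<And>k. P k \<in> carrier_mat n n"
    and "nc_defined n (\<lambda>k. blk 1 (ev_rep t) (P k)) R"
  shows "\<exists>g Q. Q \<in> carrier_mat n n \<and> poly g t \<noteq> 0 \<and>
    (\<forall>K \<phi> e. poly_rep K \<phi> \<longrightarrow> \<phi> (g * e) = 1\<^sub>m K \<longrightarrow>
      nc_defined (n * K) (\<lambda>k. blk K \<phi> (P k)) R \<and>
      nc_eval (n * K) (\<lambda>k. blk K \<phi> (P k)) R = blk K \<phi> (e \<cdot>\<^sub>m Q))"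
  using assms(2)
proof (induction R)
  case (NC_Const c)
  have "blk K \<phi> (e \<cdot>\<^sub>m ([:c:] \<cdot>\<^sub>m 1\<^sub>m n)) = c \<cdot>\<^sub>m 1\<^sub>m (n * K)"
    if "poly_rep K \<phi>" and e: "\<phi> (1 * e) = 1\<^sub>m K" for K and \<phi> :: "'a poly \<Rightarrow> 'a mat" and e
  proof -
    interpret poly_rep K \<phi> by fact
    have "blk K \<phi> (e \<cdot>\<^sub>m ([:c:] \<cdot>\<^sub>m 1\<^sub>m n)) = blk K \<phi> ([:c:] \<cdot>\<^sub>m 1\<^sub>m n)"
      using e by (intro blk_smult_one[of _ n n]) auto
    also have "\<dots> = c \<cdot>\<^sub>m blk K \<phi> (1\<^sub>m n)"
    proof (rule eq_matI)
      fix i j assume "i < dim_row (c \<cdot>\<^sub>m blk K \<phi> (1\<^sub>m n))" "j < dim_col (c \<cdot>\<^sub>m blk K \<phi> (1\<^sub>m n))"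
      then have "i < n * K" "j < n * K" by auto
      then show "blk K \<phi> ([:c:] \<cdot>\<^sub>m 1\<^sub>m n) $$ (i, j) = (c \<cdot>\<^sub>m blk K \<phi> (1\<^sub>m n)) $$ (i, j)"
        using block_index_less[of i n K] block_index_less[of j n K] h_const[of c]
        by (auto simp: blk_index[of _ n n] h_zero h_one)
    qed auto
    finally show ?thesis by (simp add: blk_one)
  qed
  then show ?case
    by (intro exI[of _ 1] exI[of _ "[:c:] \<cdot>\<^sub>m 1\<^sub>m n"]) auto
next
  case (NC_Var k)
  show ?case
    using P poly_rep.blk_smult_one[of _ _ "P k" n n]
    by (intro exI[of _ 1] exI[of _ "P k"]) auto
next
  case (NC_Add R1 R2)
  from NC_Add.IH(1) NC_Add.prems obtain g1 Q1 where Q1: "Q1 \<in> carrier_mat n n" and g1: "poly g1 t \<noteq> 0"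
    and 1: "\<And>K \<phi> e. poly_rep K \<phi> \<Longrightarrow> \<phi> (g1 * e) = 1\<^sub>m K \<Longrightarrow>
      nc_defined (n * K) (\<lambda>k. blk K \<phi> (P k)) R1 \<and>
      nc_eval (n * K) (\<lambda>k. blk K \<phi> (P k)) R1 = blk K \<phi> (e \<cdot>\<^sub>m Q1)"
    by auto
  from NC_Add.IH(2) NC_Add.prems obtain g2 Q2 where Q2: "Q2 \<in> carrier_mat n n" and g2: "poly g2 t \<noteq> 0"
    and 2: "\<And>K \<phi> e. poly_rep K \<phi> \<Longrightarrow> \<phi> (g2 * e) = 1\<^sub>m K \<Longrightarrow>
      nc_defined (n * K) (\<lambda>k. blk K \<phi> (P k)) R2 \<and>
      nc_eval (n * K) (\<lambda>k. blk K \<phi> (P k)) R2 = blk K \<phi> (e \<cdot>\<^sub>m Q2)"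
    by auto
  note Q = Q1 Q2 and g = g1 g2
  \<comment> \<open>Fractions are added over the product of the denominators: an inverse
    \<open>e\<close> of \<open>g1 * g2\<close> yields the inverses \<open>g2 * e\<close> of
    \<open>g1\<close> and \<open>g1 * e\<close> of \<open>g2\<close>.\<close>
  show ?case
  proof (intro exI[of _ "g1 * g2"] exI[of _ "g2 \<cdot>\<^sub>m Q1 + g1 \<cdot>\<^sub>m Q2"] conjI allI impI)
    fix K and \<phi> :: "'a poly \<Rightarrow> 'a mat" and e
    assume "poly_rep K \<phi>" and e: "\<phi> (g1 * g2 * e) = 1\<^sub>m K"
    interpret poly_rep K \<phi> by fact
    note 1 = 1[OF \<open>poly_rep K \<phi>\<close>, of "g2 * e"] and 2 = 2[OF \<open>poly_rep K \<phi>\<close>, of "g1 * e"]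
    have "e \<cdot>\<^sub>m (g2 \<cdot>\<^sub>m Q1 + g1 \<cdot>\<^sub>m Q2) = (g2 * e) \<cdot>\<^sub>m Q1 + (g1 * e) \<cdot>\<^sub>m Q2"
      using Q by (intro eq_matI) (auto simp: algebra_simps)
    then have "blk K \<phi> (e \<cdot>\<^sub>m (g2 \<cdot>\<^sub>m Q1 + g1 \<cdot>\<^sub>m Q2))
        = blk K \<phi> ((g2 * e) \<cdot>\<^sub>m Q1) + blk K \<phi> ((g1 * e) \<cdot>\<^sub>m Q2)"
      using Q by (simp add: blk_add[of _ n n] mats_UNIV)
    with 1 2 e show "nc_defined (n * K) (\<lambda>k. blk K \<phi> (P k)) (NC_Add R1 R2)"
      "nc_eval (n * K) (\<lambda>k. blk K \<phi> (P k)) (NC_Add R1 R2) = blk K \<phi> (e \<cdot>\<^sub>m (g2 \<cdot>\<^sub>m Q1 + g1 \<cdot>\<^sub>m Q2))"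
      by (auto simp: ac_simps)
  qed (use Q g in auto)
next
  case (NC_Mult R1 R2)
  from NC_Mult.IH(1) NC_Mult.prems obtain g1 Q1 where Q1: "Q1 \<in> carrier_mat n n" and g1: "poly g1 t \<noteq> 0"
    and 1: "\<And>K \<phi> e. poly_rep K \<phi> \<Longrightarrow> \<phi> (g1 * e) = 1\<^sub>m K \<Longrightarrow>
      nc_defined (n * K) (\<lambda>k. blk K \<phi> (P k)) R1 \<and>
      nc_eval (n * K) (\<lambda>k. blk K \<phi> (P k)) R1 = blk K \<phi> (e \<cdot>\<^sub>m Q1)"
    by auto
  from NC_Mult.IH(2) NC_Mult.prems obtain g2 Q2 where Q2: "Q2 \<in> carrier_mat n n" and g2: "poly g2 t \<noteq> 0"
    and 2: "\<And>K \<phi> e. poly_rep K \<phi> \<Longrightarrow> \<phi> (g2 * e) = 1\<^sub>m K \<Longrightarrow>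
      nc_defined (n * K) (\<lambda>k. blk K \<phi> (P k)) R2 \<and>
      nc_eval (n * K) (\<lambda>k. blk K \<phi> (P k)) R2 = blk K \<phi> (e \<cdot>\<^sub>m Q2)"
    by auto
  note Q = Q1 Q2 and g = g1 g2
  show ?case
  proof (intro exI[of _ "g1 * g2"] exI[of _ "Q1 * Q2"] conjI allI impI)
    fix K and \<phi> :: "'a poly \<Rightarrow> 'a mat" and e
    assume "poly_rep K \<phi>" and e: "\<phi> (g1 * g2 * e) = 1\<^sub>m K"
    interpret poly_rep K \<phi> by fact
    note 1 = 1[OF \<open>poly_rep K \<phi>\<close>, of "g2 * e"] and 2 = 2[OF \<open>poly_rep K \<phi>\<close>, of "g1 * e"]
    have "blk K \<phi> ((g2 * e) \<cdot>\<^sub>m Q1) * blk K \<phi> ((g1 * e) \<cdot>\<^sub>m Q2)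
        = blk K \<phi> (((g2 * e) \<cdot>\<^sub>m Q1) * ((g1 * e) \<cdot>\<^sub>m Q2))"
      using Q by (simp add: blk_mult[of _ n n _ n] mats_UNIV)
    also have "((g2 * e) \<cdot>\<^sub>m Q1) * ((g1 * e) \<cdot>\<^sub>m Q2) = (g1 * g2 * e) \<cdot>\<^sub>m (e \<cdot>\<^sub>m (Q1 * Q2))"
      using Q by (intro eq_matI) (auto simp: ac_simps)
    also have "blk K \<phi> \<dots> = blk K \<phi> (e \<cdot>\<^sub>m (Q1 * Q2))"
      using Q e by (intro blk_smult_one[of _ n n]) auto
    finally show "nc_defined (n * K) (\<lambda>k. blk K \<phi> (P k)) (NC_Mult R1 R2)"
      "nc_eval (n * K) (\<lambda>k. blk K \<phi> (P k)) (NC_Mult R1 R2) = blk K \<phi> (e \<cdot>\<^sub>m (Q1 * Q2))"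
      using 1 2 e by (auto simp: ac_simps)
  qed (use Q g in auto)
next
  case (NC_Inv R)
  then obtain g Q where Q: "Q \<in> carrier_mat n n" and g: "poly g t \<noteq> 0"
    and 1: "\<And>K \<phi> e. poly_rep K \<phi> \<Longrightarrow> \<phi> (g * e) = 1\<^sub>m K \<Longrightarrow>
      nc_defined (n * K) (\<lambda>k. blk K \<phi> (P k)) R \<and>
      nc_eval (n * K) (\<lambda>k. blk K \<phi> (P k)) R = blk K \<phi> (e \<cdot>\<^sub>m Q)"
    by auto
  \<comment> \<open>Evaluation at \<open>t\<close> is itself one of the representations, with
    \<open>?c\<close> inverse to \<open>g\<close>. It returns the given point of the line, where the
    value of \<open>R\<close> is invertible, and so shows that \<open>det Q\<close> does not vanish
    at \<open>t\<close>.\<close>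
  let ?c = "[:inverse (poly g t):]"
  have "ev_rep t (g * ?c) = 1\<^sub>m 1"
    using g by (auto simp: ev_rep_def intro!: eq_matI)
  from 1[OF poly_rep_ev_rep this]
  have "nc_eval n (\<lambda>k. blk 1 (ev_rep t) (P k)) R = blk 1 (ev_rep t) (?c \<cdot>\<^sub>m Q)" by simp
  with NC_Inv.prems have "invertible_mat (blk 1 (ev_rep t) (?c \<cdot>\<^sub>m Q))" by simp
  then have inv: "invertible_mat (map_mat (\<lambda>p. poly p t) (?c \<cdot>\<^sub>m Q))" unfolding blk_ev_rep .
  interpret ph: comm_ring_hom "\<lambda>p. poly p t" by unfold_locales auto
  have "det (map_mat (\<lambda>p. poly p t) (?c \<cdot>\<^sub>m Q)) \<noteq> 0"
  proof
    assume *: "det (map_mat (\<lambda>p. poly p t) (?c \<cdot>\<^sub>m Q)) = 0"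
    have c: "map_mat (\<lambda>p. poly p t) (?c \<cdot>\<^sub>m Q) \<in> carrier_mat n n" using Q by auto
    have "det (1\<^sub>m n :: 'a mat) = 0"
      unfolding invertible_mat_the_inverse(2)[OF c inv, symmetric]
        det_mult[OF c invertible_mat_the_inverse(1)[OF c inv]] * by (rule mult_zero_left)
    then show False by simp
  qed
  then have dQ: "poly (det Q) t \<noteq> 0" by (auto simp: ph.hom_det)
  note adj = adj_mat[OF Q]
  \<comment> \<open>The inverse of \<open>Q / g\<close> is \<open>g adj(Q) / det Q\<close>. It is
    written as \<open>g * g * adj(Q)\<close> over \<open>g * det Q\<close>, so that inverting the
    new denominator also inverts \<open>g\<close>.\<close>
  show ?case
  proof (intro exI[of _ "g * det Q"] exI[of _ "(g * g) \<cdot>\<^sub>m adj_mat Q"] conjI allI impI)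
    fix K and \<phi> :: "'a poly \<Rightarrow> 'a mat" and e
    assume "poly_rep K \<phi>" and e: "\<phi> (g * det Q * e) = 1\<^sub>m K"
    interpret poly_rep K \<phi> by fact
    note 1 = 1[OF \<open>poly_rep K \<phi>\<close>, of "det Q * e"]
    have "blk K \<phi> ((det Q * e) \<cdot>\<^sub>m Q) * blk K \<phi> (e \<cdot>\<^sub>m ((g * g) \<cdot>\<^sub>m adj_mat Q))
      = blk K \<phi> (((det Q * e) \<cdot>\<^sub>m Q) * (e \<cdot>\<^sub>m ((g * g) \<cdot>\<^sub>m adj_mat Q)))"
      using Q adj by (simp add: blk_mult[of _ n n _ n] mats_UNIV)
    also have "((det Q * e) \<cdot>\<^sub>m Q) * (e \<cdot>\<^sub>m ((g * g) \<cdot>\<^sub>m adj_mat Q))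
       = (det Q * e * e * g * g) \<cdot>\<^sub>m (Q * adj_mat Q)"
      using Q adj(1) by (intro eq_matI) (auto simp: ac_simps)
    also have "\<dots> = (g * det Q * e) \<cdot>\<^sub>m ((g * det Q * e) \<cdot>\<^sub>m 1\<^sub>m n)"
      unfolding adj(2) by (intro eq_matI) (auto simp: ac_simps)
    also have "blk K \<phi> \<dots> = blk K \<phi> ((g * det Q * e) \<cdot>\<^sub>m 1\<^sub>m n)"
      using e by (intro blk_smult_one[of _ n n]) auto
    also have "\<dots> = blk K \<phi> (1\<^sub>m n)"
      using e by (intro blk_smult_one[of _ n n]) auto
    finally have *: "blk K \<phi> ((det Q * e) \<cdot>\<^sub>m Q) * blk K \<phi> (e \<cdot>\<^sub>m ((g * g) \<cdot>\<^sub>m adj_mat Q)) = 1\<^sub>m (n * K)"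
      by (simp add: blk_one)
    have "blk K \<phi> ((det Q * e) \<cdot>\<^sub>m Q) \<in> carrier_mat (n * K) (n * K)"
      "blk K \<phi> (e \<cdot>\<^sub>m ((g * g) \<cdot>\<^sub>m adj_mat Q)) \<in> carrier_mat (n * K) (n * K)"
      using Q adj(1) by (auto intro!: blk_carrier)
    from the_mat_inverse_eq[OF this *] 1 e
    show "nc_defined (n * K) (\<lambda>k. blk K \<phi> (P k)) (NC_Inv R)"
      "nc_eval (n * K) (\<lambda>k. blk K \<phi> (P k)) (NC_Inv R) = blk K \<phi> (e \<cdot>\<^sub>m ((g * g) \<cdot>\<^sub>m adj_mat Q))"
      by (auto simp: ac_simps)
  qed (use Q g dQ adj(1) in auto)
qed

text \<open>Multiplication by \<open>p\<close> on \<open>K[t] / (q)\<close> in the basis of the monomials.\<close>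
definition mod_rep :: "'a :: field poly \<Rightarrow> 'a poly \<Rightarrow> 'a mat" where
  "mod_rep q p = mat (degree q) (degree q) (\<lambda>(i, j). coeff ((p * monom 1 j) mod q) i)"

lemma coeff_mod_sum: "coeff ((\<Sum>i\<in>I. f i) mod q) l = (\<Sum>i\<in>I. coeff (f i mod q) l)"
  for q :: "'a :: field poly"
  by (induction I rule: infinite_finite_induct) (auto simp: poly_mod_add_left)

lemma poly_rep_mod_rep:
  fixes q :: "'a :: field poly"
  assumes q: "degree q \<ge> 1"
  shows "poly_rep (degree q) (mod_rep q)"
proof unfold_locales
  let ?n = "degree q"
  show c: "mod_rep q x \<in> carrier_mat ?n ?n" for x unfolding mod_rep_def by auto
  have mono: "monom c j mod q = monom c j" if "j < ?n" for j and c :: 'a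
    using that degree_monom_le[of c j] by (intro mod_poly_less) auto
  show "mod_rep q 1 = 1\<^sub>m ?n"
    unfolding mod_rep_def by (intro eq_matI) (auto simp: mono coeff_monom)
  show "mod_rep q (x + y) = mod_rep q x + mod_rep q y" for x y
    unfolding mod_rep_def by (intro eq_matI) (auto simp: poly_mod_add_left ring_distribs)
  show "mod_rep q [:c:] = c \<cdot>\<^sub>m 1\<^sub>m ?n" for c
    unfolding mod_rep_def by (intro eq_matI) (auto simp: mono coeff_monom mod_smult_left)
  show "mod_rep q (x * y) = mod_rep q x * mod_rep q y" for x y
  proof (rule eq_matI)
    fix i j assume "i < dim_row (mod_rep q x * mod_rep q y)" "j < dim_col (mod_rep q x * mod_rep q y)"
    then have ij: "i < ?n" "j < ?n" using c[of x] c[of y] by auto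
    \<comment> \<open>Column \<open>j\<close> of \<open>mod_rep q y\<close> lists the coefficients
      of this remainder, so expanding it in monomials turns a product of classes into a product of
      matrices.\<close>
    define r where "r = (y * monom 1 j) mod q"
    have "q \<noteq> 0" using q by auto
    then have "degree r < ?n"
      using degree_mod_less[of q "y * monom 1 j"] q unfolding r_def by auto
    then have "degree r \<le> ?n - 1" by simp
    from poly_as_sum_of_monoms'[OF this] have r: "r = (\<Sum>l<?n. monom (coeff r l) l)"
    proof -
      have "{..?n - 1} = {..<?n}" using q by auto
      then show "(\<Sum>i\<le>?n - 1. monom (coeff r i) i) = r \<Longrightarrow> r = (\<Sum>l<?n. monom (coeff r l) l)" by simp
    qed
    have "mod_rep q (x * y) $$ (i, j) = coeff ((x * (y * monom 1 j)) mod q) i"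
      using ij by (simp add: mod_rep_def mult.assoc)
    also have "(x * (y * monom 1 j)) mod q = (x * r) mod q"
      unfolding r_def by (simp add: mod_mult_right_eq)
    also have "x * r = (\<Sum>l<?n. x * monom (coeff r l) l)"
      by (subst r) (simp add: sum_distrib_left)
    also have "coeff (\<dots> mod q) i = (\<Sum>l<?n. coeff ((x * monom (coeff r l) l) mod q) i)"
      by (rule coeff_mod_sum)
    also have "\<dots> = (\<Sum>l<?n. mod_rep q x $$ (i, l) * mod_rep q y $$ (l, j))"
    proof (rule sum.cong[OF refl])
      fix l assume "l \<in> {..<?n}"
      have "x * monom (coeff r l) l = Polynomial.smult (coeff r l) (x * monom 1 l)"
        by (subst mult_smult_right[symmetric]) (simp only: smult_monom mult_1_right)
      then show "coeff ((x * monom (coeff r l) l) mod q) i = mod_rep q x $$ (i, l) * mod_rep q y $$ (l, j)"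
        using ij \<open>l \<in> {..<?n}\<close> by (simp add: mod_rep_def mod_smult_left r_def)
    qed
    also have "\<dots> = (mod_rep q x * mod_rep q y) $$ (i, j)"
      using ij c by (intro index_mult_mat_sum[symmetric, of _ ?n ?n _ ?n])
    finally show "mod_rep q (x * y) $$ (i, j) = (mod_rep q x * mod_rep q y) $$ (i, j)" .
  qed (auto simp: mod_rep_def)
qed auto

lemma mod_rep_cong: "x mod q = y mod q \<Longrightarrow> mod_rep q x = mod_rep q y"
proof -
  assume *: "x mod q = y mod q"
  have "(x * z) mod q = (y * z) mod q" for z
    using * by (metis mod_mult_left_eq)
  then show ?thesis unfolding mod_rep_def by simp
qed

section \<open>Amplification of a point \<open>X\<close> to \<open>X \<otimes> I_m\<close>\<close>

definition amplify :: "nat \<Rightarrow> 'a :: field mat \<Rightarrow> 'a mat" where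
  "amplify m = blk m (\<lambda>c. c \<cdot>\<^sub>m 1\<^sub>m m)"

interpretation amplify_rep: matrix_rep m "\<lambda>c :: 'a :: field. c \<cdot>\<^sub>m 1\<^sub>m m" UNIV for m
  by unfold_locales (auto simp: add_smult_distrib_right_mat intro!: eq_matI)

lemma amplify_carrier: "M \<in> carrier_mat p q \<Longrightarrow> amplify m M \<in> carrier_mat (p * m) (q * m)"
  unfolding amplify_def by simp

lemma amplify_mult: "M \<in> carrier_mat p q \<Longrightarrow> N \<in> carrier_mat q r \<Longrightarrow>
  amplify m (M * N) = amplify m M * amplify m N"
  unfolding amplify_def by (rule amplify_rep.blk_mult) (auto simp: mats_UNIV)

lemma amplify_one: "amplify m (1\<^sub>m n) = 1\<^sub>m (n * m)"
  unfolding amplify_def by (rule amplify_rep.blk_one)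

text \<open>Amplification is a unital ring homomorphism, so it passes through every operation,
  inversion included. It brings points of sizes \<open>n\<close> and \<open>m\<close> to the common
  size \<open>n * m\<close>.\<close>

lemma nc_eval_amplify:
  assumes X: "X \<in> mat_tuples n" and "nc_defined n X R"
  shows "nc_defined (n * m) (\<lambda>k. amplify m (X k)) R \<and>
    nc_eval (n * m) (\<lambda>k. amplify m (X k)) R = amplify m (nc_eval n X R)"
  using assms(2)
proof (induction R)
  case (NC_Const c)
  have "amplify m (c \<cdot>\<^sub>m 1\<^sub>m n) = c \<cdot>\<^sub>m amplify m (1\<^sub>m n)"
    unfolding amplify_def
    by (rule eq_matI) (auto simp: blk_index[of _ n n] block_index_less)
  then show ?case by (simp add: amplify_one)
next
  case (NC_Add R1 R2)
  then have "nc_eval n X R1 \<in> carrier_mat n n" "nc_eval n X R2 \<in> carrier_mat n n"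
    using nc_eval_carrier[OF X] by auto
  then have "amplify m (nc_eval n X R1 + nc_eval n X R2) = amplify m (nc_eval n X R1) + amplify m (nc_eval n X R2)"
    unfolding amplify_def by (intro amplify_rep.blk_add[of _ n n]) (auto simp: mats_UNIV)
  with NC_Add show ?case by simp
next
  case (NC_Mult R1 R2)
  then have "nc_eval n X R1 \<in> carrier_mat n n" "nc_eval n X R2 \<in> carrier_mat n n"
    using nc_eval_carrier[OF X] by auto
  with NC_Mult show ?case by (simp add: amplify_mult)
next
  case (NC_Inv R)
  then have R: "nc_eval n X R \<in> carrier_mat n n" and inv: "invertible_mat (nc_eval n X R)"
    using nc_eval_carrier[OF X] by auto
  note i = invertible_mat_the_inverse[OF R inv]
  have "amplify m (nc_eval n X R) * amplify m (the (mat_inverse (nc_eval n X R))) = 1\<^sub>m (n * m)"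
    using amplify_mult[OF R i(1), of m] i(2) by (simp add: amplify_one)
  from the_mat_inverse_eq[OF amplify_carrier[OF R] amplify_carrier[OF i(1)] this] NC_Inv
  show ?case by auto
qed auto

text \<open>The line \<open>P(t)\<close> joins a point of the domain of \<open>U\<close> at \<open>t = 0\<close> to one of the domain of \<open>R\<close>
  at \<open>t = 1\<close>.  Over a small field no scalar \<open>t\<close> need do, but the class of \<open>t\<close> modulo
  \<open>1 + t g\<^sub>1 g\<^sub>2 e\<close> inverts \<open>g\<^sub>1\<close>, \<open>g\<^sub>2\<close> and \<open>e\<close>.\<close>
lemma common_point:
  fixes U R :: "('a :: field, 'd) nc_expr"
  assumes n: "n \<ge> 1" and X: "X \<in> nc_dom n U" and U0: "nc_eval n X U \<noteq> 0\<^sub>m n n"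
    and R: "nc_nondegenerate R"
  shows "\<exists>N\<ge>1. \<exists>Z \<in> nc_dom N U \<inter> nc_dom N R. nc_eval N Z U \<noteq> 0\<^sub>m N N"
proof -
  from R obtain m W where m: "m \<ge> 1" and W: "W \<in> nc_dom m R"
    unfolding nc_nondegenerate_def by auto
  define N where "N = n * m"
  define X' where "X' = (\<lambda>k. amplify m (X k))"
  define W' where "W' = (\<lambda>k. amplify n (W k))"
  have X't: "X' k \<in> carrier_mat N N" for k
    using X unfolding X'_def N_def nc_dom_def mat_tuples_def by (auto intro: amplify_carrier)
  have W't: "W' k \<in> carrier_mat N N" for k
    using W amplify_carrier[of "W k" m m n] unfolding W'_def N_def nc_dom_def mat_tuples_def
    by (auto simp: mult.commute)
  have U': "nc_defined N X' U" "nc_eval N X' U = amplify m (nc_eval n X U)"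
    using nc_eval_amplify[of X n U m] X unfolding N_def X'_def nc_dom_def by auto
  have R': "nc_defined N W' R"
    using nc_eval_amplify[of W m R n] W unfolding N_def W'_def nc_dom_def by (auto simp: mult.commute)
  have Uc: "nc_eval n X U \<in> carrier_mat n n"
    using nc_eval_carrier[of X n U] X unfolding nc_dom_def by auto
  with U0 obtain i j where ij: "i < n" "j < n" "nc_eval n X U $$ (i, j) \<noteq> 0"
    by (metis (no_types, lifting) carrier_matD eq_matI index_zero_mat)
  have "amplify m (nc_eval n X U) $$ (i * m + 0, j * m + 0) \<noteq> 0"
    unfolding amplify_def using ij m Uc by (subst blk_index') auto
  then have nz: "nc_eval N X' U $$ (i * m, j * m) \<noteq> 0" using U'(2) by simp
  have ijN: "i * m < N" "j * m < N"
    using ij m unfolding N_def by auto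
  define P where "P k = mat N N (\<lambda>(a, b). [: X' k $$ (a, b), W' k $$ (a, b) - X' k $$ (a, b) :])" for k
  have P: "P k \<in> carrier_mat N N" for k unfolding P_def by simp
  have P0: "(\<lambda>k. blk 1 (ev_rep 0) (P k)) = X'"
    unfolding blk_ev_rep P_def by (intro ext eq_matI) (simp_all add: carrier_matD[OF X't])
  have P1: "(\<lambda>k. blk 1 (ev_rep 1) (P k)) = W'"
    unfolding blk_ev_rep P_def by (intro ext eq_matI) (simp_all add: carrier_matD[OF W't])
  have "nc_defined N (\<lambda>k. blk 1 (ev_rep 0) (P k)) U" unfolding P0 by (rule U'(1))
  from lift_to_line[of P N 0 U, OF P this] obtain g1 Q1
    where Q1: "Q1 \<in> carrier_mat N N" and g1: "poly g1 0 \<noteq> 0"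
    and 1: "\<And>K \<phi> e. poly_rep K \<phi> \<Longrightarrow> \<phi> (g1 * e) = 1\<^sub>m K \<Longrightarrow>
      nc_defined (N * K) (\<lambda>k. blk K \<phi> (P k)) U \<and>
      nc_eval (N * K) (\<lambda>k. blk K \<phi> (P k)) U = blk K \<phi> (e \<cdot>\<^sub>m Q1)"
    by auto
  have "nc_defined N (\<lambda>k. blk 1 (ev_rep 1) (P k)) R" unfolding P1 by (rule R')
  from lift_to_line[of P N 1 R, OF P this] obtain g2 Q2
    where g2: "poly g2 1 \<noteq> 0"
    and 2: "\<And>K \<phi> e. poly_rep K \<phi> \<Longrightarrow> \<phi> (g2 * e) = 1\<^sub>m K \<Longrightarrow>
      nc_defined (N * K) (\<lambda>k. blk K \<phi> (P k)) R"
    by auto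
  \<comment> \<open>A nonzero entry of the numerator of \<open>U\<close>. It joins the factors to be
    inverted, so that \<open>U\<close> is not only defined but also nonzero at the new
    point.\<close>
  define e where "e = Q1 $$ (i * m, j * m)"
  have "e \<noteq> 0"
  proof -
    have "ev_rep 0 (g1 * [:inverse (poly g1 0):]) = 1\<^sub>m 1"
      using g1 by (auto simp: ev_rep_def intro!: eq_matI)
    from 1[OF poly_rep_ev_rep this]
    have "nc_eval N X' U = blk 1 (ev_rep 0) ([:inverse (poly g1 0):] \<cdot>\<^sub>m Q1)"
      unfolding P0 by simp
    then show ?thesis
      using nz ijN Q1 unfolding blk_ev_rep e_def by (auto simp del: mult_pCons_left)
  qed
  \<comment> \<open>The factor \<open>t\<close> contributed by \<open>pCons 0\<close> makes
    \<open>r\<close> nonconstant even when \<open>g1 * g2 * e\<close> is constant, so the quotient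
    by \<open>1 + r\<close> is nontrivial. In it \<open>- r\<close> becomes \<open>1\<close>, and
    \<open>g1\<close>, \<open>g2\<close> and \<open>e\<close> all divide \<open>- r\<close>.\<close>
  define r where "r = pCons 0 (g1 * g2 * e)"
  define q where "q = 1 + r"
  define K where "K = degree q"
  have "g1 * g2 * e \<noteq> 0" using g1 g2 \<open>e \<noteq> 0\<close> by auto
  then have "degree r \<ge> 1" unfolding r_def by simp
  then have K: "K \<ge> 1" unfolding K_def q_def by (subst degree_add_eq_right) auto
  define \<phi> where "\<phi> = mod_rep q"
  interpret poly_rep K \<phi>
    unfolding K_def \<phi>_def by (rule poly_rep_mod_rep) (use K K_def in auto)
  have r: "\<phi> (- r) = 1\<^sub>m K"
  proof -
    have "- r mod q = (- r + q) mod q" by simp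
    then have "- r mod q = 1 mod q" unfolding q_def by simp
    then have "\<phi> (- r) = \<phi> 1" unfolding \<phi>_def by (rule mod_rep_cong)
    then show ?thesis unfolding h_one .
  qed
  have rq: "- r = g1 * (pCons 0 (- g2 * e))" "- r = g2 * (pCons 0 (- g1 * e))"
    "- r = e * (pCons 0 (- g1 * g2))"
    unfolding r_def by (simp_all add: ac_simps)
  have 1: "nc_defined (N * K) (\<lambda>k. blk K \<phi> (P k)) U"
    "nc_eval (N * K) (\<lambda>k. blk K \<phi> (P k)) U = blk K \<phi> (pCons 0 (- g2 * e) \<cdot>\<^sub>m Q1)"
    using 1[OF poly_rep_axioms, of "pCons 0 (- g2 * e)"] r unfolding rq(1) by auto
  have 2: "nc_defined (N * K) (\<lambda>k. blk K \<phi> (P k)) R"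
    using 2[OF poly_rep_axioms, of "pCons 0 (- g1 * e)"] r unfolding rq(2) by auto
  have tup: "(\<lambda>k. blk K \<phi> (P k)) \<in> mat_tuples (N * K)"
    unfolding mat_tuples_def using P by auto
  \<comment> \<open>This product divides \<open>r * r\<close>, whose image is the identity matrix,
    so its own image cannot be zero as \<open>K\<close> is positive.\<close>
  have "\<phi> (pCons 0 (- g2 * e) * e) \<noteq> 0\<^sub>m K K"
  proof
    assume 0: "\<phi> (pCons 0 (- g2 * e) * e) = 0\<^sub>m K K"
    have "(- r) * (- r) = (e * pCons 0 (- g1 * g2)) * (g1 * pCons 0 (- g2 * e))"
      by (simp only: rq(1)[symmetric] rq(3)[symmetric])
    also have "\<dots> = (pCons 0 (- g2 * e) * e) * (g1 * pCons 0 (- g1 * g2))"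
      by (simp only: ac_simps)
    finally have "\<phi> ((- r) * (- r)) = \<phi> ((pCons 0 (- g2 * e) * e) * (g1 * pCons 0 (- g1 * g2)))"
      by (rule arg_cong)
    then have "\<phi> (- r) * \<phi> (- r) = \<phi> (pCons 0 (- g2 * e) * e) * \<phi> (g1 * pCons 0 (- g1 * g2))"
      by (simp only: h_mult UNIV_I)
    then have "1\<^sub>m K = (0\<^sub>m K K :: 'a mat)"
      unfolding r 0 using h_carrier[of "g1 * pCons 0 (- g1 * g2)"] by simp
    then have "(1\<^sub>m K :: 'a mat) $$ (0, 0) = 0\<^sub>m K K $$ (0, 0)" by simp
    then show False using K by simp
  qed
  then obtain a b where ab: "a < K" "b < K" "\<phi> (pCons 0 (- g2 * e) * e) $$ (a, b) \<noteq> 0"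
    using h_carrier[of "pCons 0 (- g2 * e) * e"]
    by (metis (no_types, lifting) carrier_matD eq_matI index_zero_mat)
  have "blk K \<phi> (pCons 0 (- g2 * e) \<cdot>\<^sub>m Q1) $$ (i * m * K + a, j * m * K + b) \<noteq> 0"
    using ab ijN Q1 by (subst blk_index'[of _ N N]) (auto simp: e_def)
  then have "nc_eval (N * K) (\<lambda>k. blk K \<phi> (P k)) U \<noteq> 0\<^sub>m (N * K) (N * K)"
    unfolding 1(2) using ab ijN by (auto simp: block_index_combine)
  moreover have "N * K \<ge> 1" using K n m unfolding N_def by simp
  ultimately show ?thesis
    using 1(1) 2 tup unfolding nc_dom_def by blast
qed

section \<open>Equivalence of rational expressions\<close>

lemma mat_eq_of_minus_eq_zero:
  fixes M N :: "'a :: ab_group_add mat"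
  assumes "M \<in> carrier_mat p q" "N \<in> carrier_mat p q" "M - N = 0\<^sub>m p q"
  shows "M = N"
proof (rule eq_matI)
  fix i j assume "i < dim_row N" "j < dim_col N"
  then show "M $$ (i, j) = N $$ (i, j)"
    using arg_cong[OF assms(3), of "\<lambda>M. M $$ (i, j)"] assms(1,2) by simp
qed (use assms in auto)

lemma nc_nondegenerateI: "n \<ge> 1 \<Longrightarrow> X \<in> nc_dom n R \<Longrightarrow> nc_nondegenerate R"
  unfolding nc_nondegenerate_def by auto

text \<open>The expression \<open>1 + 0 * R\<close> has the same domain as \<open>R\<close> and
  takes the value \<open>I\<close> there, which is nonzero in positive size;
  \<open>common_point\<close> applies to it.\<close>

lemma nc_nondegenerate_pair:
  fixes R T :: "('a :: field, 'd) nc_expr"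
  assumes "nc_nondegenerate R" "nc_nondegenerate T"
  obtains n X where "n \<ge> 1" "X \<in> nc_dom n R" "X \<in> nc_dom n T"
proof -
  from assms(1) obtain n X where n: "n \<ge> 1" and X: "X \<in> nc_dom n R"
    unfolding nc_nondegenerate_def by auto
  let ?U = "NC_Add (NC_Const 1) (NC_Mult (NC_Const 0) R)"
  have c: "nc_eval n X R \<in> carrier_mat n n"
    using nc_eval_carrier[of X n R] X unfolding nc_dom_def by auto
  have "nc_eval n X ?U = 1\<^sub>m n"
    using c by (auto intro!: eq_matI)
  then have "nc_eval n X ?U $$ (0, 0) \<noteq> 0\<^sub>m n n $$ (0, 0)" using n by auto
  then have "nc_eval n X ?U \<noteq> 0\<^sub>m n n" by metis
  moreover have "X \<in> nc_dom n ?U" using X unfolding nc_dom_def by auto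
  ultimately obtain N Z where "N \<ge> 1" "Z \<in> nc_dom N ?U" "Z \<in> nc_dom N T"
    using common_point[OF n _ _ assms(2), of X ?U] by auto
  then show ?thesis using that unfolding nc_dom_def by auto
qed

lemma nc_equiv_sym: "nc_equiv R T \<Longrightarrow> nc_equiv T R"
  unfolding nc_equiv_def by auto

lemma nc_equiv_refl: "nc_equiv R R"
  unfolding nc_equiv_def by auto

text \<open>At a point where \<open>R\<close> and \<open>V\<close> differ, \<open>T\<close> may be
  undefined. Applied to \<open>R - V\<close>, \<open>common_point\<close> moves to a point where
  they still differ and \<open>T\<close> is defined; there both values equal that of
  \<open>T\<close>.\<close>

lemma nc_equiv_trans:
  fixes R T V :: "('a :: field, 'd) nc_expr"
  assumes RT: "nc_equiv R T" and TV: "nc_equiv T V" and T: "nc_nondegenerate T"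
  shows "nc_equiv R V"
proof (rule ccontr)
  assume "\<not> nc_equiv R V"
  then obtain n X where n: "n \<ge> 1" and X: "X \<in> nc_dom n R" "X \<in> nc_dom n V"
    and ne: "nc_eval n X R \<noteq> nc_eval n X V"
    unfolding nc_equiv_def by auto
  let ?U = "NC_Add R (NC_Mult (NC_Const (- 1)) V)"
  have U: "nc_eval N Z ?U = nc_eval N Z R - nc_eval N Z V"
    if "Z \<in> nc_dom N R" "Z \<in> nc_dom N V" for N Z
  proof -
    have "nc_eval N Z R \<in> carrier_mat N N" "nc_eval N Z V \<in> carrier_mat N N"
      using that nc_eval_carrier[of Z N] unfolding nc_dom_def by auto
    then show ?thesis by (auto intro!: eq_matI)
  qed
  have "nc_eval n X R \<in> carrier_mat n n" "nc_eval n X V \<in> carrier_mat n n"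
    using X nc_eval_carrier[of X n] unfolding nc_dom_def by auto
  then have "nc_eval n X R - nc_eval n X V \<noteq> 0\<^sub>m n n"
    using ne mat_eq_of_minus_eq_zero by metis
  then have "nc_eval n X ?U \<noteq> 0\<^sub>m n n" using U[OF X] by simp
  moreover have "X \<in> nc_dom n ?U" using X unfolding nc_dom_def by auto
  ultimately obtain N Z where N: "N \<ge> 1" "Z \<in> nc_dom N ?U" "Z \<in> nc_dom N T"
    and Z: "nc_eval N Z ?U \<noteq> 0\<^sub>m N N"
    using common_point[OF n _ _ T, of X ?U] by auto
  then have d: "Z \<in> nc_dom N R" "Z \<in> nc_dom N V" unfolding nc_dom_def by auto
  have "nc_eval N Z R = nc_eval N Z V"
    using RT TV N d unfolding nc_equiv_def by force
  moreover have "nc_eval N Z V \<in> carrier_mat N N"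
    using d nc_eval_carrier[of Z N V] unfolding nc_dom_def by auto
  ultimately show False using Z U[OF d] by simp
qed

section \<open>The free skew field as a ring type\<close>

lemma nc_class_eq_iff:
  assumes "nc_nondegenerate R" "nc_nondegenerate T"
  shows "nc_class R = nc_class T \<longleftrightarrow> nc_equiv R T"
  unfolding nc_class_def using assms nc_equiv_trans nc_equiv_sym nc_equiv_refl by blast

text \<open>The carrier of the record is made a type so that, once it is an instance of
  \<open>ring_1\<close>, the ordinary matrix operations are those over the free skew field.\<close>

typedef (overloaded) ('a :: field, 'd) ratf = "{nc_class R | R :: ('a, 'd) nc_expr. nc_nondegenerate R}"
proof -
  have "(\<lambda>_. 1\<^sub>m 1) \<in> nc_dom 1 (NC_Const 1 :: ('a, 'd) nc_expr)"
    unfolding nc_dom_def mat_tuples_def by auto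
  then show ?thesis using nc_nondegenerateI[of 1] by blast
qed

definition rf :: "('a :: field, 'd) nc_expr \<Rightarrow> ('a, 'd) ratf" where
  "rf R = Abs_ratf (nc_class R)"

lemma Rep_rf: "nc_nondegenerate R \<Longrightarrow> Rep_ratf (rf R) = nc_class R"
  unfolding rf_def by (rule Abs_ratf_inverse) auto

lemma ratf_cases:
  obtains R where "nc_nondegenerate R" "f = rf R"
  using Rep_ratf[of f] Rep_ratf_inverse[of f] unfolding rf_def by auto

lemma rf_eq_iff: "nc_nondegenerate R \<Longrightarrow> nc_nondegenerate T \<Longrightarrow> rf R = rf T \<longleftrightarrow> nc_equiv R T"
  using nc_class_eq_iff[of R T] Rep_rf[of R] Rep_rf[of T] unfolding rf_def by metis

lemma nc_nondegenerate_Const: "nc_nondegenerate (NC_Const c)"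
  by (rule nc_nondegenerateI[of 1 "\<lambda>_. 1\<^sub>m 1"]) (auto simp: nc_dom_def mat_tuples_def)

lemma nc_nondegenerate_Var: "nc_nondegenerate (NC_Var k)"
  by (rule nc_nondegenerateI[of 1 "\<lambda>_. 1\<^sub>m 1"]) (auto simp: nc_dom_def mat_tuples_def)

lemma nc_dom_simps:
  "X \<in> nc_dom n (NC_Add R T) \<longleftrightarrow> X \<in> nc_dom n R \<and> X \<in> nc_dom n T"
  "X \<in> nc_dom n (NC_Mult R T) \<longleftrightarrow> X \<in> nc_dom n R \<and> X \<in> nc_dom n T"
  "X \<in> nc_dom n (NC_Inv R) \<longleftrightarrow> X \<in> nc_dom n R \<and> invertible_mat (nc_eval n X R)"
  "X \<in> nc_dom n (NC_Const c) \<longleftrightarrow> X \<in> mat_tuples n"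
  "X \<in> nc_dom n (NC_Var k) \<longleftrightarrow> X \<in> mat_tuples n"
  unfolding nc_dom_def by auto

lemma nc_dom_eval_carrier: "X \<in> nc_dom n R \<Longrightarrow> nc_eval n X R \<in> carrier_mat n n"
  using nc_eval_carrier[of X n R] unfolding nc_dom_def by auto

lemma nc_nondegenerate_Add: "nc_nondegenerate R \<Longrightarrow> nc_nondegenerate T \<Longrightarrow> nc_nondegenerate (NC_Add R T)"
  by (erule (1) nc_nondegenerate_pair) (auto simp: nc_dom_simps intro: nc_nondegenerateI)

lemma nc_nondegenerate_Mult: "nc_nondegenerate R \<Longrightarrow> nc_nondegenerate T \<Longrightarrow> nc_nondegenerate (NC_Mult R T)"
  by (erule (1) nc_nondegenerate_pair) (auto simp: nc_dom_simps intro: nc_nondegenerateI)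

lemmas nc_nondegenerate_intros = nc_nondegenerate_Add nc_nondegenerate_Mult
  nc_nondegenerate_Const nc_nondegenerate_Var

lemma rf_eqI:
  fixes R T :: "('a :: field, 'd) nc_expr"
  assumes "nc_nondegenerate R" "nc_nondegenerate T"
    and "\<And>n X. n \<ge> 1 \<Longrightarrow> X \<in> nc_dom n R \<Longrightarrow> X \<in> nc_dom n T \<Longrightarrow> nc_eval n X R = nc_eval n X T"
  shows "rf R = rf T"
  using assms unfolding rf_eq_iff[OF assms(1,2)] nc_equiv_def by auto

lemma nc_equiv_Add: "nc_equiv R R' \<Longrightarrow> nc_equiv T T' \<Longrightarrow> nc_equiv (NC_Add R T) (NC_Add R' T')"
  unfolding nc_equiv_def by (auto simp: nc_dom_simps)

lemma nc_equiv_Mult: "nc_equiv R R' \<Longrightarrow> nc_equiv T T' \<Longrightarrow> nc_equiv (NC_Mult R T) (NC_Mult R' T')"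
  unfolding nc_equiv_def by (auto simp: nc_dom_simps)

text \<open>The operations of the record are unions over all pairs of representatives. As the
  resulting class is the same for every pair, the union is that class.\<close>

lemma class_UN_eq:
  assumes F: "\<And>R' T'. nc_equiv R R' \<Longrightarrow> nc_equiv T T' \<Longrightarrow> nc_equiv (F R T) (F R' T')"
    and n: "\<And>R T. nc_nondegenerate R \<Longrightarrow> nc_nondegenerate T \<Longrightarrow> nc_nondegenerate (F R T)"
    and R: "nc_nondegenerate R" and T: "nc_nondegenerate T"
  shows "(\<Union>R'\<in>nc_class R. \<Union>T'\<in>nc_class T. nc_class (F R' T')) = nc_class (F R T)"
proof -
  have "nc_class (F R' T') = nc_class (F R T)" if "R' \<in> nc_class R" "T' \<in> nc_class T" for R' T'
    using that F[of R' T'] n R T nc_class_eq_iff[of "F R T" "F R' T'"] unfolding nc_class_def by auto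
  moreover have "R \<in> nc_class R" "T \<in> nc_class T"
    using R T nc_equiv_refl unfolding nc_class_def by auto
  ultimately show ?thesis by blast
qed

lemma free_skew_field_ops:
  assumes "nc_nondegenerate R" "nc_nondegenerate T"
  shows "nc_class R \<oplus>\<^bsub>free_skew_field\<^esub> nc_class T = nc_class (NC_Add R T)"
    and "nc_class R \<otimes>\<^bsub>free_skew_field\<^esub> nc_class T = nc_class (NC_Mult R T)"
  unfolding free_skew_field_def
  using class_UN_eq[where F = NC_Add, OF nc_equiv_Add nc_nondegenerate_Add assms]
    class_UN_eq[where F = NC_Mult, OF nc_equiv_Mult nc_nondegenerate_Mult assms] by auto

instantiation ratf :: (field, type) ring_1
begin

definition "0 = rf (NC_Const 0)"
definition "1 = rf (NC_Const 1)"
definition "f + g = Abs_ratf (Rep_ratf f \<oplus>\<^bsub>free_skew_field\<^esub> Rep_ratf g)"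
definition "f * g = Abs_ratf (Rep_ratf f \<otimes>\<^bsub>free_skew_field\<^esub> Rep_ratf g)"
definition "- (f :: ('a, 'b) ratf) = rf (NC_Const (- 1)) * f"
definition "(f :: ('a, 'b) ratf) - g = f + - g"

lemma rf_add: "nc_nondegenerate R \<Longrightarrow> nc_nondegenerate T \<Longrightarrow> rf R + rf T = rf (NC_Add R T)"
  unfolding plus_ratf_def by (simp add: Rep_rf free_skew_field_ops) (simp add: rf_def)

lemma rf_mult: "nc_nondegenerate R \<Longrightarrow> nc_nondegenerate T \<Longrightarrow> rf R * rf T = rf (NC_Mult R T)"
  unfolding times_ratf_def by (simp add: Rep_rf free_skew_field_ops) (simp add: rf_def)

instance
proof
  note defs = rf_add rf_mult nc_nondegenerate_intros zero_ratf_def one_ratf_def uminus_ratf_def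
    minus_ratf_def
  fix f g h :: "('a, 'b) ratf"
  obtain R where R: "nc_nondegenerate R" "f = rf R" by (rule ratf_cases)
  obtain T where T: "nc_nondegenerate T" "g = rf T" by (rule ratf_cases)
  obtain V where V: "nc_nondegenerate V" "h = rf V" by (rule ratf_cases)
  note RTV = R T V
  \<comment> \<open>Each ring law is an identity of matrices at every point where both sides are
    defined, and \<open>rf_eqI\<close> turns this into equality of classes.\<close>
  show "f + g + h = f + (g + h)" unfolding RTV using R(1) T(1) V(1)
    by (simp add: defs, intro rf_eqI) (auto simp: defs nc_dom_simps dest!: nc_dom_eval_carrier intro!: assoc_add_mat)
  show "f * g * h = f * (g * h)" unfolding RTV using R(1) T(1) V(1)
    by (simp add: defs, intro rf_eqI) (auto simp: defs nc_dom_simps dest!: nc_dom_eval_carrier intro!: assoc_mult_mat)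
  show "f + g = g + f" unfolding RTV using R(1) T(1)
    by (simp add: defs, intro rf_eqI) (auto simp: defs nc_dom_simps dest!: nc_dom_eval_carrier intro!: comm_add_mat)
  show "0 + f = f" unfolding RTV using R(1)
    by (simp add: defs, intro rf_eqI) (auto simp: defs nc_dom_simps dest!: nc_dom_eval_carrier intro!: eq_matI)
  show "- f + f = 0" unfolding RTV using R(1)
    by (simp add: defs, intro rf_eqI) (auto simp: defs nc_dom_simps dest!: nc_dom_eval_carrier intro!: eq_matI)
  show "f - g = f + - g" by (rule minus_ratf_def)
  show "1 * f = f" unfolding RTV using R(1)
    by (simp add: defs, intro rf_eqI) (auto simp: defs nc_dom_simps dest!: nc_dom_eval_carrier intro!: eq_matI)
  show "f * 1 = f" unfolding RTV using R(1)
    by (simp add: defs, intro rf_eqI) (auto simp: defs nc_dom_simps dest!: nc_dom_eval_carrier intro!: eq_matI)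
  show "(f + g) * h = f * h + g * h" unfolding RTV using R(1) T(1) V(1)
    by (simp add: defs, intro rf_eqI) (auto simp: defs nc_dom_simps dest!: nc_dom_eval_carrier intro!: add_mult_distrib_mat)
  show "h * (f + g) = h * f + h * g" unfolding RTV using R(1) T(1) V(1)
    by (simp add: defs, intro rf_eqI) (auto simp: defs nc_dom_simps dest!: nc_dom_eval_carrier intro!: mult_add_distrib_mat)
  have dom: "(\<lambda>_. 1\<^sub>m 1) \<in> nc_dom 1 (NC_Const c :: ('a, 'b) nc_expr)" for c
    unfolding nc_dom_def mat_tuples_def by auto
  have "\<not> nc_equiv (NC_Const 0 :: ('a, 'b) nc_expr) (NC_Const 1)"
  proof
    assume "nc_equiv (NC_Const 0 :: ('a, 'b) nc_expr) (NC_Const 1)"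
    then have "nc_eval 1 (\<lambda>_. 1\<^sub>m 1) (NC_Const 0 :: ('a, 'b) nc_expr) =
        nc_eval 1 (\<lambda>_. 1\<^sub>m 1) (NC_Const 1 :: ('a, 'b) nc_expr)"
      using dom[of 0] dom[of 1] unfolding nc_equiv_def by blast
    then have "(0 \<cdot>\<^sub>m 1\<^sub>m 1 :: 'a mat) $$ (0, 0) = (1 \<cdot>\<^sub>m 1\<^sub>m 1 :: 'a mat) $$ (0, 0)" by simp
    then show False by simp
  qed
  then show "(0 :: ('a, 'b) ratf) \<noteq> 1"
    unfolding zero_ratf_def one_ratf_def by (simp add: rf_eq_iff nc_nondegenerate_intros)
qed

end

section \<open>Domains and values of rational functions\<close>

definition rdef :: "nat \<Rightarrow> ('d \<Rightarrow> 'a :: field mat) \<Rightarrow> ('a, 'd) ratf set" where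
  "rdef n X = {f. X \<in> ratfun_dom n (Rep_ratf f)}"

definition reval :: "nat \<Rightarrow> ('d \<Rightarrow> 'a :: field mat) \<Rightarrow> ('a, 'd) ratf \<Rightarrow> 'a mat" where
  "reval n X f = ratfun_eval n (Rep_ratf f) X"

text \<open>The definite description in \<open>ratfun_eval\<close> is well determined because
  representatives defined at \<open>X\<close> agree there. Equivalence speaks of positive sizes
  only, hence \<open>n \<ge> 1\<close>.\<close>

lemma rdefI:
  assumes "n \<ge> 1" "X \<in> nc_dom n R"
  shows "rf R \<in> rdef n X" "reval n X (rf R) = nc_eval n X R"
proof -
  have R: "nc_nondegenerate R" using assms by (rule nc_nondegenerateI)
  then have mem: "R \<in> Rep_ratf (rf R)"
    by (simp add: Rep_rf) (simp add: nc_class_def nc_equiv_refl)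
  then show "rf R \<in> rdef n X" using assms unfolding rdef_def ratfun_dom_def by auto
  have "nc_eval n X T = nc_eval n X R" if "T \<in> Rep_ratf (rf R)" "X \<in> nc_dom n T" for T
    using that assms R by (auto simp: Rep_rf nc_class_def nc_equiv_def)
  with mem assms show "reval n X (rf R) = nc_eval n X R"
    unfolding reval_def ratfun_eval_def by (intro the_equality) blast+
qed

lemma rdefE:
  assumes "f \<in> rdef n X"
  obtains R where "nc_nondegenerate R" "f = rf R" "X \<in> nc_dom n R"
proof -
  obtain T where T: "nc_nondegenerate T" "f = rf T" by (rule ratf_cases)
  from assms obtain R where R: "R \<in> Rep_ratf f" "X \<in> nc_dom n R"
    unfolding rdef_def ratfun_dom_def by auto
  with T have "nc_nondegenerate R" "nc_equiv T R" by (auto simp: Rep_rf nc_class_def)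
  with T R show ?thesis by (intro that[of R]) (auto simp: rf_eq_iff)
qed

text \<open>The domain of a function is a union over its representatives. Sums and products are
  therefore formed from representatives chosen to be defined at \<open>X\<close>; another choice
  could fail to be.\<close>

lemma matrix_rep_reval:
  assumes n: "n \<ge> 1" and X: "X \<in> mat_tuples n"
  shows "matrix_rep n (reval n X) (rdef n X)"
proof
  have c: "rf (NC_Const c) \<in> rdef n X" "reval n X (rf (NC_Const c)) = c \<cdot>\<^sub>m 1\<^sub>m n" for c
    using rdefI[OF n, of X "NC_Const c"] X by (auto simp: nc_dom_simps)
  show "1 \<in> rdef n X" "reval n X 1 = 1\<^sub>m n" using c[of 1] unfolding one_ratf_def by auto
  fix f assume f: "f \<in> rdef n X"
  then obtain R where R: "nc_nondegenerate R" "f = rf R" "X \<in> nc_dom n R" by (rule rdefE)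
  show "reval n X f \<in> carrier_mat n n"
    unfolding R(2) rdefI(2)[OF n R(3)] by (rule nc_dom_eval_carrier[OF R(3)])
  show "- f \<in> rdef n X"
    using rdefI(1)[OF n, of X "NC_Mult (NC_Const (- 1)) R"] R X
    by (auto simp: uminus_ratf_def rf_mult nc_nondegenerate_intros nc_dom_simps)
  fix g assume g: "g \<in> rdef n X"
  then obtain T where T: "nc_nondegenerate T" "g = rf T" "X \<in> nc_dom n T" by (rule rdefE)
  have d: "X \<in> nc_dom n (NC_Add R T)" "X \<in> nc_dom n (NC_Mult R T)"
    using R T by (auto simp: nc_dom_simps)
  show "f + g \<in> rdef n X" "f * g \<in> rdef n X" "reval n X (f + g) = reval n X f + reval n X g"
    "reval n X (f * g) = reval n X f * reval n X g"
    using rdefI[OF n d(1)] rdefI[OF n d(2)] rdefI[OF n R(3)] rdefI[OF n T(3)] R T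
    by (auto simp: rf_add rf_mult)
qed

text \<open>An invertible value puts \<open>X\<close> into the domain of \<open>NC_Inv R\<close>,
  which makes this expression nondegenerate. A single point thus produces an inverse in the skew
  field.\<close>

lemma rdef_inverse:
  assumes n: "n \<ge> 1" and f: "f \<in> rdef n X" and inv: "invertible_mat (reval n X f)"
  shows "\<exists>g\<in>rdef n X. f * g = 1 \<and> g * f = 1"
proof -
  obtain R where R: "nc_nondegenerate R" "f = rf R" "X \<in> nc_dom n R" using f by (rule rdefE)
  have d: "X \<in> nc_dom n (NC_Inv R)"
    using inv R rdefI(2)[OF n R(3)] by (auto simp: nc_dom_simps)
  then have nd: "nc_nondegenerate (NC_Inv R)" by (rule nc_nondegenerateI[OF n])
  have "rf R * rf (NC_Inv R) = 1"
    unfolding rf_mult[OF R(1) nd] one_ratf_def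
    by (intro rf_eqI nc_nondegenerate_intros R nd)
      (auto simp: nc_dom_simps invertible_mat_the_inverse dest!: nc_dom_eval_carrier)
  moreover have "rf (NC_Inv R) * rf R = 1"
    unfolding rf_mult[OF nd R(1)] one_ratf_def
    by (intro rf_eqI nc_nondegenerate_intros R nd)
      (auto simp: nc_dom_simps invertible_mat_the_inverse dest!: nc_dom_eval_carrier)
  ultimately show ?thesis using rdefI(1)[OF n d] R(2) by blast
qed

section \<open>Constants and variables\<close>

definition rconst :: "'a :: field \<Rightarrow> ('a, 'd) ratf" where
  "rconst c = rf (NC_Const c)"

definition rvar :: "'d \<Rightarrow> ('a :: field, 'd) ratf" where
  "rvar k = rf (NC_Var k)"

lemma rconst_rdef:
  assumes "n \<ge> 1" "X \<in> mat_tuples n"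
  shows "rconst c \<in> rdef n X" "reval n X (rconst c) = c \<cdot>\<^sub>m 1\<^sub>m n"
  using rdefI[OF assms(1), of X "NC_Const c"] assms(2) by (auto simp: rconst_def nc_dom_simps)

lemma rvar_rdef:
  assumes "n \<ge> 1" "X \<in> mat_tuples n"
  shows "rvar k \<in> rdef n X" "reval n X (rvar k) = X k"
  using rdefI[OF assms(1), of X "NC_Var k"] assms(2) by (auto simp: rvar_def nc_dom_simps)

lemma rconst_zero: "rconst 0 = 0" and rconst_one: "rconst 1 = 1"
  unfolding rconst_def zero_ratf_def one_ratf_def by auto

lemma rconst_add: "rconst (a + b) = rconst a + rconst b"
proof -
  have "rf (NC_Const (a + b)) = rf (NC_Add (NC_Const a) (NC_Const b))"
    by (intro rf_eqI nc_nondegenerate_intros) (simp, intro eq_matI, auto simp: algebra_simps)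
  then show ?thesis unfolding rconst_def by (simp add: rf_add nc_nondegenerate_intros)
qed

lemma rconst_mult: "rconst (a * b) = rconst a * rconst b"
proof -
  have "rf (NC_Const (a * b)) = rf (NC_Mult (NC_Const a) (NC_Const b))"
    by (intro rf_eqI nc_nondegenerate_intros) (simp, intro eq_matI, auto)
  then show ?thesis unfolding rconst_def by (simp add: rf_mult nc_nondegenerate_intros)
qed

lemma rconst_commute: "rconst c * f = f * rconst c"
proof -
  obtain R where R: "nc_nondegenerate R" "f = rf R" by (rule ratf_cases)
  show ?thesis unfolding R rconst_def using R(1)
    by (simp add: rf_mult nc_nondegenerate_intros, intro rf_eqI)
      (auto simp: nc_nondegenerate_intros nc_dom_simps dest!: nc_dom_eval_carrier intro!: eq_matI)
qed

section \<open>Inverses of matrices with invertible evaluation\<close>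

text \<open>A polynomial in \<open>M\<close>, coefficients listed from the constant term up. The
  Horner form exposes the constant coefficient, and it is built from sums, products and scalars, so
  it can be lifted from a value to matrices of rational functions.\<close>

primrec horner :: "nat \<Rightarrow> 'a :: field mat \<Rightarrow> 'a list \<Rightarrow> 'a mat" where
  "horner n M [] = 0\<^sub>m n n"
| "horner n M (c # cs) = c \<cdot>\<^sub>m 1\<^sub>m n + M * horner n M cs"

lemma horner_carrier: "M \<in> carrier_mat n n \<Longrightarrow> horner n M cs \<in> carrier_mat n n"
  by (induction cs) auto

definition left_pow :: "nat \<Rightarrow> 'a :: field mat \<Rightarrow> nat \<Rightarrow> 'a mat" where
  "left_pow n M i = ((*) M ^^ i) (1\<^sub>m n)"

lemma left_pow_carrier: "M \<in> carrier_mat n n \<Longrightarrow> left_pow n M i \<in> carrier_mat n n"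
  unfolding left_pow_def by (induction i) auto

lemma horner_index:
  assumes M: "M \<in> carrier_mat n n" and ab: "a < n" "b < n"
  shows "horner n M cs $$ (a, b) = (\<Sum>i<length cs. cs ! i * left_pow n M i $$ (a, b))"
  using ab(1)
proof (induction cs arbitrary: a)
  case (Cons c cs)
  have "(M * horner n M cs) $$ (a, b) = (\<Sum>e<n. M $$ (a, e) * horner n M cs $$ (e, b))"
    by (rule index_mult_mat_sum[OF M horner_carrier[OF M] Cons.prems ab(2)])
  also have "\<dots> = (\<Sum>e<n. \<Sum>i<length cs. cs ! i * (M $$ (a, e) * left_pow n M i $$ (e, b)))"
    using Cons.IH by (intro sum.cong) (auto simp: sum_distrib_left ac_simps)
  also have "\<dots> = (\<Sum>i<length cs. cs ! i * (\<Sum>e<n. M $$ (a, e) * left_pow n M i $$ (e, b)))"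
    by (subst sum.swap) (simp add: sum_distrib_left)
  also have "\<dots> = (\<Sum>i<length cs. cs ! i * left_pow n M (Suc i) $$ (a, b))"
    using index_mult_mat_sum[OF M left_pow_carrier[OF M] Cons.prems ab(2)]
    by (simp add: left_pow_def del: index_mult_mat(1))
  finally have "(M * horner n M cs) $$ (a, b) = (\<Sum>i<length cs. cs ! i * left_pow n M (Suc i) $$ (a, b))" .
  moreover have "horner n M (c # cs) $$ (a, b)
      = c * left_pow n M 0 $$ (a, b) + (M * horner n M cs) $$ (a, b)"
    using M horner_carrier[OF M, of cs] Cons.prems ab(2)
    by (simp add: left_pow_def del: index_mult_mat(1))
  moreover have "(\<Sum>i<length (c # cs). (c # cs) ! i * left_pow n M i $$ (a, b))
      = c * left_pow n M 0 $$ (a, b) + (\<Sum>i<length cs. cs ! i * left_pow n M (Suc i) $$ (a, b))"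
    by (simp only: length_Cons sum.lessThan_Suc_shift) simp
  ultimately show ?case by simp
qed (use ab in simp)

text \<open>The \<open>n * n + 1\<close> first powers of \<open>M\<close> are linearly dependent in
  a space of dimension \<open>n * n\<close>.\<close>

lemma exists_horner_zero:
  fixes M :: "'a :: field mat"
  assumes M: "M \<in> carrier_mat n n"
  shows "\<exists>cs. horner n M cs = 0\<^sub>m n n \<and> (\<exists>c\<in>set cs. c \<noteq> 0)"
proof -
  let ?r = "Suc (n * n)"
  \<comment> \<open>The columns are the powers of \<open>M\<close>, flattened to vectors. A zero row
    makes the matrix square, so that it has determinant zero and its kernel provides the
    dependence.\<close>
  define Z where "Z = mat ?r ?r (\<lambda>(x, i). if x < n * n then left_pow n M i $$ (x div n, x mod n) else 0)"
  have Z: "Z \<in> carrier_mat ?r ?r" unfolding Z_def by simp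
  have "transpose_mat Z *\<^sub>v unit_vec ?r (n * n) = 0\<^sub>v ?r"
    by (rule eq_vecI) (auto simp: Z_def scalar_prod_def)
  moreover have "(unit_vec ?r (n * n) :: 'a vec) \<noteq> 0\<^sub>v ?r"
  proof
    assume "(unit_vec ?r (n * n) :: 'a vec) = 0\<^sub>v ?r"
    then have "(unit_vec ?r (n * n) :: 'a vec) $ (n * n) = 0\<^sub>v ?r $ (n * n)" by simp
    then show False by simp
  qed
  ultimately have "det (transpose_mat Z) = 0"
    using det_0_iff_vec_prod_zero_field[of "transpose_mat Z" ?r] Z
    by (metis transpose_carrier_mat unit_vec_carrier)
  then have "det Z = 0" using det_transpose[OF Z] by simp
  then obtain v where v: "v \<in> carrier_vec ?r" "v \<noteq> 0\<^sub>v ?r" "Z *\<^sub>v v = 0\<^sub>v ?r"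
    using det_0_iff_vec_prod_zero_field[OF Z] by auto
  define cs where "cs = map (\<lambda>i. v $ i) [0..<?r]"
  have "horner n M cs = 0\<^sub>m n n"
  proof (rule eq_matI)
    fix a b assume "a < dim_row (0\<^sub>m n n :: 'a mat)" "b < dim_col (0\<^sub>m n n :: 'a mat)"
    then have ab: "a < n" "b < n" by auto
    have x: "a * n + b < n * n" using ab by (rule block_index_combine)
    have "horner n M cs $$ (a, b) = (\<Sum>i<?r. v $ i * left_pow n M i $$ (a, b))"
      unfolding horner_index[OF M ab] by (auto simp: cs_def simp del: upt_Suc intro!: sum.cong)
    also have "\<dots> = (Z *\<^sub>v v) $ (a * n + b)"
      using x ab v(1) by (auto simp: Z_def scalar_prod_def lessThan_atLeast0 ac_simps intro!: sum.cong)
    also have "\<dots> = 0" unfolding v(3) using x by simp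
    finally show "horner n M cs $$ (a, b) = 0\<^sub>m n n $$ (a, b)" using ab by simp
  qed (use horner_carrier[OF M, of cs] in auto)
  moreover have "\<exists>c\<in>set cs. c \<noteq> 0"
  proof (rule ccontr)
    assume *: "\<not> (\<exists>c\<in>set cs. c \<noteq> 0)"
    have "v $ i = 0" if "i < ?r" for i
    proof -
      have "v $ i \<in> set cs" unfolding cs_def set_map using that by (intro imageI) (simp del: upt_Suc)
      with * show ?thesis by blast
    qed
    then have "v = 0\<^sub>v ?r" using v(1) by (intro eq_vecI) auto
    with v(2) show False by simp
  qed
  ultimately show ?thesis by blast
qed

text \<open>In an annihilating polynomial, factors \<open>M\<close> are cancelled with
  \<open>N\<close> as long as the constant coefficient vanishes. Once it is some
  \<open>c \<noteq> 0\<close>, the equation \<open>c I + M H = 0\<close> exhibits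
  \<open>- inverse c\<close> times \<open>H\<close> as the inverse.\<close>

lemma exists_horner_inverse:
  fixes M :: "'a :: field mat"
  assumes M: "M \<in> carrier_mat n n" and N: "N \<in> carrier_mat n n" and NM: "N * M = 1\<^sub>m n"
  shows "\<exists>cs. M * horner n M cs = 1\<^sub>m n"
proof -
  have "\<exists>ds d. M * (d \<cdot>\<^sub>m horner n M ds) = 1\<^sub>m n" if "horner n M cs = 0\<^sub>m n n" "\<exists>c\<in>set cs. c \<noteq> 0" for cs
    using that
  proof (induction cs)
    case (Cons c cs)
    note H = horner_carrier[OF M, of cs]
    show ?case
    proof (cases "c = 0")
      case True
      have "horner n M cs = N * M * horner n M cs" using NM H by simp
      also have "\<dots> = N * (M * horner n M cs)" by (rule assoc_mult_mat[OF N M H])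
      also have "M * horner n M cs = horner n M (c # cs)"
        using True M H by (auto intro!: eq_matI)
      finally have "horner n M cs = 0\<^sub>m n n" using Cons.prems(1) N by simp
      with Cons True show ?thesis by auto
    next
      case False
      have "M * ((- inverse c) \<cdot>\<^sub>m horner n M cs) = 1\<^sub>m n"
      proof (rule eq_matI)
        fix i j assume "i < dim_row (1\<^sub>m n :: 'a mat)" "j < dim_col (1\<^sub>m n :: 'a mat)"
        then have ij: "i < n" "j < n" by auto
        have MH: "M * horner n M cs \<in> carrier_mat n n" using M H by simp
        have "horner n M (c # cs) $$ (i, j) = 0" unfolding Cons.prems(1) using ij by simp
        then have "c * 1\<^sub>m n $$ (i, j) + (M * horner n M cs) $$ (i, j) = 0"
          using ij carrier_matD[OF MH] by (simp del: index_mult_mat index_one_mat(1))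
        then have "(M * horner n M cs) $$ (i, j) = - c * 1\<^sub>m n $$ (i, j)"
          by (simp add: eq_neg_iff_add_eq_0 add.commute del: index_mult_mat(1) index_one_mat(1))
        then show "(M * ((- inverse c) \<cdot>\<^sub>m horner n M cs)) $$ (i, j) = 1\<^sub>m n $$ (i, j)"
          unfolding mult_smult_distrib[OF M H] using ij carrier_matD[OF MH] False
          by (simp del: index_mult_mat index_one_mat(1))
      qed (use M H in auto)
      then show ?thesis by blast
    qed
  qed simp
  moreover have "\<exists>es. horner n M es = d \<cdot>\<^sub>m horner n M ds" for d ds
  proof (induction ds)
    case (Cons c ds)
    then obtain es where es: "horner n M es = d \<cdot>\<^sub>m horner n M ds" by auto
    have "horner n M ((d * c) # es) = d \<cdot>\<^sub>m horner n M (c # ds)"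
      using M horner_carrier[OF M, of ds] by (simp add: es, intro eq_matI) (auto simp: algebra_simps)
    then show ?case by blast
  qed (auto intro!: exI[of _ "[]"])
  ultimately show ?thesis using exists_horner_zero[OF M] by metis
qed

text \<open>An invertibility property as in a local ring, asked for at value \<open>I\<close>, is
  what elimination uses. The elements from \<open>scalar_in\<close> lift the coefficients of a
  polynomial in a value.\<close>

locale inverse_closed_rep = matrix_rep k h S for k and h :: "'r :: ring_1 \<Rightarrow> 'b :: field mat" and S +
  assumes left_inverse_in: "x \<in> S \<Longrightarrow> h x = 1\<^sub>m k \<Longrightarrow> \<exists>y\<in>S. y * x = 1"
    and scalar_in: "\<exists>x\<in>S. h x = c \<cdot>\<^sub>m 1\<^sub>m k"
begin

lemma blk_eq_one_iff:
  assumes E: "E \<in> mats S n n"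
  shows "blk k h E = 1\<^sub>m (n * k) \<longleftrightarrow>
    (\<forall>i<n. \<forall>j<n. h (E $$ (i, j)) = (if i = j then 1\<^sub>m k else 0\<^sub>m k k))"
proof
  note c = matsD(1)[OF E]
  assume e: "blk k h E = 1\<^sub>m (n * k)"
  show "\<forall>i<n. \<forall>j<n. h (E $$ (i, j)) = (if i = j then 1\<^sub>m k else 0\<^sub>m k k)"
  proof (intro allI impI)
    fix i j assume ij: "i < n" "j < n"
    show "h (E $$ (i, j)) = (if i = j then 1\<^sub>m k else 0\<^sub>m k k)"
    proof (rule eq_matI)
      fix a b assume "a < dim_row (if i = j then 1\<^sub>m k else 0\<^sub>m k k :: 'b mat)"
        "b < dim_col (if i = j then 1\<^sub>m k else 0\<^sub>m k k :: 'b mat)"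
      then have ab: "a < k" "b < k" by (auto split: if_splits)
      have "h (E $$ (i, j)) $$ (a, b) = blk k h E $$ (i * k + a, j * k + b)"
        by (rule blk_index'[OF c ij ab, symmetric])
      also have "\<dots> = blk k h (1\<^sub>m n) $$ (i * k + a, j * k + b)" unfolding e blk_one ..
      also have "\<dots> = h (1\<^sub>m n $$ (i, j)) $$ (a, b)"
        by (rule blk_index'[OF one_carrier_mat ij ab])
      finally show "h (E $$ (i, j)) $$ (a, b) = (if i = j then 1\<^sub>m k else 0\<^sub>m k k) $$ (a, b)"
        using ij by (auto simp: h_one h_zero)
    qed (use h_dim[OF matsD(2)[OF E ij]] in auto)
  qed
next
  note c = matsD(1)[OF E]
  assume *: "\<forall>i<n. \<forall>j<n. h (E $$ (i, j)) = (if i = j then 1\<^sub>m k else 0\<^sub>m k k)"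
  have "blk k h E = blk k h (1\<^sub>m n)"
    using c * by (intro block_matrix_eqI[of _ n k n k]) (auto simp: blk_index'[of _ n n] h_one h_zero)
  then show "blk k h E = 1\<^sub>m (n * k)" by (simp add: blk_one)
qed

text \<open>Gaussian elimination, column by column: all pivots evaluate to the identity.\<close>
lemma exists_left_inverse_columns:
  assumes "c \<le> n" "E \<in> mats S n n" "blk k h E = 1\<^sub>m (n * k)"
    and "\<And>i j. c \<le> j \<Longrightarrow> j < n \<Longrightarrow> i < n \<Longrightarrow> E $$ (i, j) = (if i = j then 1 else 0)"
  shows "\<exists>V\<in>mats S n n. V * E = 1\<^sub>m n"
  using assms
proof (induction c arbitrary: E)
  case 0
  then have "E = 1\<^sub>m n" using matsD(1)[OF 0(2)] by (intro eq_matI) auto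
  then show ?case by (intro bexI[OF _ mats_one]) auto
next
  case (Suc c)
  note E = matsD[OF Suc.prems(2)]
  have hE: "h (E $$ (i, j)) = (if i = j then 1\<^sub>m k else 0\<^sub>m k k)" if "i < n" "j < n" for i j
    using Suc.prems(3) that blk_eq_one_iff[OF Suc.prems(2)] by auto
  have c: "c < n" using Suc.prems(1) by simp
  obtain u where u: "u \<in> S" "u * E $$ (c, c) = 1"
    using left_inverse_in[OF E(2)[OF c c]] hE[OF c c] by auto
  have "h u * h (E $$ (c, c)) = 1\<^sub>m k"
    using u h_mult[OF u(1) E(2)[OF c c]] h_one by simp
  then have hu: "h u = 1\<^sub>m k" using hE[OF c c] h_dim[OF u(1)] by simp
  \<comment> \<open>The elementary matrix that turns column \<open>c\<close> into a unit column. It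
    alters the later columns only through row \<open>c\<close>, where they are zero, and has value
    \<open>I\<close> since the entries of \<open>E\<close> off the diagonal have value zero.\<close>
  define G where "G = mat n n (\<lambda>(i, j). if j = c then (if i = c then u else - (E $$ (i, c) * u))
    else if i = j then 1 else 0)"
  have Gc: "G \<in> carrier_mat n n" unfolding G_def by simp
  have G: "G \<in> mats S n n"
    by (rule matsI) (auto simp: G_def u one_in zero_in c intro!: uminus_in mult_in E(2))
  have "blk k h G = 1\<^sub>m (n * k)"
    unfolding blk_eq_one_iff[OF G]
    using c h_dim[OF u(1)] by (auto simp: G_def hu h_one h_zero h_uminus h_mult mult_in E(2) u hE)
  then have "blk k h (G * E) = 1\<^sub>m (n * k)"
    using Suc.prems(3) blk_mult[OF G Suc.prems(2)] by simp
  moreover have "(G * E) $$ (i, j) = (if i = j then 1 else 0)"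
    if ij: "c \<le> j" "j < n" "i < n" for i j
  proof -
    have "(G * E) $$ (i, j) = (\<Sum>l<n. G $$ (i, l) * E $$ (l, j))"
      by (rule index_mult_mat_sum[OF Gc E(1) ij(3,2)])
    also have "\<dots> = (\<Sum>l<n. (if l = c then G $$ (i, c) * E $$ (c, j) else 0)
        + (if l = i then if i = c then 0 else E $$ (i, j) else 0))"
      using ij c by (intro sum.cong) (auto simp: G_def)
    also have "\<dots> = G $$ (i, c) * E $$ (c, j) + (if i = c then 0 else E $$ (i, j))"
      using c ij by (simp add: sum.distrib)
    also have "\<dots> = (if i = j then 1 else 0)"
      using c ij Suc.prems(4)[of j] u(2) by (cases "j = c") (auto simp: G_def mult.assoc)
    finally show ?thesis .
  qed
  ultimately obtain V where V: "V \<in> mats S n n" "V * (G * E) = 1\<^sub>m n"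
    using Suc.IH[of "G * E"] c mats_mult[OF G Suc.prems(2)] by auto
  then have "(V * G) * E = 1\<^sub>m n" using matsD(1)[OF V(1)] Gc E(1) by (simp add: assoc_mult_mat)
  then show ?case using mats_mult[OF V(1) G] by blast
qed

text \<open>Over a noncommutative ring a left inverse may fail to be a right inverse. But the left
  inverse \<open>V\<close> has value \<open>I\<close> too, hence a left inverse \<open>W\<close> of
  its own, and \<open>W = W V E = E\<close>.\<close>

lemma exists_inverse_of_blk_one:
  assumes E: "E \<in> mats S n n" and E1: "blk k h E = 1\<^sub>m (n * k)"
  shows "\<exists>V\<in>mats S n n. V * E = 1\<^sub>m n \<and> E * V = 1\<^sub>m n"
proof -
  obtain V where V: "V \<in> mats S n n" "V * E = 1\<^sub>m n"
    using exists_left_inverse_columns[OF order_refl E E1] by auto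
  have "blk k h V = blk k h V * blk k h E"
    unfolding E1 by (rule right_mult_one_mat[OF blk_carrier[OF matsD(1)[OF V(1)]], symmetric])
  then have "blk k h V = 1\<^sub>m (n * k)"
    using blk_mult[OF V(1) E] V(2) by (simp add: blk_one)
  then obtain W where W: "W \<in> mats S n n" "W * V = 1\<^sub>m n"
    using exists_left_inverse_columns[OF order_refl V(1)] by auto
  have "W = W * (V * E)" using V W(1) matsD(1) by (metis right_mult_one_mat)
  also have "\<dots> = E"
    using matsD(1)[OF W(1)] matsD(1)[OF V(1)] matsD(1)[OF E] W(2)
    by (subst assoc_mult_mat[symmetric, of _ n n _ n _ n]) auto
  finally show ?thesis using V W by auto
qed

text \<open>An arbitrary matrix of size \<open>n * k\<close> over the field need not be the value of
  a matrix over \<open>S\<close>; a polynomial in the value of \<open>D\<close> is. This is why the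
  inverse is sought in that form.\<close>

lemma horner_in_blk_image:
  assumes D: "D \<in> mats S n n"
  shows "\<exists>W\<in>mats S n n. blk k h W = horner (n * k) (blk k h D) cs"
proof (induction cs)
  case Nil
  have "0\<^sub>m n n \<in> mats S n n" by (rule matsI) (auto simp: zero_in)
  moreover have "blk k h (0\<^sub>m n n) = 0\<^sub>m (n * k) (n * k)"
    by (rule eq_matI) (auto simp: blk_index[of _ n n] h_zero block_index_less)
  ultimately show ?case by auto
next
  case (Cons c cs)
  then obtain W where W: "W \<in> mats S n n" "blk k h W = horner (n * k) (blk k h D) cs" by auto
  obtain x where x: "x \<in> S" "h x = c \<cdot>\<^sub>m 1\<^sub>m k" using scalar_in by auto
  define Z where "Z = mat n n (\<lambda>(i, j). if i = j then x else 0)"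
  have Z: "Z \<in> mats S n n" by (rule matsI) (auto simp: Z_def x zero_in)
  have "blk k h Z = c \<cdot>\<^sub>m blk k h (1\<^sub>m n)"
    by (rule block_matrix_eqI[of _ n k n k])
      (auto simp: blk_index'[of _ n n] h_zero h_one x Z_def block_index_combine)
  then have "blk k h (Z + D * W) = horner (n * k) (blk k h D) (c # cs)"
    using W Z mats_mult[OF D W(1)] by (simp add: blk_add blk_mult[OF D W(1)] blk_one)
  moreover have "Z + D * W \<in> mats S n n" by (intro mats_add Z mats_mult[OF D W(1)])
  ultimately show ?case by auto
qed

lemma exists_inverse_of_blk_invertible:
  assumes D: "D \<in> mats S n n" and det: "det (blk k h D) \<noteq> 0"
  shows "\<exists>V\<in>mats S n n. V * D = 1\<^sub>m n \<and> D * V = 1\<^sub>m n"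
proof -
  note Dc = matsD(1)[OF D]
  have M: "blk k h D \<in> carrier_mat (n * k) (n * k)" using Dc by (rule blk_carrier)
  obtain N where N: "N \<in> carrier_mat (n * k) (n * k)" "N * blk k h D = 1\<^sub>m (n * k)"
    using det_non_zero_imp_unit[OF M det, of "()"] unfolding Units_def ring_mat_def by auto
  obtain cs where cs: "blk k h D * horner (n * k) (blk k h D) cs = 1\<^sub>m (n * k)"
    using exists_horner_inverse[OF M N] by auto
  obtain W where W: "W \<in> mats S n n" "blk k h W = horner (n * k) (blk k h D) cs"
    using horner_in_blk_image[OF D] by blast
  note Wc = matsD(1)[OF W(1)]
  have DW: "blk k h (D * W) = 1\<^sub>m (n * k)"
    using cs W blk_mult[OF D W(1)] by simp
  have WD: "blk k h (W * D) = 1\<^sub>m (n * k)"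
    using mat_mult_left_right_inverse[OF M blk_carrier[OF Wc, of k h]] cs W blk_mult[OF W(1) D] by simp
  obtain V where V: "V \<in> mats S n n" "V * (W * D) = 1\<^sub>m n"
    using exists_inverse_of_blk_one[OF mats_mult[OF W(1) D] WD] by auto
  obtain V' where V': "V' \<in> mats S n n" "(D * W) * V' = 1\<^sub>m n"
    using exists_inverse_of_blk_one[OF mats_mult[OF D W(1)] DW] by auto
  note c = Dc Wc matsD(1)[OF V(1)] matsD(1)[OF V'(1)]
  have 1: "(V * W) * D = 1\<^sub>m n" using V(2) assoc_mult_mat[OF c(3,2,1)] by simp
  have 2: "D * (W * V') = 1\<^sub>m n" using V'(2) assoc_mult_mat[OF c(1,2,4)] by simp
  have "V * W = (V * W) * (D * (W * V'))" using 2 c by simp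
  also have "\<dots> = W * V'"
    using 1 c by (subst assoc_mult_mat[symmetric, of _ n n _ n _ n]) auto
  finally show ?thesis using 1 2 mats_mult[OF V(1) W(1)] by auto
qed

end

lemma inverse_closed_rep_reval:
  assumes n: "n \<ge> 1" and X: "X \<in> mat_tuples n"
  shows "inverse_closed_rep n (reval n X) (rdef n X)"
proof -
  interpret matrix_rep n "reval n X" "rdef n X" by (rule matrix_rep_reval[OF n X])
  show ?thesis
  proof
    fix f assume "f \<in> rdef n X" "reval n X f = 1\<^sub>m n"
    then show "\<exists>g\<in>rdef n X. g * f = 1"
      using rdef_inverse[OF n, of f X] the_mat_inverse_eq(1)[of "1\<^sub>m n" n "1\<^sub>m n"] by auto
  next
    show "\<exists>x\<in>rdef n X. reval n X x = c \<cdot>\<^sub>m 1\<^sub>m n" for c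
      using rconst_rdef[OF n X] by blast
  qed
qed

section \<open>The action of the coefficient algebra on the state space\<close>

lemma sum_rotate:
  "(\<Sum>e\<in>I. \<Sum>a\<in>J. \<Sum>b\<in>K. f e a b) = (\<Sum>a\<in>J. \<Sum>b\<in>K. \<Sum>e\<in>I. f e a b)"
proof -
  have "(\<Sum>e\<in>I. \<Sum>a\<in>J. \<Sum>b\<in>K. f e a b) = (\<Sum>a\<in>J. \<Sum>e\<in>I. \<Sum>b\<in>K. f e a b)"
    by (rule sum.swap)
  also have "\<dots> = (\<Sum>a\<in>J. \<Sum>b\<in>K. \<Sum>e\<in>I. f e a b)"
    by (intro sum.cong[OF refl]) (rule sum.swap)
  finally show ?thesis .
qed

lemma minus_swap:
  fixes V X Z :: "'a :: ab_group_add mat"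
  shows "X \<in> carrier_mat p q \<Longrightarrow> Z \<in> carrier_mat p q \<Longrightarrow> V \<in> carrier_mat p q \<Longrightarrow>
    X - Z = V \<Longrightarrow> X - V = Z"
  by (intro eq_matI) auto

lemma mat_minus_add_cancel:
  fixes X V :: "'a :: ab_group_add mat"
  shows "X \<in> carrier_mat p q \<Longrightarrow> V \<in> carrier_mat p q \<Longrightarrow> X - V + V = X"
  by (intro eq_matI) auto

lemma mat_sum_carrier [simp]: "mat_sum p q F \<in> carrier_mat p q"
  unfolding mat_sum_def by simp

lemma mat_sum_dim [simp]: "dim_row (mat_sum p q F) = p" "dim_col (mat_sum p q F) = q"
  unfolding mat_sum_def by auto

lemma mat_sum_index: "i < p \<Longrightarrow> j < q \<Longrightarrow> mat_sum p q F $$ (i, j) = (\<Sum>k\<in>UNIV. F k $$ (i, j))"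
  unfolding mat_sum_def by simp

lemma mult_mat_sum:
  fixes M :: "'a :: field mat"
  assumes M: "M \<in> carrier_mat p q" and F: "\<And>k. F k \<in> carrier_mat q r"
  shows "M * mat_sum q r F = mat_sum p r (\<lambda>k. M * F k)"
proof (rule eq_matI)
  fix i j assume "i < dim_row (mat_sum p r (\<lambda>k. M * F k))" "j < dim_col (mat_sum p r (\<lambda>k. M * F k))"
  then have ij: "i < p" "j < r" by (auto simp: mat_sum_def)
  have "(M * mat_sum q r F) $$ (i, j) = (\<Sum>l<q. M $$ (i, l) * (\<Sum>k\<in>UNIV. F k $$ (l, j)))"
    using ij by (simp add: index_mult_mat_sum[OF M mat_sum_carrier ij] mat_sum_index del: index_mult_mat)
  also have "\<dots> = (\<Sum>k\<in>UNIV. \<Sum>l<q. M $$ (i, l) * F k $$ (l, j))"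
    by (simp add: sum_distrib_left) (rule sum.swap)
  also have "\<dots> = mat_sum p r (\<lambda>k. M * F k) $$ (i, j)"
    using ij by (simp add: index_mult_mat_sum[OF M F ij] mat_sum_index del: index_mult_mat)
  finally show "(M * mat_sum q r F) $$ (i, j) = mat_sum p r (\<lambda>k. M * F k) $$ (i, j)" .
qed (use M in \<open>auto simp: mat_sum_def\<close>)

lemma mat_sum_mult:
  fixes M :: "'a :: field mat"
  assumes M: "M \<in> carrier_mat q r" and F: "\<And>k. F k \<in> carrier_mat p q"
  shows "mat_sum p q F * M = mat_sum p r (\<lambda>k. F k * M)"
proof (rule eq_matI)
  fix i j assume "i < dim_row (mat_sum p r (\<lambda>k. F k * M))" "j < dim_col (mat_sum p r (\<lambda>k. F k * M))"
  then have ij: "i < p" "j < r" by (auto simp: mat_sum_def)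
  have "(mat_sum p q F * M) $$ (i, j) = (\<Sum>l<q. (\<Sum>k\<in>UNIV. F k $$ (i, l)) * M $$ (l, j))"
    using ij by (simp add: index_mult_mat_sum[OF mat_sum_carrier M ij] mat_sum_index del: index_mult_mat)
  also have "\<dots> = (\<Sum>k\<in>UNIV. \<Sum>l<q. F k $$ (i, l) * M $$ (l, j))"
    by (simp add: sum_distrib_right) (rule sum.swap)
  also have "\<dots> = mat_sum p r (\<lambda>k. F k * M) $$ (i, j)"
    using ij by (simp add: index_mult_mat_sum[OF F M ij] mat_sum_index del: index_mult_mat)
  finally show "(mat_sum p q F * M) $$ (i, j) = mat_sum p r (\<lambda>k. F k * M) $$ (i, j)" .
qed (use M in \<open>auto simp: mat_sum_def\<close>)

section \<open>Matrix units and linear maps on matrices\<close>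

definition unit_mat :: "nat \<Rightarrow> nat \<Rightarrow> nat \<Rightarrow> 'a :: ring_1 mat" where
  "unit_mat n p q = mat n n (\<lambda>(i, j). if i = p \<and> j = q then 1 else 0)"

lemma unit_mat_carrier [simp]: "unit_mat n p q \<in> carrier_mat n n"
  unfolding unit_mat_def by simp

lemma unit_mat_dim [simp]: "dim_row (unit_mat n p q) = n" "dim_col (unit_mat n p q) = n"
  unfolding unit_mat_def by auto

lemma unit_mat_index: "i < n \<Longrightarrow> j < n \<Longrightarrow> unit_mat n p q $$ (i, j) = (if i = p \<and> j = q then 1 else 0)"
  unfolding unit_mat_def by simp

lemma mult_unit_mat_index:
  assumes "Z \<in> carrier_mat m n" "q < n" "i < m" "j < n"
  shows "(Z * unit_mat n q r) $$ (i, j) = (if j = r then Z $$ (i, q) else 0)"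
proof -
  have "(Z * unit_mat n q r) $$ (i, j) = (\<Sum>l<n. Z $$ (i, l) * unit_mat n q r $$ (l, j))"
    by (rule index_mult_mat_sum) (use assms in auto)
  also have "\<dots> = (\<Sum>l<n. if l = q then if j = r then Z $$ (i, q) else 0 else 0)"
    using assms by (intro sum.cong) (auto simp: unit_mat_index)
  finally show ?thesis using assms by simp
qed

lemma unit_mat_mult_index:
  assumes "Z \<in> carrier_mat n m" "q < n" "i < n" "j < m"
  shows "(unit_mat n p q * Z) $$ (i, j) = (if i = p then Z $$ (q, j) else 0)"
proof -
  have "(unit_mat n p q * Z) $$ (i, j) = (\<Sum>l<n. unit_mat n p q $$ (i, l) * Z $$ (l, j))"
    by (rule index_mult_mat_sum) (use assms in auto)
  also have "\<dots> = (\<Sum>l<n. if l = q then if i = p then Z $$ (q, j) else 0 else 0)"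
    using assms by (intro sum.cong) (auto simp: unit_mat_index)
  finally show ?thesis using assms by simp
qed

lemma unit_mat_mult: "q < n \<Longrightarrow> unit_mat n p q * unit_mat n q' r = (if q = q' then unit_mat n p r else 0\<^sub>m n n)"
  using unit_mat_carrier[of n]
  by (intro eq_matI) (auto simp: unit_mat_mult_index[of _ n n] unit_mat_index simp del: index_mult_mat(1)
      split: if_splits)

lemma linear_mat_mapD:
  assumes "linear_mat_map s p q T"
  shows "X \<in> carrier_mat s s \<Longrightarrow> T X \<in> carrier_mat p q"
    and "X \<in> carrier_mat s s \<Longrightarrow> Z \<in> carrier_mat s s \<Longrightarrow> T (X + Z) = T X + T Z"
    and "X \<in> carrier_mat s s \<Longrightarrow> T (c \<cdot>\<^sub>m X) = c \<cdot>\<^sub>m T X"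
  using assms unfolding linear_mat_map_def by auto

lemma linear_mat_map_minus:
  assumes T: "linear_mat_map s p q T" and X: "X \<in> carrier_mat s s" "Z \<in> carrier_mat s s"
  shows "T (X - Z) = T X - T Z"
proof -
  have "X - Z = X + (- 1) \<cdot>\<^sub>m Z" using X by (intro eq_matI) auto
  then have "T (X - Z) = T X + (- 1) \<cdot>\<^sub>m T Z"
    using linear_mat_mapD(2,3)[OF T] X by simp
  also have "\<dots> = T X - T Z"
    using linear_mat_mapD(1)[OF T] X by (intro eq_matI) auto
  finally show ?thesis .
qed

lemma linear_mat_map_zero:
  fixes T :: "'a :: field mat \<Rightarrow> 'a mat"
  assumes T: "linear_mat_map s p q T"
  shows "T (0\<^sub>m s s) = 0\<^sub>m p q"
proof -
  have "(0\<^sub>m s s :: 'a mat) - 0\<^sub>m s s = 0\<^sub>m s s" by (rule minus_r_inv_mat) simp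
  then have "T (0\<^sub>m s s) = T (0\<^sub>m s s - 0\<^sub>m s s)" by (simp only:)
  also have "\<dots> = T (0\<^sub>m s s) - T (0\<^sub>m s s)" by (intro linear_mat_map_minus[OF T]) auto
  also have "\<dots> = 0\<^sub>m p q" by (rule minus_r_inv_mat[OF linear_mat_mapD(1)[OF T]]) auto
  finally show ?thesis .
qed

lemma linear_mat_map_expand:
  assumes T: "linear_mat_map s p q T" and X: "X \<in> carrier_mat s s" and ij: "i < p" "j < q"
  shows "T X $$ (i, j) = (\<Sum>a<s. \<Sum>b<s. X $$ (a, b) * T (unit_mat s a b) $$ (i, j))"
proof -
  \<comment> \<open>\<open>F I\<close> keeps the entries of \<open>X\<close> at the positions in
    \<open>I\<close>, so that the induction adds one multiple of a matrix unit at a time.\<close>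
  define F where "F I = mat s s (\<lambda>ab. if ab \<in> I then X $$ ab else 0)" for I
  have F: "F I \<in> carrier_mat s s" for I unfolding F_def by simp
  have "T (F I) $$ (i, j) = (\<Sum>(a, b)\<in>I. X $$ (a, b) * T (unit_mat s a b) $$ (i, j))"
    if "finite I" "I \<subseteq> {..<s} \<times> {..<s}" for I
    using that
  proof (induction I)
    case empty
    have "F {} = 0 \<cdot>\<^sub>m F {}" unfolding F_def by (intro eq_matI) auto
    then have "T (F {}) = 0 \<cdot>\<^sub>m T (F {})" using linear_mat_mapD(3)[OF T F, of 0 "{}"] by simp
    then have "T (F {}) $$ (i, j) = (0 \<cdot>\<^sub>m T (F {})) $$ (i, j)" by (rule arg_cong)
    also have "\<dots> = 0" using linear_mat_mapD(1)[OF T F, of "{}"] ij by simp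
    finally show ?case by simp
  next
    case (insert ab I)
    obtain a b where ab: "ab = (a, b)" by (cases ab)
    have "F (insert ab I) = X $$ (a, b) \<cdot>\<^sub>m unit_mat s a b + F I"
      using insert.hyps(2) unfolding ab F_def by (intro eq_matI) (auto simp: unit_mat_def)
    then have "T (F (insert ab I)) = X $$ (a, b) \<cdot>\<^sub>m T (unit_mat s a b) + T (F I)"
      using linear_mat_mapD(2,3)[OF T] F by simp
    then have "T (F (insert ab I)) $$ (i, j) = X $$ (a, b) * T (unit_mat s a b) $$ (i, j) + T (F I) $$ (i, j)"
      using linear_mat_mapD(1)[OF T F, of I] linear_mat_mapD(1)[OF T unit_mat_carrier, of a b] ij by simp
    then show ?case using insert ab by simp
  qed
  from this[of "{..<s} \<times> {..<s}"]
  have "T (F ({..<s} \<times> {..<s})) $$ (i, j) = (\<Sum>(a, b)\<in>{..<s} \<times> {..<s}. X $$ (a, b) * T (unit_mat s a b) $$ (i, j))"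
    by simp
  moreover have "F ({..<s} \<times> {..<s}) = X" using X unfolding F_def by (intro eq_matI) auto
  ultimately show ?thesis by (simp add: sum.cartesian_product)
qed

text \<open>Multiplication by \<open>E_br\<close> moves column \<open>b\<close> of \<open>Z\<close>
  to column \<open>r\<close>, that is, \<open>Z E_br = \<Sum>_a Z_ab E_ar\<close>.\<close>

lemma linear_mat_map_mult_unit:
  assumes T: "linear_mat_map s p q T" and Z: "Z \<in> carrier_mat s s" and ij: "i < p" "j < q"
    and b: "b < s" and r: "r < s"
  shows "T (Z * unit_mat s b r) $$ (i, j) = (\<Sum>a<s. Z $$ (a, b) * T (unit_mat s a r) $$ (i, j))"
proof -
  have "T (Z * unit_mat s b r) $$ (i, j)
      = (\<Sum>a<s. \<Sum>b'<s. (Z * unit_mat s b r) $$ (a, b') * T (unit_mat s a b') $$ (i, j))"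
    by (rule linear_mat_map_expand[OF T _ ij]) (use Z in auto)
  also have "\<dots> = (\<Sum>a<s. \<Sum>b'<s. if b' = r then Z $$ (a, b) * T (unit_mat s a r) $$ (i, j) else 0)"
    using Z b by (intro sum.cong refl) (auto simp: mult_unit_mat_index[of _ s s] simp del: index_mult_mat(1))
  finally show ?thesis using r by simp
qed

lemma col_mult_mat:
  "P \<in> carrier_mat p n \<Longrightarrow> M \<in> carrier_mat n q \<Longrightarrow> j < q \<Longrightarrow> col (P * M) j = P *\<^sub>v col M j"
  by (intro eq_vecI) auto

text \<open>The vectors \<open>x\<close> for which all equations \<open>P y = Q x\<close> have a
  common solution \<open>y\<close> form a subspace. It contains the columns of the members of
  \<open>\<W>\<close>, hence every vector, and solutions for the unit vectors are put together as
  the columns of \<open>U\<close>.\<close>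

lemma exists_matrix_of_relation:
  fixes PQ :: "('a :: field mat \<times> 'a mat) set" and \<W> :: "'a mat set"
  assumes span: "LinearCombinations.module.span class_ring (module_vec TYPE('a) n)
      (\<Union>W\<in>\<W>. vec_space.col_space n W) = carrier_vec n"
    and PQ: "\<And>P Q. (P, Q) \<in> PQ \<Longrightarrow> P \<in> carrier_mat m n \<and> Q \<in> carrier_mat m n"
    and \<W>: "\<And>W. W \<in> \<W> \<Longrightarrow> W \<in> carrier_mat n r"
    and ex: "\<And>W. W \<in> \<W> \<Longrightarrow> \<exists>W'\<in>carrier_mat n r. \<forall>(P, Q)\<in>PQ. P * W' = Q * W"
  shows "\<exists>U\<in>carrier_mat n n. \<forall>(P, Q)\<in>PQ. P * U = Q"
proof -
  interpret vec_space "TYPE('a)" n .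
  define N where "N = {x \<in> carrier_vec n. \<exists>y\<in>carrier_vec n. \<forall>(P, Q)\<in>PQ. P *\<^sub>v y = Q *\<^sub>v x}"
  have sub: "LinearCombinations.submodule class_ring N V"
    unfolding LinearCombinations.submodule_def
  proof (intro conjI allI impI)
    show "module class_ring V" by (rule vec_module)
    show "N \<subseteq> carrier V" unfolding N_def by (auto simp: module_vec_simps)
    fix v w assume "v \<in> N" "w \<in> N"
    then obtain v' w' where v: "v \<in> carrier_vec n" "v' \<in> carrier_vec n" "\<forall>(P, Q)\<in>PQ. P *\<^sub>v v' = Q *\<^sub>v v"
      and w: "w \<in> carrier_vec n" "w' \<in> carrier_vec n" "\<forall>(P, Q)\<in>PQ. P *\<^sub>v w' = Q *\<^sub>v w"
      unfolding N_def by auto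
    have "\<forall>(P, Q)\<in>PQ. P *\<^sub>v (v' + w') = Q *\<^sub>v (v + w)"
      using v w PQ by (force simp: mult_add_distrib_mat_vec[of _ m n])
    then show "v \<oplus>\<^bsub>V\<^esub> w \<in> N" using v w unfolding N_def module_vec_simps
      by (auto intro!: bexI[of _ "v' + w'"])
  next
    have "\<forall>(P, Q)\<in>PQ. P *\<^sub>v 0\<^sub>v n = Q *\<^sub>v 0\<^sub>v n" using PQ by (force intro!: eq_vecI)
    then show "\<zero>\<^bsub>V\<^esub> \<in> N" unfolding N_def module_vec_simps by (auto intro!: bexI[of _ "0\<^sub>v n"])
  next
    fix c :: 'a and v assume "v \<in> N"
    then obtain v' where v: "v \<in> carrier_vec n" "v' \<in> carrier_vec n" "\<forall>(P, Q)\<in>PQ. P *\<^sub>v v' = Q *\<^sub>v v"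
      unfolding N_def by auto
    have "\<forall>(P, Q)\<in>PQ. P *\<^sub>v (c \<cdot>\<^sub>v v') = Q *\<^sub>v (c \<cdot>\<^sub>v v)"
      using v PQ by (force simp: mult_mat_vec[of _ m n])
    then show "c \<odot>\<^bsub>V\<^esub> v \<in> N" using v unfolding N_def module_vec_simps
      by (auto intro!: bexI[of _ "c \<cdot>\<^sub>v v'"])
  qed
  have "col_space W \<subseteq> N" if W: "W \<in> \<W>" for W
    unfolding col_space_def
  proof (rule span_is_subset[OF _ sub], rule subsetI)
    fix x assume "x \<in> set (cols W)"
    then obtain j where j: "j < r" "x = col W j" using \<W>[OF W] by (auto simp: cols_def)
    obtain W' where W': "W' \<in> carrier_mat n r" "\<forall>(P, Q)\<in>PQ. P * W' = Q * W" using ex[OF W] by auto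
    have "P *\<^sub>v col W' j = Q *\<^sub>v x" if "(P, Q) \<in> PQ" for P Q
    proof -
      have "P *\<^sub>v col W' j = col (P * W') j"
        using PQ[OF that] W'(1) j by (intro col_mult_mat[symmetric]) auto
      also have "P * W' = Q * W" using W'(2) that by auto
      also have "col (Q * W) j = Q *\<^sub>v col W j"
        using PQ[OF that] \<W>[OF W] j by (intro col_mult_mat) auto
      finally show ?thesis unfolding j(2) .
    qed
    then show "x \<in> N" unfolding N_def using j W' \<W>[OF W] by (auto intro!: bexI[of _ "col W' j"])
  qed
  then have "span (\<Union>W\<in>\<W>. col_space W) \<subseteq> N" by (intro span_is_subset[OF _ sub]) auto
  then have "carrier_vec n \<subseteq> N" unfolding span .
  then have "unit_vec n j \<in> N" for j by auto
  then have "\<forall>j. \<exists>y\<in>carrier_vec n. \<forall>(P, Q)\<in>PQ. P *\<^sub>v y = Q *\<^sub>v unit_vec n j"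
    unfolding N_def by blast
  then have "\<exists>f. \<forall>j. f j \<in> carrier_vec n \<and> (\<forall>(P, Q)\<in>PQ. P *\<^sub>v f j = Q *\<^sub>v unit_vec n j)"
    unfolding Bex_def by (rule choice)
  then obtain f where f: "\<And>j. f j \<in> carrier_vec n" "\<And>j P Q. (P, Q) \<in> PQ \<Longrightarrow> P *\<^sub>v f j = Q *\<^sub>v unit_vec n j"
    by blast
  define U where "U = mat_of_cols n (map f [0..<n])"
  have U: "U \<in> carrier_mat n n" unfolding U_def by auto
  have colU: "col U j = f j" if "j < n" for j
    unfolding U_def using that f(1) by (subst col_mat_of_cols) auto
  have "P * U = Q" if "(P, Q) \<in> PQ" for P Q
  proof (rule eq_matI)
    fix i j assume "i < dim_row Q" "j < dim_col Q"
    then have ij: "i < m" "j < n" using PQ[OF that] by auto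
    have "(P * U) $$ (i, j) = col (P * U) j $ i"
      by (rule index_col[symmetric]) (use ij PQ[OF that] U in auto)
    also have "col (P * U) j = Q *\<^sub>v unit_vec n j"
      using col_mult_mat[of P m n U n j] ij PQ[OF that] U colU f(2)[OF that] by simp
    also have "\<dots> $ i = Q $$ (i, j)"
      using ij PQ[OF that] by (auto simp: scalar_prod_right_unit)
    finally show "(P * U) $$ (i, j) = Q $$ (i, j)" .
  qed (use PQ[OF that] U in auto)
  with U show ?thesis by auto
qed

section \<open>Operators on the state space of a controllable and observable realization\<close>

locale lost_abbey =
  fixes s L :: nat and D C :: "'a :: field mat"
    and A B :: "'d :: finite \<Rightarrow> 'a mat \<Rightarrow> 'a mat" and Y :: "'d \<Rightarrow> 'a mat"
  assumes realization: "fm_realization s L D C A B Y"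
    and controllable: "fm_controllable s L A B"
    and observable: "fm_observable s L C A"
    and lost_abbey: "linearized_lost_abbey s L D C A B Y"
begin

lemma D: "D \<in> carrier_mat s s" and C: "C \<in> carrier_mat s L"
  and lin_A: "linear_mat_map s L L (A k)" and lin_B: "linear_mat_map s L s (B k)"
  and Y: "Y k \<in> carrier_mat s s"
  using realization unfolding fm_realization_def mat_tuples_def by auto

lemmas A = linear_mat_mapD(1)[OF lin_A]
lemmas B = linear_mat_mapD(1)[OF lin_B]

definition AS :: "'a mat \<Rightarrow> 'a mat" where "AS S = mat_sum L L (\<lambda>k. A k (mat_comm S (Y k)))"
definition BS :: "'a mat \<Rightarrow> 'a mat" where "BS S = mat_sum L s (\<lambda>k. B k (mat_comm S (Y k)))"

lemma AS: "AS S \<in> carrier_mat L L" and BS: "BS S \<in> carrier_mat L s"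
  unfolding AS_def BS_def by auto

lemma conditions:
  assumes "S \<in> carrier_mat s s" "Z \<in> carrier_mat s s" "Z' \<in> carrier_mat s s"
  shows "S * D - D * S = C * BS S"
    "S * C * B i Z - C * B i (S * Z) = C * AS S * B i Z"
    "S * C * A i Z - C * A i (S * Z) = C * AS S * A i Z"
    "B i (Z * S) - B i Z * S = A i Z * BS S"
    "A i (Z * S) * B j Z' - A i Z * B j (S * Z') = A i Z * AS S * B j Z'"
    "A i (Z * S) * A j Z' - A i Z * A j (S * Z') = A i Z * AS S * A j Z'"
  using lost_abbey assms unfolding linearized_lost_abbey_def AS_def BS_def Let_def by blast+

lemma obs_words_carrier: "G \<in> obs_words s C A \<Longrightarrow> G \<in> carrier_mat s L"
  by (induction rule: obs_words.induct) (auto intro!: C A mult_carrier_mat)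

lemma ctrl_words_carrier: "W \<in> ctrl_words s A B \<Longrightarrow> W \<in> carrier_mat L s"
  by (induction rule: ctrl_words.induct) (auto intro!: A B mult_carrier_mat)

lemma eq_zero_of_obs_words:
  assumes M: "M \<in> carrier_mat L q" and 0: "\<And>G. G \<in> obs_words s C A \<Longrightarrow> G * M = 0\<^sub>m s q"
  shows "M = 0\<^sub>m L q"
proof (rule eq_matI)
  fix i j assume "i < dim_row (0\<^sub>m L q :: 'a mat)" "j < dim_col (0\<^sub>m L q :: 'a mat)"
  then have ij: "i < L" "j < q" by auto
  have "col M j \<in> (\<Inter>W\<in>obs_words s C A. mat_kernel W)"
  proof
    fix W assume W: "W \<in> obs_words s C A"
    have "W *\<^sub>v col M j = col (W * M) j"
      using col_mult_mat[OF obs_words_carrier[OF W] M ij(2)] by simp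
    also have "\<dots> = 0\<^sub>v s" unfolding 0[OF W] using ij by (intro eq_vecI) auto
    finally show "col M j \<in> mat_kernel W"
      using obs_words_carrier[OF W] M ij unfolding mat_kernel_def by auto
  qed
  then have "col M j = 0\<^sub>v L" using observable unfolding fm_observable_def by auto
  then have "col M j $ i = 0" using ij by simp
  then show "M $$ (i, j) = 0\<^sub>m L q $$ (i, j)" using ij M by simp
qed (use M in auto)

text \<open>Every observability word other than \<open>C\<close> ends in a factor
  \<open>A i Z\<close>, so the products with \<open>C\<close> and with all \<open>A i Z\<close>
  decide equality.\<close>

lemma eqI_of_observable:
  assumes M: "M \<in> carrier_mat L q" "N \<in> carrier_mat L q"
    and C_eq: "C * M = C * N" and A_eq: "\<And>i Z. Z \<in> carrier_mat s s \<Longrightarrow> A i Z * M = A i Z * N"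
  shows "M = N"
proof (rule mat_eq_of_minus_eq_zero[OF M], rule eq_zero_of_obs_words)
  fix G assume "G \<in> obs_words s C A"
  then show "G * (M - N) = 0\<^sub>m s q"
  proof cases
    case base
    then show ?thesis
      using M C C_eq by (simp add: mult_minus_distrib_mat[of _ s L])
  next
    case (step W X i)
    note W = obs_words_carrier[OF step(2)] and X = A[OF step(3), of i]
    have "A i X * (M - N) = 0\<^sub>m L q"
      using M X A_eq[OF step(3), of i] by (simp add: mult_minus_distrib_mat[of _ L L])
    moreover have "G * (M - N) = W * (A i X * (M - N))"
      unfolding step(1) using W X M by (intro assoc_mult_mat) auto
    ultimately show ?thesis using W by simp
  qed
qed (use M in auto)

text \<open>The set \<open>PQ\<close> collects the equations that \<open>U\<close> has to satisfy after multiplication by observability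
  words.  They are solvable on the columns of the controllability words, hence everywhere,
  and by observability they determine \<open>U\<close>.\<close>
lemma exists_intertwiner:
  assumes S: "S \<in> carrier_mat s s"
  shows "\<exists>U\<in>carrier_mat L L. C * (U + AS S) = S * C \<and>
    (\<forall>i. \<forall>Z\<in>carrier_mat s s. A i Z * (U + AS S) = A i (Z * S) \<and>
      U * A i Z = A i (S * Z) \<and> U * B i Z = B i (S * Z))"
proof -
  define PQ where "PQ = insert (C, S * C - C * AS S)
    {(G * A i Z, G * (A i (Z * S) - A i Z * AS S)) | G i Z. G \<in> obs_words s C A \<and> Z \<in> carrier_mat s s}"
  \<comment> \<open>Hypotheses 1 and 2 have the shape of the lost-abbey conditions: \<open>W\<close>
    will be \<open>A i Z\<close> or \<open>B i Z\<close>, and \<open>W'\<close> the same map at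
    \<open>S * Z\<close>.\<close>
  have step: "\<forall>(P, Q)\<in>PQ. P * W' = Q * W"
    if W: "W \<in> carrier_mat L q" "W' \<in> carrier_mat L q"
      and 1: "S * C * W - C * W' = C * AS S * W"
      and 2: "\<And>i Z. Z \<in> carrier_mat s s \<Longrightarrow> A i (Z * S) * W - A i Z * W' = A i Z * AS S * W"
    for W W' q
  proof -
    have "C * W' = (S * C - C * AS S) * W"
    proof -
      have "(S * C - C * AS S) * W = S * C * W - C * AS S * W"
        using C AS[of S] S W by (intro minus_mult_distrib_mat[of _ s L]) auto
      also have "\<dots> = C * W'"
        by (rule minus_swap[OF _ _ _ 1, of s q]) (use C AS[of S] S W in auto)
      finally show ?thesis by simp
    qed
    moreover have "G * A i Z * W' = G * (A i (Z * S) - A i Z * AS S) * W"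
      if G: "G \<in> obs_words s C A" and Z: "Z \<in> carrier_mat s s" for G i Z
    proof -
      have ZS: "Z * S \<in> carrier_mat s s" using Z S by simp
      note c' = obs_words_carrier[OF G] A[OF Z, of i] A[OF ZS, of i] AS[of S] W
      have "G * (A i (Z * S) - A i Z * AS S) * W = G * ((A i (Z * S) - A i Z * AS S) * W)"
        using c' by (intro assoc_mult_mat) auto
      also have "(A i (Z * S) - A i Z * AS S) * W = A i (Z * S) * W - A i Z * AS S * W"
        using c' by (intro minus_mult_distrib_mat[of _ L L]) auto
      also have "\<dots> = A i Z * W'"
        by (rule minus_swap[OF _ _ _ 2[OF Z, of i], of L q]) (use c' in auto)
      also have "G * (A i Z * W') = G * A i Z * W'"
        using c' by (intro assoc_mult_mat[symmetric]) auto
      finally show ?thesis by simp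
    qed
    ultimately show ?thesis unfolding PQ_def by auto
  qed
  have stepA: "\<forall>(P, Q)\<in>PQ. P * A i (S * Z) = Q * A i Z" if Z: "Z \<in> carrier_mat s s" for i Z
    using conditions(3,6)[OF S] Z S by (intro step[of _ L]) (auto intro: A)
  have stepB: "\<forall>(P, Q)\<in>PQ. P * B i (S * Z) = Q * B i Z" if Z: "Z \<in> carrier_mat s s" for i Z
    using conditions(2,5)[OF S] Z S by (intro step[of _ s]) (auto intro: B)
  have PQ_carrier: "P \<in> carrier_mat s L \<and> Q \<in> carrier_mat s L" if "(P, Q) \<in> PQ" for P Q
  proof -
    have "S * C - C * AS S \<in> carrier_mat s L" using C S AS[of S] by auto
    moreover have "G * A i Z \<in> carrier_mat s L \<and> G * (A i (Z * S) - A i Z * AS S) \<in> carrier_mat s L"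
      if "G \<in> obs_words s C A" "Z \<in> carrier_mat s s" for G i Z
      using obs_words_carrier[OF that(1)] A[OF that(2), of i] AS[of S] by auto
    ultimately show ?thesis using that C unfolding PQ_def by auto
  qed
  \<comment> \<open>Only the leftmost factor of a controllability word changes: its argument
    \<open>X\<close> becomes \<open>S * X\<close>, and the remaining factors are carried
    along.\<close>
  have ex: "\<exists>W'\<in>carrier_mat L s. \<forall>(P, Q)\<in>PQ. P * W' = Q * W" if "W \<in> ctrl_words s A B" for W
    using that
  proof cases
    case (base X k)
    then show ?thesis using stepB[of X k] B[of "S * X" k] S by auto
  next
    case (step W' X i)
    have SX: "S * X \<in> carrier_mat s s" using S step(3) by simp
    note c' = ctrl_words_carrier[OF step(2)] A[OF step(3), of i] A[OF SX, of i]
    have "P * (A i (S * X) * W') = Q * W" if "(P, Q) \<in> PQ" for P Q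
    proof -
      note pq = PQ_carrier[OF that]
      have "P * (A i (S * X) * W') = (P * A i (S * X)) * W'"
        using pq c' by (intro assoc_mult_mat[symmetric]) auto
      also have "P * A i (S * X) = Q * A i X" using stepA[OF step(3), of i] that by auto
      also have "Q * A i X * W' = Q * W"
        unfolding step(1) using pq c' by (intro assoc_mult_mat) auto
      finally show ?thesis .
    qed
    moreover have "A i (S * X) * W' \<in> carrier_mat L s" using c' by simp
    ultimately show ?thesis by blast
  qed
  from exists_matrix_of_relation[OF controllable[unfolded fm_controllable_def] PQ_carrier ctrl_words_carrier ex]
  obtain U where U: "U \<in> carrier_mat L L" and *: "\<forall>(P, Q)\<in>PQ. P * U = Q" by (rule bexE)
  have PQU: "P * U = Q" if "(P, Q) \<in> PQ" for P Q using bspec[OF * that] by simp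
  have CU: "C * U = S * C - C * AS S" by (rule PQU) (simp add: PQ_def)
  have obsU: "G * (A i Z * U) = G * (A i (Z * S) - A i Z * AS S)"
    if G: "G \<in> obs_words s C A" and Z: "Z \<in> carrier_mat s s" for G i Z
  proof -
    have "(G * A i Z, G * (A i (Z * S) - A i Z * AS S)) \<in> PQ" using G Z unfolding PQ_def by blast
    from PQU[OF this] show ?thesis
      using assoc_mult_mat[OF obs_words_carrier[OF G] A[OF Z, of i] U] by simp
  qed
  have uniq: "M = N" if M: "M \<in> carrier_mat L q" "N \<in> carrier_mat L q"
      and "\<And>G. G \<in> obs_words s C A \<Longrightarrow> G * M = G * N" for M N q
  proof (rule mat_eq_of_minus_eq_zero[OF M], rule eq_zero_of_obs_words)
    fix G assume G: "G \<in> obs_words s C A"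
    show "G * (M - N) = 0\<^sub>m s q"
      using that(3)[OF G] M obs_words_carrier[OF G]
      by (simp add: mult_minus_distrib_mat[of _ s L])
  qed (use M in auto)
  have AU: "A i Z * U = A i (Z * S) - A i Z * AS S" if Z: "Z \<in> carrier_mat s s" for i Z
  proof (rule uniq)
    show "A i Z * U \<in> carrier_mat L L" "A i (Z * S) - A i Z * AS S \<in> carrier_mat L L"
      using A[OF Z, of i] U AS[of S] by auto
  qed (rule obsU[OF _ Z])
  \<comment> \<open>The same conditions serve a second time. So far \<open>U\<close> is known only
    after multiplication by \<open>C\<close> or \<open>A i Z\<close>; observability strips these
    factors.\<close>
  have UM: "U * M = M'"
    if M: "M \<in> carrier_mat L q" "M' \<in> carrier_mat L q"
      and 1: "S * C * M - C * M' = C * AS S * M"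
      and 2: "\<And>i Z. Z \<in> carrier_mat s s \<Longrightarrow> A i (Z * S) * M - A i Z * M' = A i Z * AS S * M"
    for M M' q
  proof (rule eqI_of_observable)
    have "C * (U * M) = C * U * M" using C U M by (intro assoc_mult_mat[symmetric]) auto
    also have "\<dots> = S * C * M - C * AS S * M"
      unfolding CU using C AS[of S] S M by (intro minus_mult_distrib_mat[of _ s L]) auto
    also have "\<dots> = C * M'"
      by (rule minus_swap[OF _ _ _ 1, of s q]) (use C AS[of S] S M in auto)
    finally show "C * (U * M) = C * M'" .
    fix i and Z :: "'a mat" assume Z: "Z \<in> carrier_mat s s"
    have ZS: "Z * S \<in> carrier_mat s s" using Z S by simp
    note c' = A[OF Z, of i] A[OF ZS, of i] AS[of S] M U
    have "A i Z * (U * M) = A i Z * U * M" using c' by (intro assoc_mult_mat[symmetric]) auto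
    also have "\<dots> = A i (Z * S) * M - A i Z * AS S * M"
      unfolding AU[OF Z] using c' by (intro minus_mult_distrib_mat[of _ L L]) auto
    also have "\<dots> = A i Z * M'"
      by (rule minus_swap[OF _ _ _ 2[OF Z, of i], of L q]) (use c' in auto)
    finally show "A i Z * (U * M) = A i Z * M'" .
  qed (use M U in auto)
  have UA: "U * A i Z = A i (S * Z)" if Z: "Z \<in> carrier_mat s s" for i Z
    using conditions(3,6)[OF S] Z S by (intro UM[of _ L]) (auto intro: A)
  have UB: "U * B i Z = B i (S * Z)" if Z: "Z \<in> carrier_mat s s" for i Z
    using conditions(2,5)[OF S] Z S by (intro UM[of _ s]) (auto intro: B)
  have "C * (U + AS S) = C * U + C * AS S" using C U AS[of S] by (intro mult_add_distrib_mat) auto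
  also have "\<dots> = S * C" unfolding CU
    using C S AS[of S] by (intro mat_minus_add_cancel[of _ s L]) auto
  finally have CT: "C * (U + AS S) = S * C" .
  have "A i Z * (U + AS S) = A i (Z * S)" if Z: "Z \<in> carrier_mat s s" for i Z
  proof -
    have ZS: "Z * S \<in> carrier_mat s s" using Z S by simp
    have "A i Z * (U + AS S) = A i Z * U + A i Z * AS S"
      using A[OF Z, of i] U AS[of S] by (intro mult_add_distrib_mat) auto
    also have "\<dots> = A i (Z * S)" unfolding AU[OF Z]
      using A[OF Z, of i] A[OF ZS, of i] AS[of S] by (intro mat_minus_add_cancel[of _ L L]) auto
    finally show ?thesis .
  qed
  with CT show ?thesis using U UA UB by blast
qed

text \<open>The choice is forced: the products of \<open>U S\<close> with \<open>C\<close> and with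
  all \<open>A i Z\<close> are prescribed, and by observability they determine it.\<close>

definition U :: "'a mat \<Rightarrow> 'a mat" where
  "U S = (SOME U. U \<in> carrier_mat L L \<and> C * (U + AS S) = S * C \<and>
    (\<forall>i. \<forall>Z\<in>carrier_mat s s. A i Z * (U + AS S) = A i (Z * S) \<and>
      U * A i Z = A i (S * Z) \<and> U * B i Z = B i (S * Z)))"

definition T :: "'a mat \<Rightarrow> 'a mat" where "T S = U S + AS S"

text \<open>\<open>N\<close> and \<open>M\<close> are the constant terms of the two pencils:
  \<delta> is \<open>N - \<Sum>_k A_k(I) x_k\<close>, and the numerator is
  \<open>\<Sum>_k B_k(I) x_k - M\<close>.\<close>

definition N :: "'a mat" where "N = 1\<^sub>m L + mat_sum L L (\<lambda>k. A k (Y k))"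

definition M :: "'a mat" where "M = mat_sum L s (\<lambda>k. B k (Y k))"

lemma U_props:
  assumes "S \<in> carrier_mat s s"
  shows "U S \<in> carrier_mat L L \<and> C * T S = S * C \<and>
    (\<forall>i. \<forall>Z\<in>carrier_mat s s. A i Z * T S = A i (Z * S) \<and>
      U S * A i Z = A i (S * Z) \<and> U S * B i Z = B i (S * Z))"
  using someI_ex[OF exists_intertwiner[OF assms, unfolded Bex_def]]
  unfolding T_def U_def[symmetric] by blast

lemma N: "N \<in> carrier_mat L L" and M: "M \<in> carrier_mat L s"
  unfolding N_def M_def by auto

context
  fixes S :: "'a mat" assumes S: "S \<in> carrier_mat s s"
begin

lemma U: "U S \<in> carrier_mat L L" and T: "T S \<in> carrier_mat L L"
  using U_props[OF S] AS[of S] unfolding T_def by auto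

lemma C_T: "C * T S = S * C" and A_T: "Z \<in> carrier_mat s s \<Longrightarrow> A i Z * T S = A i (Z * S)"
  and U_A: "Z \<in> carrier_mat s s \<Longrightarrow> U S * A i Z = A i (S * Z)"
  and U_B: "Z \<in> carrier_mat s s \<Longrightarrow> U S * B i Z = B i (S * Z)"
  using U_props[OF S] by auto

lemma C_BS: "C * BS S = S * D - D * S"
  using conditions(1)[OF S one_carrier_mat one_carrier_mat] by simp

lemma B_right: "Z \<in> carrier_mat s s \<Longrightarrow> B i (Z * S) = B i Z * S + A i Z * BS S"
proof -
  assume Z: "Z \<in> carrier_mat s s"
  have "B i (Z * S) = B i Z * S + (B i (Z * S) - B i Z * S)"
    using B[OF Z, of i] B[of "Z * S" i] Z S by (intro eq_matI) auto
  then show ?thesis using conditions(4)[OF S Z Z, of i] by simp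
qed

lemma AS_index: "i < L \<Longrightarrow> j < L \<Longrightarrow>
  AS S $$ (i, j) = (\<Sum>k\<in>UNIV. A k (S * Y k) $$ (i, j)) - (\<Sum>k\<in>UNIV. A k (Y k * S) $$ (i, j))"
proof -
  assume ij: "i < L" "j < L"
  have "A k (mat_comm S (Y k)) $$ (i, j) = A k (S * Y k) $$ (i, j) - A k (Y k * S) $$ (i, j)" for k
    using ij S Y[of k] A[of "Y k * S" k] A[of "S * Y k" k]
    unfolding mat_comm_def by (subst linear_mat_map_minus[OF lin_A]) auto
  then show ?thesis using ij by (simp add: AS_def mat_sum_index sum_subtractf)
qed

lemma BS_index: "i < L \<Longrightarrow> j < s \<Longrightarrow>
  BS S $$ (i, j) = (\<Sum>k\<in>UNIV. B k (S * Y k) $$ (i, j)) - (\<Sum>k\<in>UNIV. B k (Y k * S) $$ (i, j))"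
proof -
  assume ij: "i < L" "j < s"
  have "B k (mat_comm S (Y k)) $$ (i, j) = B k (S * Y k) $$ (i, j) - B k (Y k * S) $$ (i, j)" for k
    using ij S Y[of k] B[of "Y k * S" k] B[of "S * Y k" k]
    unfolding mat_comm_def by (subst linear_mat_map_minus[OF lin_B]) auto
  then show ?thesis using ij by (simp add: BS_def mat_sum_index sum_subtractf)
qed

text \<open>On the terms of \<open>N\<close> the two operators produce \<open>A k (S * Y k)\<close>
  and \<open>A k (Y k * S)\<close>. The sum of the differences is exactly \<open>AS S\<close>, by
  which \<open>T S\<close> exceeds \<open>U S\<close>.\<close>

lemma U_N: "U S * N = N * T S"
proof -
  have AY: "A k (Y k) \<in> carrier_mat L L" "A k (S * Y k) \<in> carrier_mat L L" for k
    using A Y S by auto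
  have "U S * N = U S + mat_sum L L (\<lambda>k. A k (S * Y k))"
    unfolding N_def using U
    by (simp add: mult_add_distrib_mat[of _ L L _ L] mult_mat_sum[OF U AY(1)] U_A[OF Y])
  also have "\<dots> = T S + mat_sum L L (\<lambda>k. A k (Y k * S))"
    using U T AS[of S] by (intro eq_matI) (auto simp: T_def AS_index mat_sum_index)
  also have "\<dots> = N * T S"
    unfolding N_def using T
    by (simp add: add_mult_distrib_mat[of _ L L _ _ L] mat_sum_mult[OF T AY(1)] A_T[OF Y])
  finally show ?thesis .
qed

text \<open>A factor \<open>S\<close> leaves the argument of \<open>B\<close> on the right only up
  to the defect \<open>A i Z * BS S\<close>. The defects at \<open>Y k\<close> and the commutator
  term \<open>BS S\<close> add up to \<open>N * BS S\<close>, the identity summand of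
  \<open>N\<close> accounting for the latter.\<close>

lemma U_M: "U S * M = M * S + N * BS S"
proof -
  have AY: "A k (Y k) \<in> carrier_mat L L" "B k (Y k) \<in> carrier_mat L s" for k
    using A B Y by auto
  have BYS: "B k (Y k * S) = B k (Y k) * S + A k (Y k) * BS S" for k
    by (rule B_right[OF Y])
  have "U S * M = mat_sum L s (\<lambda>k. B k (S * Y k))"
    unfolding M_def by (simp add: mult_mat_sum[OF U AY(2)] U_B[OF Y])
  also have "\<dots> = mat_sum L s (\<lambda>k. B k (Y k * S)) + BS S"
    using BS[of S] by (intro eq_matI) (auto simp: BS_index mat_sum_index)
  also have "mat_sum L s (\<lambda>k. B k (Y k * S))
      = mat_sum L s (\<lambda>k. B k (Y k) * S) + mat_sum L s (\<lambda>k. A k (Y k) * BS S)"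
  proof (rule eq_matI)
    fix i j assume "i < dim_row (mat_sum L s (\<lambda>k. B k (Y k) * S) + mat_sum L s (\<lambda>k. A k (Y k) * BS S))"
      "j < dim_col (mat_sum L s (\<lambda>k. B k (Y k) * S) + mat_sum L s (\<lambda>k. A k (Y k) * BS S))"
    then have ij: "i < L" "j < s" by auto
    have "B k (Y k * S) $$ (i, j) = (B k (Y k) * S) $$ (i, j) + (A k (Y k) * BS S) $$ (i, j)" for k
      unfolding BYS using ij carrier_matD[OF AY(1)[of k]] carrier_matD[OF BS[of S]]
      by (simp del: index_mult_mat(1))
    then show "mat_sum L s (\<lambda>k. B k (Y k * S)) $$ (i, j)
      = (mat_sum L s (\<lambda>k. B k (Y k) * S) + mat_sum L s (\<lambda>k. A k (Y k) * BS S)) $$ (i, j)"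
      using ij by (simp add: mat_sum_index sum.distrib del: index_mult_mat(1))
  qed auto
  also have "mat_sum L s (\<lambda>k. B k (Y k) * S) = M * S"
    unfolding M_def by (rule mat_sum_mult[OF S AY(2), symmetric])
  also have "mat_sum L s (\<lambda>k. A k (Y k) * BS S) = mat_sum L L (\<lambda>k. A k (Y k)) * BS S"
    by (rule mat_sum_mult[OF BS AY(1), symmetric])
  also have "M * S + mat_sum L L (\<lambda>k. A k (Y k)) * BS S + BS S = M * S + N * BS S"
  proof -
    have "N * BS S = 1\<^sub>m L * BS S + mat_sum L L (\<lambda>k. A k (Y k)) * BS S"
      unfolding N_def using BS[of S] by (intro add_mult_distrib_mat[of _ L L]) auto
    then show ?thesis using carrier_matD[OF M] carrier_matD[OF S] carrier_matD[OF BS[of S]]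
      by (simp, intro eq_matI) (auto simp del: index_mult_mat(1))
  qed
  finally show ?thesis .
qed

end

lemma A_unit_T:
  assumes S: "S \<in> carrier_mat s s"
  shows "U S * A i (1\<^sub>m s) = A i S" "A i (1\<^sub>m s) * T S = A i S"
    "U S * B i (1\<^sub>m s) = B i S" "B i S = B i (1\<^sub>m s) * S + A i (1\<^sub>m s) * BS S"
  using U_A[OF S one_carrier_mat, of i] A_T[OF S one_carrier_mat, of i] U_B[OF S one_carrier_mat, of i]
    B_right[OF S one_carrier_mat, of i] S by auto

text \<open>\<open>T\<close> is multiplicative: behind \<open>C\<close> it acts as \<open>S\<close>
  on the left of \<open>C\<close>, behind \<open>A i Z\<close> as \<open>S\<close> on the right of
  \<open>Z\<close>, and observability removes the test. Hence the relations of matrix units carry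
  over.\<close>

lemma T_unit_mult:
  assumes "b < s" "c < s"
  shows "T (unit_mat s a b) * T (unit_mat s c d)
    = (if b = c then T (unit_mat s a d) else 0\<^sub>m L L)"
proof -
  note T = T[OF unit_mat_carrier]
  have A0: "A i (0\<^sub>m s s) = 0\<^sub>m L L" for i by (rule linear_mat_map_zero[OF lin_A])
  show ?thesis
  proof (rule eqI_of_observable)
    have "C * (T (unit_mat s a b) * T (unit_mat s c d)) = C * T (unit_mat s a b) * T (unit_mat s c d)"
      using C T by (intro assoc_mult_mat[symmetric]) auto
    also have "\<dots> = unit_mat s a b * C * T (unit_mat s c d)"
      unfolding C_T[OF unit_mat_carrier] ..
    also have "\<dots> = unit_mat s a b * (C * T (unit_mat s c d))"
      using C T by (intro assoc_mult_mat) auto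
    also have "\<dots> = unit_mat s a b * unit_mat s c d * C"
      unfolding C_T[OF unit_mat_carrier] using C by (intro assoc_mult_mat[symmetric]) auto
    also have "\<dots> = C * (if b = c then T (unit_mat s a d) else 0\<^sub>m L L)"
      using C assms by (simp add: unit_mat_mult C_T)
    finally show "C * (T (unit_mat s a b) * T (unit_mat s c d))
      = C * (if b = c then T (unit_mat s a d) else 0\<^sub>m L L)" .
    fix i and Z :: "'a mat" assume Z: "Z \<in> carrier_mat s s"
    have Z': "Z * unit_mat s a b \<in> carrier_mat s s" using Z by simp
    have "A i Z * (T (unit_mat s a b) * T (unit_mat s c d)) = A i Z * T (unit_mat s a b) * T (unit_mat s c d)"
      using A[OF Z, of i] T by (intro assoc_mult_mat[symmetric]) auto
    also have "\<dots> = A i (Z * unit_mat s a b * unit_mat s c d)"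
      by (simp add: A_T[OF unit_mat_carrier Z] A_T[OF unit_mat_carrier Z'])
    also have "Z * unit_mat s a b * unit_mat s c d = Z * (unit_mat s a b * unit_mat s c d)"
      using Z by (intro assoc_mult_mat) auto
    also have "A i \<dots> = A i Z * (if b = c then T (unit_mat s a d) else 0\<^sub>m L L)"
      using Z A[OF Z, of i] assms by (simp add: unit_mat_mult A_T A0)
    finally show "A i Z * (T (unit_mat s a b) * T (unit_mat s c d))
      = A i Z * (if b = c then T (unit_mat s a d) else 0\<^sub>m L L)" .
  qed (use T in \<open>auto intro: mult_carrier_mat\<close>)
qed

text \<open>The operators at the units \<open>E_rr\<close> behave like idempotents with sum
  \<open>I\<close>: row \<open>r\<close> of \<open>C * V\<close> is seen through
  \<open>C * T(E_rr)\<close>, and \<open>A_i(E_ab)\<close> absorbs \<open>T(E_bb)\<close> on the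
  right. So \<open>V\<close> is killed by \<open>C\<close> and by every
  \<open>A i Z\<close>.\<close>

lemma eq_zero_of_T_unit:
  assumes V: "V \<in> carrier_mat L q" and TV: "\<And>r. r < s \<Longrightarrow> T (unit_mat s r r) * V = 0\<^sub>m L q"
  shows "V = 0\<^sub>m L q"
proof (rule eqI_of_observable)
  note T = T[OF unit_mat_carrier]
  show "C * V = C * 0\<^sub>m L q"
  proof (rule eq_matI)
    fix r j assume "r < dim_row (C * 0\<^sub>m L q)" "j < dim_col (C * 0\<^sub>m L q)"
    then have rj: "r < s" "j < q" using C by auto
    have "unit_mat s r r * (C * V) = C * T (unit_mat s r r) * V"
      unfolding C_T[OF unit_mat_carrier] using C V by (intro assoc_mult_mat[symmetric]) auto
    also have "\<dots> = C * (T (unit_mat s r r) * V)" using C V T by (intro assoc_mult_mat) auto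
    also have "\<dots> = 0\<^sub>m s q" unfolding TV[OF rj(1)] using C by simp
    finally have "(unit_mat s r r * (C * V)) $$ (r, j) = 0" using rj by simp
    then show "(C * V) $$ (r, j) = (C * 0\<^sub>m L q) $$ (r, j)"
      using rj C V by (simp add: unit_mat_mult_index[of _ s q] del: index_mult_mat(1))
  qed (use C V in auto)
  fix i and Z :: "'a mat" assume Z: "Z \<in> carrier_mat s s"
  have AV: "(A i (unit_mat s a b) * V) $$ (l, j) = 0" if "b < s" "l < L" "j < q" for a b l j
  proof -
    have "A i (unit_mat s a b) = A i (unit_mat s a b) * T (unit_mat s b b)"
      using that by (simp add: A_T unit_mat_mult)
    then have "A i (unit_mat s a b) * V = A i (unit_mat s a b) * (T (unit_mat s b b) * V)"
      using A[OF unit_mat_carrier, of i a b] T V by (simp add: assoc_mult_mat[of _ L L _ L _ q, symmetric])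
    also have "\<dots> = 0\<^sub>m L q" unfolding TV[OF that(1)] using A[OF unit_mat_carrier, of i a b] by simp
    finally show ?thesis using that by simp
  qed
  show "A i Z * V = A i Z * 0\<^sub>m L q"
  proof (rule eq_matI)
    fix l j assume "l < dim_row (A i Z * 0\<^sub>m L q)" "j < dim_col (A i Z * 0\<^sub>m L q)"
    then have lj: "l < L" "j < q" using A[OF Z, of i] by auto
    have "(A i Z * V) $$ (l, j) = (\<Sum>e<L. (\<Sum>a<s. \<Sum>b<s. Z $$ (a, b) * A i (unit_mat s a b) $$ (l, e)) * V $$ (e, j))"
      unfolding index_mult_mat_sum[OF A[OF Z] V lj]
      using lj by (intro sum.cong refl) (simp add: linear_mat_map_expand[OF lin_A Z])
    also have "\<dots> = (\<Sum>a<s. \<Sum>b<s. Z $$ (a, b) * (\<Sum>e<L. A i (unit_mat s a b) $$ (l, e) * V $$ (e, j)))"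
      unfolding sum_distrib_right sum_distrib_left
      by (subst sum_rotate) (simp add: mult.assoc)
    also have "\<dots> = 0"
    proof (intro sum.neutral ballI)
      fix a b assume "b \<in> {..<s}"
      then show "Z $$ (a, b) * (\<Sum>e<L. A i (unit_mat s a b) $$ (l, e) * V $$ (e, j)) = 0"
        using AV[of b l j a] lj index_mult_mat_sum[OF A[OF unit_mat_carrier] V lj, of i a b] by simp
    qed
    finally show "(A i Z * V) $$ (l, j) = (A i Z * 0\<^sub>m L q) $$ (l, j)"
      using lj A[OF Z, of i] by (simp del: index_mult_mat(1))
  qed (use A[OF Z, of i] V in auto)
qed (use V in auto)

end

section \<open>Matrices over the free skew field\<close>

lemma carrier_free_skew_field: "carrier free_skew_field = range Rep_ratf"
proof -
  have "range Rep_ratf = {nc_class R | R :: ('a, 'b) nc_expr. nc_nondegenerate R}"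
    using Rep_ratf Abs_ratf_inverse by (metis (mono_tags, lifting) rangeI subsetI subset_antisym image_subsetI)
  then show ?thesis unfolding free_skew_field_def by simp
qed

lemma Rep_ratf_ops:
  "Rep_ratf f \<oplus>\<^bsub>free_skew_field\<^esub> Rep_ratf g = Rep_ratf (f + g)"
  "Rep_ratf f \<otimes>\<^bsub>free_skew_field\<^esub> Rep_ratf g = Rep_ratf (f * g)"
proof -
  obtain R where R: "nc_nondegenerate R" "f = rf R" by (rule ratf_cases)
  obtain T where T: "nc_nondegenerate T" "g = rf T" by (rule ratf_cases)
  show "Rep_ratf f \<oplus>\<^bsub>free_skew_field\<^esub> Rep_ratf g = Rep_ratf (f + g)"
    "Rep_ratf f \<otimes>\<^bsub>free_skew_field\<^esub> Rep_ratf g = Rep_ratf (f * g)"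
    unfolding R T using R(1) T(1)
    by (simp_all add: rf_add rf_mult Rep_rf nc_nondegenerate_intros free_skew_field_ops)
qed

lemma Rep_ratf_zero_one:
  "\<zero>\<^bsub>free_skew_field\<^esub> = Rep_ratf 0" "\<one>\<^bsub>free_skew_field\<^esub> = Rep_ratf 1"
  unfolding zero_ratf_def one_ratf_def
  by (simp_all add: Rep_rf nc_nondegenerate_intros) (simp_all add: free_skew_field_def)

text \<open>Differences and finite sums in the record are defined through its additive group;
  computing with them requires the laws, which are inherited from \<open>ratf\<close>.\<close>

lemma ring_free_skew_field: "ring (free_skew_field :: ('a :: field, 'd) nc_ratfun ring)"
proof (rule ringI)
  show "abelian_group (free_skew_field :: ('a, 'd) nc_ratfun ring)"
  proof (rule abelian_groupI)
    fix x :: "('a, 'd) nc_ratfun" assume "x \<in> carrier free_skew_field"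
    then obtain f where f: "x = Rep_ratf f" unfolding carrier_free_skew_field by auto
    show "\<exists>y\<in>carrier free_skew_field. y \<oplus>\<^bsub>free_skew_field\<^esub> x = \<zero>\<^bsub>free_skew_field\<^esub>"
      unfolding carrier_free_skew_field
      by (intro bexI[of _ "Rep_ratf (- f)"]) (auto simp: f Rep_ratf_ops Rep_ratf_zero_one)
  qed (auto simp: carrier_free_skew_field Rep_ratf_ops Rep_ratf_zero_one ac_simps)
  show "monoid (free_skew_field :: ('a, 'd) nc_ratfun ring)"
    by (rule monoidI) (auto simp: carrier_free_skew_field Rep_ratf_ops Rep_ratf_zero_one mult.assoc)
qed (auto simp: carrier_free_skew_field Rep_ratf_ops Rep_ratf_zero_one ring_distribs)

lemma Rep_ratf_minus: "Rep_ratf f \<ominus>\<^bsub>free_skew_field\<^esub> Rep_ratf g = Rep_ratf (f - g)"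
proof -
  interpret ring "free_skew_field :: ('a, 'b) nc_ratfun ring" by (rule ring_free_skew_field)
  have "\<ominus>\<^bsub>free_skew_field\<^esub> Rep_ratf g = Rep_ratf (- g)"
    by (rule minus_equality) (auto simp: carrier_free_skew_field Rep_ratf_ops Rep_ratf_zero_one)
  then show ?thesis by (simp add: a_minus_def Rep_ratf_ops)
qed

lemma Rep_ratf_finsum:
  fixes f :: "'i \<Rightarrow> ('a :: field, 'b) ratf"
  shows "finite I \<Longrightarrow> (\<Oplus>\<^bsub>free_skew_field\<^esub>k\<in>I. Rep_ratf (f k)) = Rep_ratf (\<Sum>k\<in>I. f k)"
proof (induction I rule: finite_induct)
  case empty
  interpret ring "free_skew_field :: ('a, 'b) nc_ratfun ring" by (rule ring_free_skew_field)
  show ?case by (simp add: Rep_ratf_zero_one)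
next
  case (insert k I)
  interpret ring "free_skew_field :: ('a, 'b) nc_ratfun ring" by (rule ring_free_skew_field)
  show ?case using insert
    by (subst finsum_insert) (auto simp: carrier_free_skew_field Rep_ratf_ops)
qed

section \<open>Transfer of matrices from \<open>ratf\<close> to the record\<close>

abbreviation Rep_mat :: "('a :: field, 'd) ratf mat \<Rightarrow> ('a, 'd) nc_ratfun mat" where
  "Rep_mat \<equiv> map_mat Rep_ratf"

lemma rmat_add_Rep:
  "M \<in> carrier_mat p q \<Longrightarrow> N \<in> carrier_mat p q \<Longrightarrow>
    rmat_add free_skew_field (Rep_mat M) (Rep_mat N) = Rep_mat (M + N)"
  unfolding rmat_add_def by (intro eq_matI) (auto simp: Rep_ratf_ops)

lemma rmat_minus_Rep:
  "M \<in> carrier_mat p q \<Longrightarrow> N \<in> carrier_mat p q \<Longrightarrow>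
    rmat_minus free_skew_field (Rep_mat M) (Rep_mat N) = Rep_mat (M - N)"
  unfolding rmat_minus_def by (intro eq_matI) (auto simp: Rep_ratf_minus)

lemma rmat_mult_Rep:
  assumes M: "M \<in> carrier_mat p q" and N: "N \<in> carrier_mat q r"
  shows "rmat_mult free_skew_field (Rep_mat M) (Rep_mat N) = Rep_mat (M * N)"
proof (rule eq_matI)
  interpret ring "free_skew_field :: ('a, 'b) nc_ratfun ring" by (rule ring_free_skew_field)
  fix i j assume "i < dim_row (Rep_mat (M * N))" "j < dim_col (Rep_mat (M * N))"
  then have ij: "i < p" "j < r" using M N by auto
  have "rmat_mult free_skew_field (Rep_mat M) (Rep_mat N) $$ (i, j)
      = (\<Oplus>\<^bsub>free_skew_field\<^esub>k\<in>{..<q}. Rep_ratf (M $$ (i, k) * N $$ (k, j)))"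
  proof -
    have "rmat_mult free_skew_field (Rep_mat M) (Rep_mat N) $$ (i, j)
        = (\<Oplus>\<^bsub>free_skew_field\<^esub>k\<in>{..<q}. Rep_mat M $$ (i, k) \<otimes>\<^bsub>free_skew_field\<^esub> Rep_mat N $$ (k, j))"
      unfolding rmat_mult_def using ij M N by simp
    also have "\<dots> = (\<Oplus>\<^bsub>free_skew_field\<^esub>k\<in>{..<q}. Rep_ratf (M $$ (i, k) * N $$ (k, j)))"
      using ij M N by (intro finsum_cong') (simp_all add: Rep_ratf_ops carrier_free_skew_field)
    finally show ?thesis .
  qed
  also have "\<dots> = Rep_ratf (\<Sum>k<q. M $$ (i, k) * N $$ (k, j))"
    by (rule Rep_ratf_finsum) simp
  also have "\<dots> = Rep_mat (M * N) $$ (i, j)"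
    using ij M N index_mult_mat_sum[OF M N ij] by (simp del: index_mult_mat(1))
  finally show "rmat_mult free_skew_field (Rep_mat M) (Rep_mat N) $$ (i, j) = Rep_mat (M * N) $$ (i, j)" .
qed (use M N in \<open>auto simp: rmat_mult_def\<close>)

lemma rmat_scalar_Rep: "rmat_scalar free_skew_field n (Rep_ratf f) = Rep_mat (mat n n (\<lambda>(i, j). if i = j then f else 0))"
  unfolding rmat_scalar_def by (intro eq_matI) (auto simp: Rep_ratf_zero_one)

lemma rmat_scalar_one_Rep: "rmat_scalar free_skew_field n \<one>\<^bsub>free_skew_field\<^esub> = Rep_mat (1\<^sub>m n)"
  unfolding Rep_ratf_zero_one(2) rmat_scalar_Rep one_mat_def ..

lemma rmat_carrier_iff:
  "M \<in> rmat_carrier free_skew_field p q \<longleftrightarrow> (\<exists>Z \<in> carrier_mat p q. M = Rep_mat Z)"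
proof
  assume M: "M \<in> rmat_carrier free_skew_field p q"
  have "M = Rep_mat (map_mat Abs_ratf M)"
  proof (rule eq_matI)
    fix i j assume "i < dim_row (Rep_mat (map_mat Abs_ratf M))" "j < dim_col (Rep_mat (map_mat Abs_ratf M))"
    then have ij: "i < dim_row M" "j < dim_col M" by auto
    have "M $$ (i, j) \<in> elements_mat M"
      by (rule elements_matI[OF _ ij refl]) simp
    then have "M $$ (i, j) \<in> range Rep_ratf"
      using M unfolding rmat_carrier_def carrier_free_skew_field by blast
    then obtain g where "M $$ (i, j) = Rep_ratf g" by blast
    then have "Rep_ratf (Abs_ratf (M $$ (i, j))) = M $$ (i, j)" by (simp only: Rep_ratf_inverse)
    then show "M $$ (i, j) = Rep_mat (map_mat Abs_ratf M) $$ (i, j)" using ij by simp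
  qed auto
  moreover have "map_mat Abs_ratf M \<in> carrier_mat p q" using M unfolding rmat_carrier_def by auto
  ultimately show "\<exists>Z \<in> carrier_mat p q. M = Rep_mat Z" by blast
next
  assume "\<exists>Z \<in> carrier_mat p q. M = Rep_mat Z"
  then show "M \<in> rmat_carrier free_skew_field p q"
    unfolding rmat_carrier_def carrier_free_skew_field by (auto simp: elements_mat_def)
qed

lemma Rep_mat_inject: "Rep_mat M = Rep_mat N \<Longrightarrow> M = N"
  by (auto simp: mat_eq_iff Rep_ratf_inject)

text \<open>Since \<open>inv\<close> is a definite description, uniqueness has to be shown as well.
  A competitor is pulled back to a matrix \<open>Z\<close> over \<open>ratf\<close>, where
  \<open>Z = N M Z = N\<close>.\<close>

lemma rmat_ring_inverse:
  fixes M N :: "('a :: field, 'd) ratf mat"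
  assumes M: "M \<in> carrier_mat n n" and N: "N \<in> carrier_mat n n"
    and MN: "M * N = 1\<^sub>m n" and NM: "N * M = 1\<^sub>m n"
  shows "Rep_mat M \<in> Units (rmat_ring free_skew_field n)"
    and "inv\<^bsub>rmat_ring free_skew_field n\<^esub> (Rep_mat M) = Rep_mat N"
proof -
  let ?R = "rmat_ring (free_skew_field :: ('a, 'd) nc_ratfun ring) n"
  have inv: "Rep_mat N \<in> carrier ?R" "Rep_mat M \<in> carrier ?R"
    "Rep_mat M \<otimes>\<^bsub>?R\<^esub> Rep_mat N = \<one>\<^bsub>?R\<^esub>" "Rep_mat N \<otimes>\<^bsub>?R\<^esub> Rep_mat M = \<one>\<^bsub>?R\<^esub>"
    using M N unfolding rmat_ring_def
    by (auto simp: rmat_carrier_iff rmat_mult_Rep[of _ n n _ n] MN NM rmat_scalar_one_Rep)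
  then show "Rep_mat M \<in> Units ?R" unfolding Units_def by auto
  have "y = Rep_mat N" if y: "y \<in> carrier ?R" "Rep_mat M \<otimes>\<^bsub>?R\<^esub> y = \<one>\<^bsub>?R\<^esub>" for y
  proof -
    obtain Z where Z: "Z \<in> carrier_mat n n" "y = Rep_mat Z"
      using y(1) unfolding rmat_ring_def by (auto simp: rmat_carrier_iff)
    have "Rep_mat (M * Z) = Rep_mat (1\<^sub>m n)"
      using y(2) unfolding rmat_ring_def Z
      by (simp add: rmat_mult_Rep[OF M Z(1)] rmat_scalar_one_Rep)
    then have MZ: "M * Z = 1\<^sub>m n" by (rule Rep_mat_inject)
    have "Z = N * M * Z" unfolding NM by (rule left_mult_one_mat[OF Z(1), symmetric])
    also have "\<dots> = N" unfolding assoc_mult_mat[OF N M Z(1)] MZ by (rule right_mult_one_mat[OF N])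
    finally show ?thesis using Z by simp
  qed
  then show "inv\<^bsub>?R\<^esub> (Rep_mat M) = Rep_mat N"
    unfolding m_inv_def by (intro the_equality conjI inv) blast
qed

lemma Rep_ratf_atoms:
  "nc_class (NC_Const c) = Rep_ratf (rconst c)" "nc_class (NC_Var k) = Rep_ratf (rvar k)"
  unfolding rconst_def rvar_def by (auto simp: Rep_rf nc_nondegenerate_intros)

lemma rconst_uminus: "rconst (- a) = - rconst a"
proof -
  have "rconst a + rconst (- a) = 0" using rconst_add[of a "- a"] by (simp add: rconst_zero)
  then show ?thesis by (rule minus_unique[symmetric])
qed

lemma rconst_minus: "rconst (a - b) = rconst a - rconst b"
  using rconst_add[of a "- b"] by (simp add: rconst_uminus)

lemma rconst_sum: "rconst (\<Sum>i\<in>I. f i) = (\<Sum>i\<in>I. rconst (f i))"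
  by (induction I rule: infinite_finite_induct) (auto simp: rconst_zero rconst_add)

section \<open>Linear pencils over the free skew field\<close>

abbreviation const_mat :: "'a :: field mat \<Rightarrow> ('a, 'd) ratf mat" where
  "const_mat \<equiv> map_mat rconst"

definition pencil :: "nat \<Rightarrow> nat \<Rightarrow> ('d :: finite \<Rightarrow> 'a :: field mat) \<Rightarrow> 'a mat \<Rightarrow> ('a, 'd) ratf mat" where
  "pencil p q F G = mat p q (\<lambda>(i, j). (\<Sum>k\<in>UNIV. rconst (F k $$ (i, j)) * rvar k) - rconst (G $$ (i, j)))"

lemma pencil_carrier [simp]: "pencil p q F G \<in> carrier_mat p q"
  unfolding pencil_def by simp

lemma pencil_dim [simp]: "dim_row (pencil p q F G) = p" "dim_col (pencil p q F G) = q"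
  unfolding pencil_def by auto

lemma pencil_index: "i < p \<Longrightarrow> j < q \<Longrightarrow> pencil p q F G $$ (i, j)
    = (\<Sum>k\<in>UNIV. rconst (F k $$ (i, j)) * rvar k) - rconst (G $$ (i, j))"
  unfolding pencil_def by simp

lemma const_mat_mult:
  assumes "M \<in> carrier_mat p q" "N \<in> carrier_mat q r"
  shows "const_mat (M * N) = const_mat M * const_mat N"
proof (rule eq_matI)
  fix i j assume "i < dim_row (const_mat M * const_mat N)" "j < dim_col (const_mat M * const_mat N)"
  then have ij: "i < p" "j < r" using assms by auto
  show "const_mat (M * N) $$ (i, j) = (const_mat M * const_mat N) $$ (i, j)"
    using ij assms
    by (simp add: index_mult_mat_sum[OF _ _ ij, of _ q] rconst_sum rconst_mult del: index_mult_mat(1))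
qed (use assms in auto)

lemma const_mat_pencil:
  assumes V: "V \<in> carrier_mat p q" and F: "\<And>k. F k \<in> carrier_mat q r" and G: "G \<in> carrier_mat q r"
  shows "const_mat V * pencil q r F G = pencil p r (\<lambda>k. V * F k) (V * G)"
proof (rule eq_matI)
  fix i j assume "i < dim_row (pencil p r (\<lambda>k. V * F k) (V * G))" "j < dim_col (pencil p r (\<lambda>k. V * F k) (V * G))"
  then have ij: "i < p" "j < r" by auto
  have cV: "const_mat V \<in> carrier_mat p q" using V by simp
  have "(const_mat V * pencil q r F G) $$ (i, j)
      = (\<Sum>l<q. rconst (V $$ (i, l)) * ((\<Sum>k\<in>UNIV. rconst (F k $$ (l, j)) * rvar k) - rconst (G $$ (l, j))))"
    unfolding index_mult_mat_sum[OF cV pencil_carrier ij]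
    using ij V by (intro sum.cong) (auto simp: pencil_index)
  also have "\<dots> = (\<Sum>l<q. \<Sum>k\<in>UNIV. rconst (V $$ (i, l) * F k $$ (l, j)) * rvar k)
      - (\<Sum>l<q. rconst (V $$ (i, l) * G $$ (l, j)))"
    by (simp add: right_diff_distrib sum_distrib_left sum_subtractf rconst_mult mult.assoc)
  also have "(\<Sum>l<q. \<Sum>k\<in>UNIV. rconst (V $$ (i, l) * F k $$ (l, j)) * rvar k)
      = (\<Sum>k\<in>UNIV. rconst (\<Sum>l<q. V $$ (i, l) * F k $$ (l, j)) * rvar k)"
    by (subst sum.swap) (simp add: sum_distrib_right rconst_sum)
  also have "(\<Sum>l<q. rconst (V $$ (i, l) * G $$ (l, j))) = rconst (\<Sum>l<q. V $$ (i, l) * G $$ (l, j))"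
    by (rule rconst_sum[symmetric])
  also have "(\<Sum>k\<in>UNIV. rconst (\<Sum>l<q. V $$ (i, l) * F k $$ (l, j)) * rvar k) - rconst (\<Sum>l<q. V $$ (i, l) * G $$ (l, j))
      = pencil p r (\<lambda>k. V * F k) (V * G) $$ (i, j)"
    unfolding pencil_index[OF ij] index_mult_mat_sum[OF V F ij] index_mult_mat_sum[OF V G ij] ..
  finally show "(const_mat V * pencil q r F G) $$ (i, j) = pencil p r (\<lambda>k. V * F k) (V * G) $$ (i, j)" .
qed (use V in auto)

text \<open>The coefficients stand to the left of the variables, so a constant factor on the right
  has to move past them; constants are central.\<close>

lemma pencil_const_mat:
  assumes V: "V \<in> carrier_mat q r" and F: "\<And>k. F k \<in> carrier_mat p q" and G: "G \<in> carrier_mat p q"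
  shows "pencil p q F G * const_mat V = pencil p r (\<lambda>k. F k * V) (G * V)"
proof (rule eq_matI)
  fix i j assume "i < dim_row (pencil p r (\<lambda>k. F k * V) (G * V))" "j < dim_col (pencil p r (\<lambda>k. F k * V) (G * V))"
  then have ij: "i < p" "j < r" by auto
  have cV: "const_mat V \<in> carrier_mat q r" using V by simp
  have "(pencil p q F G * const_mat V) $$ (i, j)
      = (\<Sum>l<q. ((\<Sum>k\<in>UNIV. rconst (F k $$ (i, l)) * rvar k) - rconst (G $$ (i, l))) * rconst (V $$ (l, j)))"
    unfolding index_mult_mat_sum[OF pencil_carrier cV ij]
    using ij V by (intro sum.cong) (auto simp: pencil_index)
  also have "\<dots> = (\<Sum>l<q. \<Sum>k\<in>UNIV. rconst (F k $$ (i, l) * V $$ (l, j)) * rvar k)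
      - (\<Sum>l<q. rconst (G $$ (i, l) * V $$ (l, j)))"
    by (simp add: left_diff_distrib sum_distrib_right sum_subtractf rconst_mult mult.assoc
        rconst_commute[of _ "rvar _", symmetric])
  also have "(\<Sum>l<q. \<Sum>k\<in>UNIV. rconst (F k $$ (i, l) * V $$ (l, j)) * rvar k)
      = (\<Sum>k\<in>UNIV. rconst (\<Sum>l<q. F k $$ (i, l) * V $$ (l, j)) * rvar k)"
    by (subst sum.swap) (simp add: sum_distrib_right rconst_sum)
  also have "(\<Sum>l<q. rconst (G $$ (i, l) * V $$ (l, j))) = rconst (\<Sum>l<q. G $$ (i, l) * V $$ (l, j))"
    by (rule rconst_sum[symmetric])
  also have "(\<Sum>k\<in>UNIV. rconst (\<Sum>l<q. F k $$ (i, l) * V $$ (l, j)) * rvar k) - rconst (\<Sum>l<q. G $$ (i, l) * V $$ (l, j))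
      = pencil p r (\<lambda>k. F k * V) (G * V) $$ (i, j)"
    unfolding pencil_index[OF ij] index_mult_mat_sum[OF F V ij] index_mult_mat_sum[OF G V ij] ..
  finally show "(pencil p q F G * const_mat V) $$ (i, j) = pencil p r (\<lambda>k. F k * V) (G * V) $$ (i, j)" .
qed (use V in auto)

lemma pencil_add:
  assumes "\<And>k. F k \<in> carrier_mat p q" "G \<in> carrier_mat p q" "\<And>k. F' k \<in> carrier_mat p q" "G' \<in> carrier_mat p q"
  shows "pencil p q F G + pencil p q F' G' = pencil p q (\<lambda>k. F k + F' k) (G + G')"
proof (rule eq_matI)
  fix i j assume "i < dim_row (pencil p q (\<lambda>k. F k + F' k) (G + G'))" "j < dim_col (pencil p q (\<lambda>k. F k + F' k) (G + G'))"
  then have ij: "i < p" "j < q" by auto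
  show "(pencil p q F G + pencil p q F' G') $$ (i, j) = pencil p q (\<lambda>k. F k + F' k) (G + G') $$ (i, j)"
    using ij carrier_matD[OF assms(2)] carrier_matD[OF assms(4)] carrier_matD[OF assms(1)] carrier_matD[OF assms(3)]
    by (simp add: pencil_index rconst_add ring_distribs sum.distrib)
qed auto

lemma skew_pencil_Rep:
  "skew_pencil s p q T Y = Rep_mat (pencil p q (\<lambda>k. T k (1\<^sub>m s)) (mat_sum p q (\<lambda>k. T k (Y k))))"
proof (rule eq_matI)
  fix i j
  assume "i < dim_row (Rep_mat (pencil p q (\<lambda>k. T k (1\<^sub>m s)) (mat_sum p q (\<lambda>k. T k (Y k)))))"
    "j < dim_col (Rep_mat (pencil p q (\<lambda>k. T k (1\<^sub>m s)) (mat_sum p q (\<lambda>k. T k (Y k)))))"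
  then have ij: "i < p" "j < q" by auto
  have "skew_pencil s p q T Y $$ (i, j)
      = Rep_ratf (\<Sum>k\<in>UNIV. rconst (T k (1\<^sub>m s) $$ (i, j)) * rvar k - rconst (T k (Y k) $$ (i, j)))"
    using ij by (simp add: skew_pencil_def Rep_ratf_atoms Rep_ratf_ops Rep_ratf_minus Rep_ratf_finsum)
  then show "skew_pencil s p q T Y $$ (i, j)
      = Rep_mat (pencil p q (\<lambda>k. T k (1\<^sub>m s)) (mat_sum p q (\<lambda>k. T k (Y k)))) $$ (i, j)"
    using ij by (simp add: pencil_index mat_sum_index rconst_sum sum_subtractf)
qed (auto simp: skew_pencil_def)

text \<open>In \<open>E_0i R = R E_0i\<close> the entry at \<open>(0, j)\<close> is
  \<open>R_ij\<close> on the left; on the right it is \<open>R_00\<close> for \<open>j = i\<close>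
  and zero otherwise.\<close>

lemma scalar_of_commuting:
  fixes R :: "'r :: ring_1 mat"
  assumes R: "R \<in> carrier_mat s s" and s: "0 < s"
    and comm: "\<And>p q. p < s \<Longrightarrow> q < s \<Longrightarrow> unit_mat s p q * R = R * unit_mat s p q"
  shows "R = mat s s (\<lambda>(i, j). if i = j then R $$ (0, 0) else 0)"
proof (rule eq_matI)
  fix i j assume "i < dim_row (mat s s (\<lambda>(i, j). if i = j then R $$ (0, 0) else 0))"
    "j < dim_col (mat s s (\<lambda>(i, j). if i = j then R $$ (0, 0) else 0))"
  then have ij: "i < s" "j < s" by auto
  have "(unit_mat s 0 i * R) $$ (0, j) = (R * unit_mat s 0 i) $$ (0, j)" using comm[OF s ij(1)] by simp
  then have "R $$ (i, j) = (if j = i then R $$ (0, 0) else 0)"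
    using unit_mat_mult_index[OF R ij(1) s ij(2), of 0] mult_unit_mat_index[OF R s s ij(2), of i] by simp
  then show "R $$ (i, j) = mat s s (\<lambda>(i, j). if i = j then R $$ (0, 0) else 0) $$ (i, j)"
    using ij by auto
qed (use R in auto)

lemma const_mat_unit: "const_mat (unit_mat s p q) = unit_mat s p q"
  by (rule eq_matI) (auto simp: unit_mat_index rconst_zero rconst_one)

section \<open>The realization as a matrix over \<open>ratf\<close>\<close>

context lost_abbey
begin

text \<open>\<open>Q\<close> is the negative of \<delta>, so that it is literally a pencil. With
  \<open>W\<close> its inverse, the realization becomes \<open>D - C * W * P\<close>.\<close>

definition Q :: "('a, 'd) ratf mat" where "Q = pencil L L (\<lambda>k. A k (1\<^sub>m s)) N"

definition P :: "('a, 'd) ratf mat" where "P = pencil L s (\<lambda>k. B k (1\<^sub>m s)) M"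

lemma QP_carrier: "Q \<in> carrier_mat L L" "P \<in> carrier_mat L s"
  unfolding Q_def P_def by auto

lemma skew_delta_Rep: "skew_delta s L A Y = Rep_mat (- Q)"
proof -
  let ?E = "pencil L L (\<lambda>k. A k (1\<^sub>m s)) (mat_sum L L (\<lambda>k. A k (Y k)))"
  have "1\<^sub>m L - ?E = - Q"
  proof (rule eq_matI)
    fix i j assume "i < dim_row (- Q)" "j < dim_col (- Q)"
    then have ij: "i < L" "j < L" using QP_carrier by auto
    then show "(1\<^sub>m L - ?E) $$ (i, j) = (- Q) $$ (i, j)"
      by (auto simp: Q_def N_def pencil_index rconst_add rconst_zero rconst_one)
  qed (use QP_carrier in auto)
  then show ?thesis
    unfolding skew_delta_def rmat_scalar_one_Rep skew_pencil_Rep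
    by (simp add: rmat_minus_Rep[of _ L L])
qed

lemma skew_pencil_B_Rep: "skew_pencil s L s B Y = Rep_mat P"
  unfolding skew_pencil_Rep P_def M_def ..

lemma const_U_Q:
  assumes S: "S \<in> carrier_mat s s"
  shows "const_mat (U S) * Q = Q * const_mat (T S)"
  unfolding Q_def
  using U[OF S] T[OF S] N A[OF one_carrier_mat]
  by (simp add: const_mat_pencil[of _ L L] pencil_const_mat[of _ L L] A_unit_T[OF S] U_N[OF S])

lemma const_U_P:
  assumes S: "S \<in> carrier_mat s s"
  shows "const_mat (U S) * P = P * const_mat S + Q * const_mat (BS S)"
proof -
  note A1 = A[OF one_carrier_mat] and B1 = B[OF one_carrier_mat]
  have "const_mat (U S) * P = pencil L s (\<lambda>k. U S * B k (1\<^sub>m s)) (U S * M)"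
    unfolding P_def by (rule const_mat_pencil[OF U[OF S] B1 M])
  also have "\<dots> = pencil L s (\<lambda>k. B k (1\<^sub>m s) * S + A k (1\<^sub>m s) * BS S) (M * S + N * BS S)"
    using A_unit_T(4)[OF S] by (simp add: A_unit_T(3)[OF S] U_M[OF S])
  also have "\<dots> = pencil L s (\<lambda>k. B k (1\<^sub>m s) * S) (M * S) + pencil L s (\<lambda>k. A k (1\<^sub>m s) * BS S) (N * BS S)"
    using A1 B1 M N S BS by (intro pencil_add[symmetric]) (auto intro: mult_carrier_mat)
  also have "pencil L s (\<lambda>k. B k (1\<^sub>m s) * S) (M * S) = P * const_mat S"
    unfolding P_def by (rule pencil_const_mat[OF S B1 M, symmetric])
  also have "pencil L s (\<lambda>k. A k (1\<^sub>m s) * BS S) (N * BS S) = Q * const_mat (BS S)"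
    unfolding Q_def by (rule pencil_const_mat[OF BS A1 N, symmetric])
  finally show ?thesis .
qed

text \<open>Moving \<open>S\<close> through \<open>C W P\<close> uses \<open>S C = C T\<close>,
  \<open>T W = W U\<close> and \<open>U P = P S + Q BS\<close>. The extra term
  \<open>C W Q BS = C BS\<close> equals \<open>S D - D S\<close> and compensates for the failure of
  \<open>D\<close> to commute with \<open>S\<close>.\<close>

lemma realization_commutes:
  assumes S: "S \<in> carrier_mat s s" and W: "W \<in> carrier_mat L L"
    and QW: "Q * W = 1\<^sub>m L" and WQ: "W * Q = 1\<^sub>m L"
  defines "R \<equiv> const_mat D - const_mat C * W * P"
  shows "const_mat S * R = R * const_mat S"
proof -
  note c = QP_carrier W
  have cU: "const_mat (U S) \<in> carrier_mat L L" and cT: "const_mat (T S) \<in> carrier_mat L L"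
    and cS: "const_mat S \<in> carrier_mat s s" and cC: "const_mat C \<in> carrier_mat s L"
    and cD: "const_mat D \<in> carrier_mat s s" and cB: "const_mat (BS S) \<in> carrier_mat L s"
    using U[OF S] T[OF S] S C D BS[of S] by auto
  have CW: "const_mat C * W \<in> carrier_mat s L" and CWP: "const_mat C * W * P \<in> carrier_mat s s"
    using cC W QP_carrier by auto
  \<comment> \<open>The relation \<open>U Q = Q T\<close>, multiplied by \<open>W\<close> on both
    sides.\<close>
  have TW: "const_mat (T S) * W = W * const_mat (U S)"
  proof -
    have "const_mat (T S) * W = (W * Q) * (const_mat (T S) * W)" using cT W WQ by simp
    also have "\<dots> = W * (Q * (const_mat (T S) * W))" using c cT by (intro assoc_mult_mat) auto
    also have "Q * (const_mat (T S) * W) = (Q * const_mat (T S)) * W"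
      using c cT by (intro assoc_mult_mat[symmetric]) auto
    also have "\<dots> = const_mat (U S) * (Q * W)"
      unfolding const_U_Q[OF S, symmetric] using c cU by (intro assoc_mult_mat) auto
    also have "\<dots> = const_mat (U S)" using QW cU by simp
    finally show ?thesis .
  qed
  have SC: "const_mat S * const_mat C = const_mat C * const_mat (T S)"
    by (simp only: const_mat_mult[OF S C, symmetric] const_mat_mult[OF C T[OF S], symmetric] C_T[OF S])
  have "const_mat S * (const_mat C * W * P) = const_mat S * (const_mat C * W) * P"
    by (rule assoc_mult_mat[OF cS CW c(2), symmetric])
  also have "const_mat S * (const_mat C * W) = const_mat S * const_mat C * W"
    by (rule assoc_mult_mat[OF cS cC W, symmetric])
  also have "\<dots> = const_mat C * (const_mat (T S) * W)"
    unfolding SC by (rule assoc_mult_mat[OF cC cT W])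
  also have "\<dots> = const_mat C * W * const_mat (U S)"
    unfolding TW by (rule assoc_mult_mat[OF cC W cU, symmetric])
  also have "\<dots> * P = const_mat C * W * (const_mat (U S) * P)"
    by (rule assoc_mult_mat[OF CW cU c(2)])
  also have "\<dots> = const_mat C * W * (P * const_mat S) + const_mat C * W * (Q * const_mat (BS S))"
    unfolding const_U_P[OF S]
    by (rule mult_add_distrib_mat[OF CW mult_carrier_mat[OF c(2) cS] mult_carrier_mat[OF c(1) cB]])
  also have "const_mat C * W * (P * const_mat S) = const_mat C * W * P * const_mat S"
    by (rule assoc_mult_mat[OF CW c(2) cS, symmetric])
  also have "const_mat C * W * (Q * const_mat (BS S)) = const_mat C * (W * (Q * const_mat (BS S)))"
    using cC W c cB by (intro assoc_mult_mat) auto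
  also have "W * (Q * const_mat (BS S)) = const_mat (BS S)"
    using assoc_mult_mat[OF W c(1) cB] WQ cB by simp
  finally have SCWP: "const_mat S * (const_mat C * W * P)
      = const_mat C * W * P * const_mat S + const_mat C * const_mat (BS S)" .
  have CBS: "const_mat C * const_mat (BS S) = const_mat S * const_mat D - const_mat D * const_mat S"
  proof -
    have "const_mat C * const_mat (BS S) = const_mat (S * D - D * S)"
      by (simp only: const_mat_mult[OF C BS, symmetric] C_BS[OF S])
    also have "\<dots> = const_mat (S * D) - const_mat (D * S)"
      using S D by (intro eq_matI) (auto simp: rconst_minus)
    finally show ?thesis by (simp only: const_mat_mult[OF S D] const_mat_mult[OF D S])
  qed
  have "const_mat S * R = const_mat S * const_mat D - const_mat S * (const_mat C * W * P)"
    unfolding R_def using cS cD CWP by (intro mult_minus_distrib_mat) auto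
  also have "\<dots> = const_mat D * const_mat S - const_mat C * W * P * const_mat S"
    unfolding SCWP CBS using cS cD CWP by (intro eq_matI) (auto simp del: index_mult_mat(1))
  also have "\<dots> = R * const_mat S"
    unfolding R_def using cS cD CWP by (intro minus_mult_distrib_mat[symmetric]) auto
  finally show ?thesis .
qed

lemma realization_scalar:
  assumes s: "s \<ge> 1" and W: "W \<in> carrier_mat L L"
    and QW: "Q * W = 1\<^sub>m L" and WQ: "W * Q = 1\<^sub>m L"
  defines "R \<equiv> const_mat D - const_mat C * W * P"
  shows "R = mat s s (\<lambda>(i, j). if i = j then R $$ (0, 0) else 0)"
proof (rule scalar_of_commuting)
  show "R \<in> carrier_mat s s" unfolding R_def using D C W QP_carrier by auto
  show "unit_mat s p q * R = R * unit_mat s p q" for p q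
    using realization_commutes[OF unit_mat_carrier W QW WQ, of p q]
    unfolding const_mat_unit R_def .
qed (use s in simp)

lemma skew_realization_Rep:
  assumes W: "W \<in> carrier_mat L L" and QW: "Q * W = 1\<^sub>m L" and WQ: "W * Q = 1\<^sub>m L"
  shows "skew_delta s L A Y \<in> Units (rmat_ring free_skew_field L)"
    and "skew_realization s L D C A B Y = Rep_mat (const_mat D - const_mat C * W * P)"
proof -
  have mQ: "- Q \<in> carrier_mat L L" and mW: "- W \<in> carrier_mat L L" using QP_carrier W by auto
  have i: "(- Q) * (- W) = 1\<^sub>m L" "(- W) * (- Q) = 1\<^sub>m L"
    using QW WQ QP_carrier W by auto
  note inv = rmat_ring_inverse[OF mQ mW i]
  show "skew_delta s L A Y \<in> Units (rmat_ring free_skew_field L)"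
    unfolding skew_delta_Rep by (rule inv(1))
  have cC: "const_mat C \<in> carrier_mat s L" and cD: "const_mat D \<in> carrier_mat s s" using C D by auto
  have CW: "const_mat C * (- W) \<in> carrier_mat s L" and CWP: "const_mat C * (- W) * P \<in> carrier_mat s s"
    using cC mW QP_carrier by auto
  have const: "map_mat (\<lambda>c. nc_class (NC_Const c)) Z = Rep_mat (const_mat Z)" for Z :: "'a mat"
    by (intro eq_matI) (auto simp: Rep_ratf_atoms)
  have "skew_realization s L D C A B Y = Rep_mat (const_mat D + const_mat C * (- W) * P)"
    unfolding skew_realization_def const skew_delta_Rep inv(2) skew_pencil_B_Rep
      rmat_mult_Rep[OF cC mW] rmat_mult_Rep[OF CW QP_carrier(2)] rmat_add_Rep[OF cD CWP] ..
  also have "const_mat D + const_mat C * (- W) * P = const_mat D - const_mat C * W * P"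
    using cC W QP_carrier cD by (simp add: add_uminus_minus_mat)
  finally show "skew_realization s L D C A B Y = Rep_mat (const_mat D - const_mat C * W * P)" .
qed

end

section \<open>Evaluation of the realization\<close>

lemma reval_pencil:
  assumes n: "n \<ge> 1" and X: "X \<in> mat_tuples n" and ij: "i < p" "j < q"
  shows "pencil p q F G $$ (i, j) \<in> rdef n X"
    and "a < n \<Longrightarrow> b < n \<Longrightarrow> reval n X (pencil p q F G $$ (i, j)) $$ (a, b)
      = (\<Sum>k\<in>UNIV. F k $$ (i, j) * X k $$ (a, b)) - (if a = b then G $$ (i, j) else 0)"
proof -
  interpret matrix_rep n "reval n X" "rdef n X" by (rule matrix_rep_reval[OF n X])
  note c = rconst_rdef[OF n X] and v = rvar_rdef[OF n X]
  have Xk: "X k \<in> carrier_mat n n" for k using X unfolding mat_tuples_def by auto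
  have t: "rconst (F k $$ (i, j)) * rvar k \<in> rdef n X" for k
    by (rule mult_in[OF c(1) v(1)])
  have s: "(\<Sum>k\<in>UNIV. rconst (F k $$ (i, j)) * rvar k) \<in> rdef n X" by (rule sum_in[OF t])
  show "pencil p q F G $$ (i, j) \<in> rdef n X"
    unfolding pencil_index[OF ij] by (rule minus_in[OF s c(1)])
  assume ab: "a < n" "b < n"
  have "reval n X (rconst (F k $$ (i, j)) * rvar k) $$ (a, b) = F k $$ (i, j) * X k $$ (a, b)" for k
  proof -
    have "reval n X (rconst (F k $$ (i, j)) * rvar k) = (F k $$ (i, j) \<cdot>\<^sub>m 1\<^sub>m n) * X k"
      by (simp add: h_mult[OF c(1) v(1)] c(2) v(2))
    also have "\<dots> = F k $$ (i, j) \<cdot>\<^sub>m X k"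
      using Xk[of k] by (subst mult_smult_assoc_mat[of _ n n _ n]) auto
    finally show ?thesis using ab Xk[of k] by simp
  qed
  moreover have "reval n X (\<Sum>k\<in>UNIV. rconst (F k $$ (i, j)) * rvar k) $$ (a, b)
      = (\<Sum>k\<in>UNIV. reval n X (rconst (F k $$ (i, j)) * rvar k) $$ (a, b))"
    by (rule h_sum[OF t ab])
  ultimately show "reval n X (pencil p q F G $$ (i, j)) $$ (a, b)
      = (\<Sum>k\<in>UNIV. F k $$ (i, j) * X k $$ (a, b)) - (if a = b then G $$ (i, j) else 0)"
    unfolding pencil_index[OF ij] h_minus[OF s c(1)] c(2)
    using ab h_dim[OF s] by simp
qed

lemma index_mult_mat_blocks:
  fixes V :: "'a :: semiring_0 mat"
  assumes "V \<in> carrier_mat p (m * k)" "Z \<in> carrier_mat (m * k) c" "i < p" "b < c"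
  shows "(V * Z) $$ (i, b) = (\<Sum>j<m. \<Sum>l<k. V $$ (i, j * k + l) * Z $$ (j * k + l, b))"
proof -
  have "(V * Z) $$ (i, b) = (\<Sum>x<m * k. V $$ (i, x div k * k + x mod k) * Z $$ (x div k * k + x mod k, b))"
    using index_mult_mat_sum[OF assms] by simp
  also have "\<dots> = (\<Sum>j<m. \<Sum>l<k. V $$ (i, j * k + l) * Z $$ (j * k + l, b))"
    by (rule sum_div_mod)
  finally show ?thesis .
qed

lemma fm_pencil_index:
  assumes T: "\<And>k. linear_mat_map s p q (T k)" and Y: "\<And>k. Y k \<in> carrier_mat s s"
    and X: "\<And>k. X k \<in> carrier_mat (s * m) (s * m)"
    and ij: "i < m" "j < m" and l: "l < p" "l' < q"
  shows "fm_pencil s p q T Y m X $$ (i * p + l, j * q + l')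
    = (\<Sum>k\<in>UNIV. T k (mat_block s (X k) i j) $$ (l, l'))
      - (if i = j then \<Sum>k\<in>UNIV. T k (Y k) $$ (l, l') else 0)"
proof -
  have less: "i * p + l < p * m" "j * q + l' < q * m"
    using block_index_combine[OF ij(1) l(1)] block_index_combine[OF ij(2) l(2)] by (auto simp: mult.commute)
  have "T k (mat_block s (X k - kron (1\<^sub>m m) (Y k)) i j) $$ (l, l')
    = T k (mat_block s (X k) i j) $$ (l, l') - (if i = j then T k (Y k) $$ (l, l') else 0)" for k
  proof -
    let ?Z = "if i = j then Y k else 0\<^sub>m s s"
    have "mat_block s (X k - kron (1\<^sub>m m) (Y k)) i j = mat_block s (X k) i j - ?Z"
    proof (rule eq_matI)
      fix a b assume "a < dim_row (mat_block s (X k) i j - ?Z)" "b < dim_col (mat_block s (X k) i j - ?Z)"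
      then have ab: "a < s" "b < s" using Y[of k] by (auto split: if_splits)
      have less': "i * s + a < m * s" "j * s + b < m * s"
        using block_index_combine[OF ij(1) ab(1)] block_index_combine[OF ij(2) ab(2)] by auto
      then show "mat_block s (X k - kron (1\<^sub>m m) (Y k)) i j $$ (a, b) = (mat_block s (X k) i j - ?Z) $$ (a, b)"
        using ab ij Y[of k] by (auto simp: mat_block_def kron_def mult.commute[of s m])
    qed (use Y[of k] in \<open>auto simp: mat_block_def\<close>)
    moreover have "mat_block s (X k) i j \<in> carrier_mat s s" "?Z \<in> carrier_mat s s"
      using Y[of k] by (auto simp: mat_block_def)
    ultimately have e: "T k (mat_block s (X k - kron (1\<^sub>m m) (Y k)) i j) = T k (mat_block s (X k) i j) - T k ?Z"
      using linear_mat_map_minus[OF T] by simp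
    have "T k (0\<^sub>m s s) = 0\<^sub>m p q" by (rule linear_mat_map_zero[OF T])
    then show ?thesis
      unfolding e using l linear_mat_mapD(1)[OF T Y, of k k] by auto
  qed
  then show ?thesis
    unfolding fm_pencil_def using less l
    by (auto simp: mat_sum_index block_ext_def sum_subtractf)
qed

lemma fm_pencil_carrier: "fm_pencil s p q T Y m X \<in> carrier_mat (p * m) (q * m)"
  unfolding fm_pencil_def by simp

lemma block_index_div_mod: "x < k \<Longrightarrow> (l * k + x) div k = l \<and> (l * k + x) mod k = x" for x k l :: nat
  by auto

section \<open>Comparison of \<delta>(X) with \<Lambda>(X)\<close>

locale lost_abbey_point = lost_abbey s L D C A B Y
  for s L :: nat and D C :: "'a :: field mat"
    and A B :: "'d :: finite \<Rightarrow> 'a mat \<Rightarrow> 'a mat" and Y :: "'d \<Rightarrow> 'a mat" +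
  fixes m :: nat and X :: "'d \<Rightarrow> 'a mat"
  assumes s: "s \<ge> 1" and m: "m \<ge> 1" and Omega: "X \<in> fm_Omega s L A Y m"
begin

abbreviation n :: nat where "n \<equiv> s * m"

lemma n: "n \<ge> 1" and n_eq: "n = m * s"
  using s m by (auto simp: mult.commute)

lemma X_tuple: "X \<in> mat_tuples n" and X: "X k \<in> carrier_mat n n"
  and det_Lambda: "det (fm_Lambda s L A Y m X) \<noteq> 0"
  using Omega unfolding fm_Omega_def mat_tuples_def by auto

lemma block_less: "i < m \<Longrightarrow> p < s \<Longrightarrow> i * s + p < n"
  unfolding n_eq by (rule block_index_combine)

definition XB :: "'d \<Rightarrow> nat \<Rightarrow> nat \<Rightarrow> 'a mat" where "XB k i j = mat_block s (X k) i j"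

lemma XB: "XB k i j \<in> carrier_mat s s"
  and XB_index: "p < s \<Longrightarrow> q < s \<Longrightarrow> XB k i j $$ (p, q) = X k $$ (i * s + p, j * s + q)"
  unfolding XB_def mat_block_def by auto

text \<open>The sign matches that of \<open>Q\<close>. The index orders differ: here the block
  number \<open>i\<close> is outermost, while evaluating \<open>Q\<close> puts the state index
  outermost.\<close>

definition Lam :: "'a mat" where "Lam = - fm_Lambda s L A Y m X"

lemma Lambda_carrier: "fm_Lambda s L A Y m X \<in> carrier_mat (m * L) (m * L)"
  using fm_pencil_carrier[of s L L A Y m X] unfolding fm_Lambda_def by (auto simp: mult.commute)

lemma Lam: "Lam \<in> carrier_mat (m * L) (m * L)"
  unfolding Lam_def using Lambda_carrier by auto

lemma Lam_index:
  assumes "i < m" "j < m" "l < L" "l' < L"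
  shows "Lam $$ (i * L + l, j * L + l')
    = (\<Sum>k\<in>UNIV. A k (XB k i j) $$ (l, l')) - (if i = j then N $$ (l, l') else 0)"
proof -
  have less: "i * L + l < m * L" "j * L + l' < m * L"
    using assms by (auto intro: block_index_combine)
  have eq: "i * L + l = j * L + l' \<longleftrightarrow> i = j \<and> l = l'"
    using assms by (metis add.commute add_right_cancel div_less div_mult_self3 add.right_neutral less_nat_zero_code)
  show ?thesis
    using less assms fm_pencil_carrier[of s L L A Y m X]
    unfolding Lam_def fm_Lambda_def N_def
    by (auto simp: mult.commute[of L m] fm_pencil_index[OF lin_A Y X assms] XB_def mat_sum_index eq)
qed

definition PB :: "'a mat" where "PB = fm_pencil s L s B Y m X"

lemma PB: "PB \<in> carrier_mat (m * L) n"
  using fm_pencil_carrier[of s L s B Y m X] unfolding PB_def by (simp add: mult.commute)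

lemma PB_index:
  assumes "i < m" "j < m" "l < L" "q < s"
  shows "PB $$ (i * L + l, j * s + q)
    = (\<Sum>k\<in>UNIV. B k (XB k i j) $$ (l, q)) - (if i = j then M $$ (l, q) else 0)"
  using assms unfolding PB_def M_def
  by (auto simp: fm_pencil_index[OF lin_B Y X assms] XB_def mat_sum_index)

text \<open>A vector indexed by \<open>(l, i, p)\<close>, where \<open>l < L\<close>, \<open>i < m\<close>, \<open>p < s\<close>, is sent to one indexed by \<open>(i, l)\<close>.\<close>
definition collapse :: "(nat \<Rightarrow> 'a mat) \<Rightarrow> 'a mat" where
  "collapse F = mat (m * L) (L * n) (\<lambda>(x, y).
     if (y mod n) div s = x div L then F ((y mod n) mod s) $$ (x mod L, y div n) else 0)"

lemma collapse_carrier: "collapse F \<in> carrier_mat (m * L) (L * n)"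
  unfolding collapse_def by simp

lemma collapse_index:
  assumes "i < m" "j < m" "l < L" "l' < L" "q < s"
  shows "collapse F $$ (i * L + l, l' * n + (j * s + q)) = (if j = i then F q $$ (l, l') else 0)"
proof -
  have less: "i * L + l < m * L" "l' * n + (j * s + q) < L * n" "j * s + q < n"
    using assms by (auto intro!: block_index_combine block_less)
  have d: "(l' * n + (j * s + q)) div n = l'" "(l' * n + (j * s + q)) mod n = j * s + q"
    using block_index_div_mod[OF less(3), of l'] by simp_all
  have e: "(j * s + q) div s = j" "(j * s + q) mod s = q" "(i * L + l) div L = i" "(i * L + l) mod L = l"
    using assms by simp_all
  show ?thesis unfolding collapse_def index_mat(1)[OF less(1,2)] prod.case d e ..
qed

lemma collapse_mult:
  assumes Z: "Z \<in> carrier_mat (L * n) c" and il: "i < m" "l < L" and b: "b < c"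
  shows "(collapse F * Z) $$ (i * L + l, b)
    = (\<Sum>l'<L. \<Sum>p<s. F p $$ (l, l') * Z $$ (l' * n + (i * s + p), b))"
proof -
  have "(collapse F * Z) $$ (i * L + l, b)
      = (\<Sum>l'<L. \<Sum>a<n. collapse F $$ (i * L + l, l' * n + a) * Z $$ (l' * n + a, b))"
    by (rule index_mult_mat_blocks[OF collapse_carrier Z]) (use il b in \<open>auto intro: block_index_combine\<close>)
  also have "\<dots> = (\<Sum>l'<L. \<Sum>p<s. F p $$ (l, l') * Z $$ (l' * n + (i * s + p), b))"
  proof (rule sum.cong[OF refl])
    fix l' assume "l' \<in> {..<L}"
    then have l': "l' < L" by simp
    have "(\<Sum>a<n. collapse F $$ (i * L + l, l' * n + a) * Z $$ (l' * n + a, b))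
        = (\<Sum>a<m * s. collapse F $$ (i * L + l, l' * n + (a div s * s + a mod s)) * Z $$ (l' * n + (a div s * s + a mod s), b))"
      unfolding n_eq by simp
    also have "\<dots> = (\<Sum>j<m. \<Sum>p<s. collapse F $$ (i * L + l, l' * n + (j * s + p)) * Z $$ (l' * n + (j * s + p), b))"
      by (rule sum_div_mod)
    also have "\<dots> = (\<Sum>j<m. if j = i then \<Sum>p<s. F p $$ (l, l') * Z $$ (l' * n + (j * s + p), b) else 0)"
      using il l' by (intro sum.cong) (auto simp: collapse_index)
    also have "\<dots> = (\<Sum>p<s. F p $$ (l, l') * Z $$ (l' * n + (i * s + p), b))"
      using il by simp
    finally show "(\<Sum>a<n. collapse F $$ (i * L + l, l' * n + a) * Z $$ (l' * n + a, b))
        = (\<Sum>p<s. F p $$ (l, l') * Z $$ (l' * n + (i * s + p), b))" .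
  qed
  finally show ?thesis .
qed

text \<open>For a vector with parts \<open>z(i, p)\<close> of length \<open>L\<close>, part
  \<open>i\<close> of \<open>TT r * z\<close> is \<open>\<Sum>_p T(E_pr) z(i, p)\<close>. A single
  \<open>r\<close> may lose information, but all \<open>r < s\<close> together determine
  \<open>z\<close>.\<close>

definition TT :: "nat \<Rightarrow> 'a mat" where "TT r = collapse (\<lambda>p. T (unit_mat s p r))"
definition UU :: "nat \<Rightarrow> 'a mat" where "UU r = collapse (\<lambda>p. U (unit_mat s p r))"

text \<open>With \<open>X_ij\<close> a block of \<open>X\<close>, the sum over \<open>p\<close> of
  its entries at \<open>(p, q)\<close> times \<open>E_pr\<close> is \<open>X_ij E_qr\<close>.
  Summation against \<open>U(E_pr)\<close> thus assembles scalar entries into a matrix argument of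
  \<open>H\<close>, which will be \<open>A\<close> or \<open>B\<close>.\<close>

lemma U_pencil:
  assumes lin: "\<And>k. linear_mat_map s L w (H k)"
    and UH: "\<And>k p. U (unit_mat s p r) * H k (1\<^sub>m s) = H k (unit_mat s p r)"
    and G: "G \<in> carrier_mat L w" and r: "r < s"
    and ij: "i < m" "j < m" and lc: "l < L" "c < w" and q: "q < s"
  shows "(\<Sum>l'<L. \<Sum>p<s. U (unit_mat s p r) $$ (l, l') *
      ((\<Sum>k\<in>UNIV. H k (1\<^sub>m s) $$ (l', c) * X k $$ (i * s + p, j * s + q))
        - (if i * s + p = j * s + q then G $$ (l', c) else 0)))
    = (\<Sum>k\<in>UNIV. H k (XB k i j * unit_mat s q r) $$ (l, c))
      - (if i = j then (U (unit_mat s q r) * G) $$ (l, c) else 0)"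
proof -
  note Up = U[OF unit_mat_carrier]
  note H1 = linear_mat_mapD(1)[OF lin one_carrier_mat]
  have eq: "i * s + p = j * s + q \<longleftrightarrow> i = j \<and> p = q" if "p < s" for p
    using that q by (metis add_left_cancel div_mult_self3 div_less add.right_neutral gr_implies_not0)
  have "(\<Sum>l'<L. \<Sum>p<s. U (unit_mat s p r) $$ (l, l') *
      ((\<Sum>k\<in>UNIV. H k (1\<^sub>m s) $$ (l', c) * X k $$ (i * s + p, j * s + q))
        - (if i * s + p = j * s + q then G $$ (l', c) else 0)))
    = (\<Sum>l'<L. \<Sum>p<s. \<Sum>k\<in>UNIV. XB k i j $$ (p, q) * (U (unit_mat s p r) $$ (l, l') * H k (1\<^sub>m s) $$ (l', c)))
      - (\<Sum>l'<L. \<Sum>p<s. if p = q then if i = j then U (unit_mat s p r) $$ (l, l') * G $$ (l', c) else 0 else 0)"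
    unfolding sum_subtractf[symmetric]
    using q by (intro sum.cong refl) (auto simp: right_diff_distrib sum_distrib_left XB_index eq mult.assoc mult.commute mult.left_commute)
  also have "(\<Sum>l'<L. \<Sum>p<s. \<Sum>k\<in>UNIV. XB k i j $$ (p, q) * (U (unit_mat s p r) $$ (l, l') * H k (1\<^sub>m s) $$ (l', c)))
      = (\<Sum>p<s. \<Sum>k\<in>UNIV. XB k i j $$ (p, q) * (\<Sum>l'<L. U (unit_mat s p r) $$ (l, l') * H k (1\<^sub>m s) $$ (l', c)))"
    by (subst sum_rotate) (simp add: sum_distrib_left)
  also have "\<dots> = (\<Sum>p<s. \<Sum>k\<in>UNIV. XB k i j $$ (p, q) * H k (unit_mat s p r) $$ (l, c))"
    unfolding index_mult_mat_sum[OF Up H1 lc, symmetric] UH ..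
  also have "\<dots> = (\<Sum>k\<in>UNIV. H k (XB k i j * unit_mat s q r) $$ (l, c))"
    by (subst sum.swap) (simp add: linear_mat_map_mult_unit[OF lin XB lc q r])
  also have "(\<Sum>l'<L. \<Sum>p<s. if p = q then if i = j then U (unit_mat s p r) $$ (l, l') * G $$ (l', c) else 0 else 0)
      = (if i = j then (U (unit_mat s q r) * G) $$ (l, c) else 0)"
    using q by (simp add: index_mult_mat_sum[OF Up G lc] del: index_mult_mat(1))
  finally show ?thesis .
qed

definition QX :: "'a mat" where "QX = blk n (reval n X) Q"

lemma QX: "QX \<in> carrier_mat (L * n) (L * n)"
  unfolding QX_def by (rule blk_carrier[OF QP_carrier(1)])

lemma QX_index:
  assumes "l < L" "l' < L" "a < n" "b < n"
  shows "QX $$ (l * n + a, l' * n + b)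
    = (\<Sum>k\<in>UNIV. A k (1\<^sub>m s) $$ (l, l') * X k $$ (a, b)) - (if a = b then N $$ (l, l') else 0)"
  unfolding QX_def blk_index'[OF QP_carrier(1) assms]
  unfolding Q_def by (rule reval_pencil(2)[OF n X_tuple]) (use assms in auto)

text \<open>Block column \<open>r\<close> of the value of \<open>P\<close> at \<open>X\<close>,
  which is the part that enters the diagonal entry \<open>(r, r)\<close> of the realization.\<close>

definition PX :: "nat \<Rightarrow> 'a mat" where
  "PX r = mat (L * n) n (\<lambda>(x, b). blk n (reval n X) P $$ (x, r * n + b))"

lemma PX: "PX r \<in> carrier_mat (L * n) n"
  unfolding PX_def by simp

lemma PX_index:
  assumes r: "r < s" and "l < L" "a < n" "b < n"
  shows "PX r $$ (l * n + a, b)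
    = (\<Sum>k\<in>UNIV. B k (1\<^sub>m s) $$ (l, r) * X k $$ (a, b)) - (if a = b then M $$ (l, r) else 0)"
proof -
  have "PX r $$ (l * n + a, b) = blk n (reval n X) P $$ (l * n + a, r * n + b)"
    unfolding PX_def using assms by (simp add: block_index_combine)
  also have "\<dots> = reval n X (P $$ (l, r)) $$ (a, b)"
    by (rule blk_index'[OF QP_carrier(2)]) (use assms in auto)
  also have "\<dots> = (\<Sum>k\<in>UNIV. B k (1\<^sub>m s) $$ (l, r) * X k $$ (a, b)) - (if a = b then M $$ (l, r) else 0)"
    unfolding P_def by (rule reval_pencil(2)[OF n X_tuple]) (use assms in auto)
  finally show ?thesis .
qed

text \<open>The evaluated form of \<open>U Q = Q T\<close>: \<open>UU r\<close> gathers entries of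
  \<open>X k\<close> into the argument \<open>XB k i j * unit_mat s q r\<close>, and the matrix unit
  then leaves \<open>A k\<close> on the right as an entry of \<open>TT r\<close>.\<close>

lemma UU_QX:
  assumes r: "r < s"
  shows "UU r * QX = Lam * TT r"
proof (rule block_matrix_eqI[of _ m L L n])
  show "UU r * QX \<in> carrier_mat (m * L) (L * n)" "Lam * TT r \<in> carrier_mat (m * L) (L * n)"
    unfolding UU_def TT_def
    using mult_carrier_mat[OF collapse_carrier QX] mult_carrier_mat[OF Lam collapse_carrier] by auto
  fix i l' l b assume il: "i < m" "l' < L" "l < L" "b < n"
  define j q where "j = b div s" and "q = b mod s"
  have jq: "j < m" "q < s" and b: "b = j * s + q"
    using il(4) block_index_less[of b m s] unfolding n_eq j_def q_def by auto
  note Tq = T[OF unit_mat_carrier[of s q r]]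
  have less: "l' * n + b < L * n" "i * L + l < m * L"
    using il by (auto intro: block_index_combine)
  have "(UU r * QX) $$ (i * L + l, l' * n + b)
      = (\<Sum>e<L. \<Sum>p<s. U (unit_mat s p r) $$ (l, e) * QX $$ (e * n + (i * s + p), l' * n + b))"
    unfolding UU_def by (rule collapse_mult[OF QX il(1,3) less(1)])
  also have "\<dots> = (\<Sum>e<L. \<Sum>p<s. U (unit_mat s p r) $$ (l, e) *
      ((\<Sum>k\<in>UNIV. A k (1\<^sub>m s) $$ (e, l') * X k $$ (i * s + p, j * s + q))
        - (if i * s + p = j * s + q then N $$ (e, l') else 0)))"
    using il jq by (intro sum.cong refl) (simp add: QX_index block_less b)
  also have "\<dots> = (\<Sum>k\<in>UNIV. A k (XB k i j * unit_mat s q r) $$ (l, l'))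
      - (if i = j then (U (unit_mat s q r) * N) $$ (l, l') else 0)"
    by (rule U_pencil[OF lin_A A_unit_T(1)[OF unit_mat_carrier] N r il(1) jq(1) il(3,2) jq(2)])
  also have "\<dots> = (\<Sum>k\<in>UNIV. (A k (XB k i j) * T (unit_mat s q r)) $$ (l, l'))
      - (if i = j then (N * T (unit_mat s q r)) $$ (l, l') else 0)"
    unfolding A_T[OF unit_mat_carrier XB] U_N[OF unit_mat_carrier] ..
  also have "\<dots> = (\<Sum>e<L. Lam $$ (i * L + l, j * L + e) * T (unit_mat s q r) $$ (e, l'))"
  proof -
    have "(\<Sum>e<L. Lam $$ (i * L + l, j * L + e) * T (unit_mat s q r) $$ (e, l'))
        = (\<Sum>e<L. (\<Sum>k\<in>UNIV. A k (XB k i j) $$ (l, e) * T (unit_mat s q r) $$ (e, l'))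
          - (if i = j then N $$ (l, e) * T (unit_mat s q r) $$ (e, l') else 0))"
      using il jq by (intro sum.cong refl) (auto simp: Lam_index left_diff_distrib sum_distrib_right)
    also have "\<dots> = (\<Sum>k\<in>UNIV. (A k (XB k i j) * T (unit_mat s q r)) $$ (l, l'))
      - (if i = j then (N * T (unit_mat s q r)) $$ (l, l') else 0)"
      unfolding sum_subtractf index_mult_mat_sum[OF A[OF XB] Tq il(3,2)] index_mult_mat_sum[OF N Tq il(3,2)]
      by (subst sum.swap) simp
    finally show ?thesis by simp
  qed
  also have "\<dots> = (\<Sum>j'<m. if j = j' then \<Sum>e<L. Lam $$ (i * L + l, j' * L + e) * T (unit_mat s q r) $$ (e, l') else 0)"
    using jq by simp
  also have "\<dots> = (\<Sum>j'<m. \<Sum>e<L. Lam $$ (i * L + l, j' * L + e) * TT r $$ (j' * L + e, l' * n + b))"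
    unfolding TT_def b using il jq by (intro sum.cong refl) (auto simp: collapse_index)
  also have "\<dots> = (Lam * TT r) $$ (i * L + l, l' * n + b)"
    unfolding TT_def by (rule index_mult_mat_blocks[OF Lam collapse_carrier less(2,1), symmetric])
  finally show "(UU r * QX) $$ (i * L + l, l' * n + b) = (Lam * TT r) $$ (i * L + l, l' * n + b)" .
qed

text \<open>Collects the defect \<open>BS\<close> of \<open>B\<close> under multiplication of its
  argument on the right by the units \<open>E_qr\<close>.\<close>

definition BB :: "nat \<Rightarrow> 'a mat" where
  "BB r = mat (m * L) n (\<lambda>(x, b). if b div s = x div L then BS (unit_mat s (b mod s) r) $$ (x mod L, r) else 0)"

lemma BB: "BB r \<in> carrier_mat (m * L) n"
  unfolding BB_def by simp

lemma BB_index: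
  assumes "i < m" "j < m" "l < L" "q < s"
  shows "BB r $$ (i * L + l, j * s + q) = (if j = i then BS (unit_mat s q r) $$ (l, r) else 0)"
proof -
  have less: "i * L + l < m * L" "j * s + q < n"
    using assms by (auto intro!: block_index_combine block_less)
  then show ?thesis using assms unfolding BB_def by simp
qed

text \<open>Column \<open>r\<close> of \<open>B k (Z * unit_mat s q r)\<close> is column
  \<open>q\<close> of \<open>B k Z\<close> plus a defect. As \<open>q\<close> varies, the first
  parts fill the numerator \<open>PB\<close>, and the defects combine to
  \<open>Lam * BB r\<close>.\<close>

lemma UU_PX:
  assumes r: "r < s"
  shows "UU r * PX r = PB + Lam * BB r"
proof (rule block_matrix_eqI[of _ m L m s])
  show "UU r * PX r \<in> carrier_mat (m * L) (m * s)" "PB + Lam * BB r \<in> carrier_mat (m * L) (m * s)"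
    unfolding UU_def n_eq[symmetric]
    using mult_carrier_mat[OF collapse_carrier PX] mult_carrier_mat[OF Lam BB] PB by auto
  fix i j l q assume il: "i < m" "j < m" "l < L" "q < s"
  note E = unit_mat_carrier[of s q r] and BSq = BS[of "unit_mat s q r"]
  have less: "i * L + l < m * L" "j * s + q < n"
    using il by (auto intro: block_index_combine block_less)
  have LB: "(Lam * BB r) $$ (i * L + l, j * s + q)
      = (\<Sum>k\<in>UNIV. (A k (XB k i j) * BS (unit_mat s q r)) $$ (l, r))
        - (if i = j then (N * BS (unit_mat s q r)) $$ (l, r) else 0)"
  proof -
    have "(Lam * BB r) $$ (i * L + l, j * s + q)
        = (\<Sum>j'<m. \<Sum>e<L. Lam $$ (i * L + l, j' * L + e) * BB r $$ (j' * L + e, j * s + q))"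
      by (rule index_mult_mat_blocks[OF Lam BB less])
    also have "\<dots> = (\<Sum>j'<m. if j' = j then \<Sum>e<L. Lam $$ (i * L + l, j' * L + e) * BS (unit_mat s q r) $$ (e, r) else 0)"
      using il by (intro sum.cong refl) (auto simp: BB_index)
    also have "\<dots> = (\<Sum>e<L. Lam $$ (i * L + l, j * L + e) * BS (unit_mat s q r) $$ (e, r))"
      using il by simp
    also have "\<dots> = (\<Sum>e<L. (\<Sum>k\<in>UNIV. A k (XB k i j) $$ (l, e) * BS (unit_mat s q r) $$ (e, r))
          - (if i = j then N $$ (l, e) * BS (unit_mat s q r) $$ (e, r) else 0))"
      using il by (intro sum.cong refl) (auto simp: Lam_index left_diff_distrib sum_distrib_right)
    also have "\<dots> = (\<Sum>k\<in>UNIV. (A k (XB k i j) * BS (unit_mat s q r)) $$ (l, r))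
        - (if i = j then (N * BS (unit_mat s q r)) $$ (l, r) else 0)"
      unfolding sum_subtractf index_mult_mat_sum[OF A[OF XB] BSq il(3) r] index_mult_mat_sum[OF N BSq il(3) r]
      by (subst sum.swap) simp
    finally show ?thesis .
  qed
  have H: "B k (XB k i j * unit_mat s q r) $$ (l, r)
      = B k (XB k i j) $$ (l, q) + (A k (XB k i j) * BS (unit_mat s q r)) $$ (l, r)" for k
  proof -
    have "(B k (XB k i j) * unit_mat s q r) $$ (l, r) = B k (XB k i j) $$ (l, q)"
      using mult_unit_mat_index[OF B[OF XB] il(4,3) r, of k k i j r] by simp
    then show ?thesis
      unfolding B_right[OF E XB] using il r A[OF XB, of k k i j] B[OF XB, of k k i j] BSq
      by (simp del: index_mult_mat(1))
  qed
  have UM: "(U (unit_mat s q r) * M) $$ (l, r) = M $$ (l, q) + (N * BS (unit_mat s q r)) $$ (l, r)"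
  proof -
    have "(M * unit_mat s q r) $$ (l, r) = M $$ (l, q)"
      using mult_unit_mat_index[OF M il(4,3) r, of r] by simp
    then show ?thesis
      unfolding U_M[OF E] using il r M N BSq by (simp del: index_mult_mat(1))
  qed
  have "(UU r * PX r) $$ (i * L + l, j * s + q)
      = (\<Sum>e<L. \<Sum>p<s. U (unit_mat s p r) $$ (l, e) * PX r $$ (e * n + (i * s + p), j * s + q))"
    unfolding UU_def by (rule collapse_mult[OF PX il(1,3) less(2)])
  also have "\<dots> = (\<Sum>e<L. \<Sum>p<s. U (unit_mat s p r) $$ (l, e) *
      ((\<Sum>k\<in>UNIV. B k (1\<^sub>m s) $$ (e, r) * X k $$ (i * s + p, j * s + q))
        - (if i * s + p = j * s + q then M $$ (e, r) else 0)))"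
    using il r by (intro sum.cong refl) (simp add: PX_index block_less)
  also have "\<dots> = (\<Sum>k\<in>UNIV. B k (XB k i j * unit_mat s q r) $$ (l, r))
      - (if i = j then (U (unit_mat s q r) * M) $$ (l, r) else 0)"
    by (rule U_pencil[OF lin_B A_unit_T(3)[OF unit_mat_carrier] M r il(1,2,3) r il(4)])
  also have "\<dots> = PB $$ (i * L + l, j * s + q) + (Lam * BB r) $$ (i * L + l, j * s + q)"
    unfolding H UM LB PB_index[OF il(1,2,3,4)] by (simp add: sum.distrib)
  also have "\<dots> = (PB + Lam * BB r) $$ (i * L + l, j * s + q)"
    using less PB Lam BB[of r] by (simp del: index_mult_mat(1))
  finally show "(UU r * PX r) $$ (i * L + l, j * s + q) = (PB + Lam * BB r) $$ (i * L + l, j * s + q)" .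
qed

definition Li :: "'a mat" where "Li = the (mat_inverse (fm_Lambda s L A Y m X))"

lemma Li: "Li \<in> carrier_mat (m * L) (m * L)" and Li_Lam: "Li * Lam = - 1\<^sub>m (m * L)"
proof -
  note \<Lambda> = Lambda_carrier
  obtain V where V: "V \<in> carrier_mat (m * L) (m * L)" "fm_Lambda s L A Y m X * V = 1\<^sub>m (m * L)"
    using det_non_zero_imp_unit[OF \<Lambda> det_Lambda, of "()"] unfolding Units_def ring_mat_def by auto
  note inv = invertible_mat_the_inverse[OF \<Lambda> the_mat_inverse_eq(1)[OF \<Lambda> V]]
  show "Li \<in> carrier_mat (m * L) (m * L)" unfolding Li_def by (rule inv(1))
  then show "Li * Lam = - 1\<^sub>m (m * L)"
    using inv(3) \<Lambda> unfolding Lam_def Li_def by simp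
qed

lemma Lam_cancel:
  assumes Z: "Z \<in> carrier_mat (m * L) c"
  shows "Li * (Lam * Z) = - Z"
proof -
  have "Li * (Lam * Z) = Li * Lam * Z" by (rule assoc_mult_mat[OF Li Lam Z, symmetric])
  also have "\<dots> = - Z" unfolding Li_Lam using Z by simp
  finally show ?thesis .
qed

lemma collapse_QX_cancel:
  assumes r: "r < s" and Z: "Z \<in> carrier_mat (L * n) c"
  shows "UU r * (QX * Z) = Lam * (TT r * Z)"
proof -
  have c: "UU r \<in> carrier_mat (m * L) (L * n)" "TT r \<in> carrier_mat (m * L) (L * n)"
    unfolding UU_def TT_def by (rule collapse_carrier)+
  have "UU r * (QX * Z) = UU r * QX * Z" by (rule assoc_mult_mat[OF c(1) QX Z, symmetric])
  also have "\<dots> = Lam * (TT r * Z)" unfolding UU_QX[OF r] by (rule assoc_mult_mat[OF Lam c(2) Z])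
  finally show ?thesis .
qed

text \<open>A kernel vector \<open>z\<close> satisfies \<open>Lam * (TT r * z) = 0\<close>, so
  \<open>TT r * z = 0\<close> for every \<open>r\<close>. Multiplication by \<open>T(E_rp')\<close>
  isolates \<open>T(E_rr) z(i, p') = 0\<close>, and this for all \<open>r\<close> forces
  \<open>z = 0\<close>.\<close>

lemma det_QX: "det QX \<noteq> 0"
proof
  assume "det QX = 0"
  then obtain v where v: "v \<in> carrier_vec (L * n)" "v \<noteq> 0\<^sub>v (L * n)" "QX *\<^sub>v v = 0\<^sub>v (L * n)"
    using det_0_iff_vec_prod_zero_field[OF QX] by auto
  define Z where "Z = mat (L * n) 1 (\<lambda>(x, _). v $ x)"
  have Z: "Z \<in> carrier_mat (L * n) 1" unfolding Z_def by simp
  have "col Z 0 = v" using v(1) unfolding Z_def by (intro eq_vecI) auto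
  then have "col (QX * Z) 0 = 0\<^sub>v (L * n)" using col_mult_mat[OF QX Z, of 0] v(3) by simp
  have QZ: "QX * Z = 0\<^sub>m (L * n) 1"
  proof (rule eq_matI)
    fix x y assume "x < dim_row (0\<^sub>m (L * n) 1 :: 'a mat)" "y < dim_col (0\<^sub>m (L * n) 1 :: 'a mat)"
    then have xy: "x < L * n" "y = 0" by auto
    have "(QX * Z) $$ (x, 0) = col (QX * Z) 0 $ x"
      by (rule index_col[symmetric]) (use xy QX Z in auto)
    then show "(QX * Z) $$ (x, y) = 0\<^sub>m (L * n) 1 $$ (x, y)"
      using \<open>col (QX * Z) 0 = 0\<^sub>v (L * n)\<close> xy by simp
  qed (use QX Z in auto)
  have TZ: "(\<Sum>e<L. \<Sum>p<s. T (unit_mat s p r) $$ (l, e) * Z $$ (e * n + (i * s + p), 0)) = 0"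
    if r: "r < s" and il: "i < m" "l < L" for r i l
  proof -
    have TZc: "TT r * Z \<in> carrier_mat (m * L) 1"
      unfolding TT_def by (rule mult_carrier_mat[OF collapse_carrier Z])
    have U0: "UU r * (QX * Z) = 0\<^sub>m (m * L) 1"
      unfolding QZ UU_def by (rule right_mult_zero_mat[OF collapse_carrier])
    have "- (TT r * Z) = Li * 0\<^sub>m (m * L) 1"
      using Lam_cancel[OF TZc] unfolding collapse_QX_cancel[OF r Z, symmetric] U0 by simp
    then have "- (TT r * Z) = 0\<^sub>m (m * L) 1" using right_mult_zero_mat[OF Li] by simp
    moreover have less: "i * L + l < m * L" using il by (rule block_index_combine)
    ultimately have "(- (TT r * Z)) $$ (i * L + l, 0) = 0" by simp
    then have "(TT r * Z) $$ (i * L + l, 0) = 0"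
      using carrier_matD[OF TZc] less by (simp del: index_mult_mat)
    then show ?thesis
      using collapse_mult[OF Z il, of 0] unfolding TT_def by simp
  qed
  have zero: "Z $$ (l * n + (i * s + p'), 0) = 0" if il: "i < m" "l < L" and p': "p' < s" for i l p'
  proof -
    define V where "V = mat L 1 (\<lambda>(l, _). Z $$ (l * n + (i * s + p'), 0))"
    have V: "V \<in> carrier_mat L 1" unfolding V_def by simp
    note T' = T[OF unit_mat_carrier]
    have "V = 0\<^sub>m L 1"
    proof (rule eq_zero_of_T_unit[OF V])
      fix r assume r: "r < s"
      show "T (unit_mat s r r) * V = 0\<^sub>m L 1"
      proof (rule eq_matI)
        fix l y assume "l < dim_row (0\<^sub>m L 1 :: 'a mat)" "y < dim_col (0\<^sub>m L 1 :: 'a mat)"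
        then have l: "l < L" and y: "y = 0" by auto
        have "(T (unit_mat s r r) * V) $$ (l, 0)
            = (\<Sum>e<L. T (unit_mat s r r) $$ (l, e) * Z $$ (e * n + (i * s + p'), 0))"
          using index_mult_mat_sum[OF T' V l, of 0] by (simp add: V_def)
        also have "\<dots> = (\<Sum>e<L. \<Sum>p<s. if p' = p then T (unit_mat s r r) $$ (l, e) * Z $$ (e * n + (i * s + p), 0) else 0)"
          using p' by simp
        also have "\<dots> = (\<Sum>e<L. \<Sum>p<s. (T (unit_mat s r p') * T (unit_mat s p r)) $$ (l, e) * Z $$ (e * n + (i * s + p), 0))"
          using p' l by (intro sum.cong refl) (auto simp: T_unit_mult simp del: index_mult_mat(1))
        also have "\<dots> = (\<Sum>e<L. \<Sum>p<s. \<Sum>e'<L. T (unit_mat s r p') $$ (l, e')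
            * (T (unit_mat s p r) $$ (e', e) * Z $$ (e * n + (i * s + p), 0)))"
          by (intro sum.cong refl)
            (simp add: index_mult_mat_sum[OF T' T' l] sum_distrib_right mult.assoc del: index_mult_mat(1))
        also have "\<dots> = (\<Sum>e'<L. T (unit_mat s r p') $$ (l, e')
            * (\<Sum>e<L. \<Sum>p<s. T (unit_mat s p r) $$ (e', e) * Z $$ (e * n + (i * s + p), 0)))"
          unfolding sum_distrib_left by (rule sum_rotate[symmetric])
        also have "\<dots> = 0" using TZ[OF r il(1)] by simp
        finally show "(T (unit_mat s r r) * V) $$ (l, y) = 0\<^sub>m L 1 $$ (l, y)"
          using l y by (simp del: index_mult_mat(1))
      qed (use T'[of r r] V in auto)
    qed
    then have "V $$ (l, 0) = 0" using il by simp
    then show ?thesis using il unfolding V_def by simp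
  qed
  have "v $ x = 0" if x: "x < L * n" for x
  proof -
    define l i p where "l = x div n" and "i = x mod n div s" and "p = x mod n mod s"
    have l: "l < L" "x mod n < m * s"
      using block_index_less[OF x] unfolding l_def by (auto simp: mult.commute)
    have "i < m" "p < s" using block_index_less[OF l(2)] unfolding i_def p_def by auto
    moreover have "x = l * n + (i * s + p)" unfolding l_def i_def p_def by (simp only: div_mult_mod_eq)
    ultimately have "Z $$ (x, 0) = 0" using zero l by simp
    then show ?thesis using x unfolding Z_def by simp
  qed
  then have "v = 0\<^sub>v (L * n)" using v(1) by (intro eq_vecI) auto
  with v(2) show False by simp
qed

interpretation rep: inverse_closed_rep n "reval n X" "rdef n X"
  by (rule inverse_closed_rep_reval[OF n X_tuple])

lemma Q_mats: "Q \<in> mats (rdef n X) L L" and P_mats: "P \<in> mats (rdef n X) L s"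
  unfolding Q_def P_def by (auto intro!: matsI reval_pencil(1)[OF n X_tuple])

lemma const_mat_mats: "V \<in> carrier_mat p q \<Longrightarrow> const_mat V \<in> mats (rdef n X) p q"
  by (rule matsI) (auto intro: rconst_rdef(1)[OF n X_tuple])

lemma exists_inverse_Q: "\<exists>W \<in> mats (rdef n X) L L. W * Q = 1\<^sub>m L \<and> Q * W = 1\<^sub>m L"
  by (rule rep.exists_inverse_of_blk_invertible[OF Q_mats]) (use det_QX in \<open>simp add: QX_def\<close>)

lemma index_kron_one_mult:
  fixes V Z :: "'a mat"
  assumes V: "V \<in> carrier_mat s L" and Z: "Z \<in> carrier_mat (m * L) c" and ip: "i < m" "p < s" and b: "b < c"
  shows "(kron (1\<^sub>m m) V * Z) $$ (i * s + p, b) = (\<Sum>l<L. V $$ (p, l) * Z $$ (i * L + l, b))"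
proof -
  have K: "kron (1\<^sub>m m) V \<in> carrier_mat (m * s) (m * L)" unfolding kron_def using V by auto
  have less: "i * s + p < m * s" using ip by (rule block_index_combine)
  have "(kron (1\<^sub>m m) V * Z) $$ (i * s + p, b)
      = (\<Sum>j<m. \<Sum>l<L. kron (1\<^sub>m m) V $$ (i * s + p, j * L + l) * Z $$ (j * L + l, b))"
    by (rule index_mult_mat_blocks[OF K Z less b])
  also have "\<dots> = (\<Sum>j<m. if j = i then \<Sum>l<L. V $$ (p, l) * Z $$ (j * L + l, b) else 0)"
  proof (intro sum.cong refl)
    fix j assume "j \<in> {..<m}"
    then have j: "j < m" by simp
    have "kron (1\<^sub>m m) V $$ (i * s + p, j * L + l) = (if j = i then V $$ (p, l) else 0)" if "l < L" for l
      using less block_index_combine[OF j that] V ip j that unfolding kron_def by auto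
    then show "(\<Sum>l<L. kron (1\<^sub>m m) V $$ (i * s + p, j * L + l) * Z $$ (j * L + l, b))
        = (if j = i then \<Sum>l<L. V $$ (p, l) * Z $$ (j * L + l, b) else 0)"
      by auto
  qed
  also have "\<dots> = (\<Sum>l<L. V $$ (p, l) * Z $$ (i * L + l, b))" using ip by simp
  finally show ?thesis .
qed

text \<open>Let \<open>G\<close> be block column \<open>r\<close> of the value of
  \<open>W * P\<close>. Comparing \<open>UU r\<close> with \<open>QX\<close> and \<open>PX r\<close>
  gives \<open>Li * PB = BB r - TT r * G\<close>. Under \<open>C\<close> the operators
  \<open>T(E_pr)\<close> become \<open>E_pr C\<close> and \<open>BS(E_qr)\<close> becomes a
  commutator with \<open>D\<close>, which leaves the value of \<open>D - C W P\<close> at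
  \<open>(r, r)\<close>.\<close>

lemma reval_realization:
  assumes W: "W \<in> carrier_mat L L" and WQ: "W * Q = 1\<^sub>m L" and QW: "Q * W = 1\<^sub>m L" and r: "r < s"
  defines "R \<equiv> const_mat D - const_mat C * W * P"
  shows "R $$ (r, r) \<in> rdef n X" and "reval n X (R $$ (r, r)) = fm_eval s L D C A B Y m X"
proof -
  \<comment> \<open>The given \<open>W\<close> may stem from another point. By uniqueness of
    inverses it equals the one whose entries are defined at this \<open>X\<close>.\<close>
  obtain W' where W': "W' \<in> mats (rdef n X) L L" "W' * Q = 1\<^sub>m L" using exists_inverse_Q by auto
  have "W' = W' * (Q * W)" using matsD(1)[OF W'(1)] QW by simp
  also have "\<dots> = W"
    using matsD(1)[OF W'(1)] QP_carrier(1) W W'(2)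
    by (subst assoc_mult_mat[symmetric, of _ L L _ L _ L]) auto
  finally have W_mats: "W \<in> mats (rdef n X) L L" using W'(1) by simp
  note WP_mats = rep.mats_mult[OF W_mats P_mats]
  note C_mats = const_mat_mats[OF C]
  note CWP_mats = rep.mats_mult[OF C_mats WP_mats]
  have R: "R = const_mat D - const_mat C * (W * P)"
    unfolding R_def using assoc_mult_mat[OF matsD(1)[OF C_mats] W QP_carrier(2)] by simp
  have Rrr: "R $$ (r, r) = rconst (D $$ (r, r)) - (const_mat C * (W * P)) $$ (r, r)"
    unfolding R using r D carrier_matD[OF matsD(1)[OF CWP_mats]] by (simp del: index_mult_mat)
  note d = rconst_rdef[OF n X_tuple] and cwp = matsD(2)[OF CWP_mats r r]
  show Rin: "R $$ (r, r) \<in> rdef n X" unfolding Rrr by (rule rep.minus_in[OF d(1) cwp])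
  define WX where "WX = blk n (reval n X) W"
  have WX: "WX \<in> carrier_mat (L * n) (L * n)" unfolding WX_def by (rule blk_carrier[OF W])
  have QWX: "QX * WX = 1\<^sub>m (L * n)"
    unfolding QX_def WX_def rep.blk_mult[OF Q_mats W_mats, symmetric] QW by (rule rep.blk_one)
  define G where "G = WX * PX r"
  have G: "G \<in> carrier_mat (L * n) n" unfolding G_def by (rule mult_carrier_mat[OF WX PX])
  have QG: "QX * G = PX r"
    unfolding G_def assoc_mult_mat[OF QX WX PX, symmetric] QWX by (rule left_mult_one_mat[OF PX])
  have TG: "TT r * G \<in> carrier_mat (m * L) n"
    unfolding TT_def by (rule mult_carrier_mat[OF collapse_carrier G])
  \<comment> \<open>\<open>QX * G = PX r\<close> is multiplied by \<open>UU r\<close> on the left;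
    the signs come from \<open>Li * Lam\<close>, which is minus the identity.\<close>
  have LiPB: "Li * PB = BB r - TT r * G"
  proof -
    have "PB + Lam * BB r = Lam * (TT r * G)"
      using collapse_QX_cancel[OF r G] UU_PX[OF r] unfolding QG by simp
    then have "Li * (PB + Lam * BB r) = - (TT r * G)" using Lam_cancel[OF TG] by simp
    moreover have "Li * (PB + Lam * BB r) = Li * PB + Li * (Lam * BB r)"
      by (rule mult_add_distrib_mat[OF Li PB mult_carrier_mat[OF Lam BB]])
    ultimately have e: "Li * PB + - BB r = - (TT r * G)" using Lam_cancel[OF BB[of r]] by simp
    show ?thesis
    proof (rule eq_matI)
      fix x y assume "x < dim_row (BB r - TT r * G)" "y < dim_col (BB r - TT r * G)"
      then have xy: "x < m * L" "y < n" using TG by auto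
      have "(Li * PB) $$ (x, y) - BB r $$ (x, y) = - (TT r * G) $$ (x, y)"
        using arg_cong[OF e, of "\<lambda>V. V $$ (x, y)"] xy carrier_matD[OF BB[of r]] carrier_matD[OF TG]
          carrier_matD[OF mult_carrier_mat[OF Li PB]]
        by (simp del: index_mult_mat)
      then show "(Li * PB) $$ (x, y) = (BB r - TT r * G) $$ (x, y)"
        using xy carrier_matD[OF BB[of r]] carrier_matD[OF TG] by (simp add: algebra_simps del: index_mult_mat)
    qed (use Li PB BB[of r] TG in auto)
  qed
  have KC: "kron (1\<^sub>m m) C \<in> carrier_mat n (m * L)" and KD: "kron (1\<^sub>m m) D \<in> carrier_mat n n"
    unfolding kron_def using C D by (auto simp: mult.commute)
  have eval: "fm_eval s L D C A B Y m X = kron (1\<^sub>m m) D + kron (1\<^sub>m m) C * (BB r - TT r * G)"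
    unfolding fm_eval_def Li_def[symmetric] PB_def[symmetric] LiPB[symmetric]
    using assoc_mult_mat[OF KC Li PB] by simp
  have BTG: "BB r - TT r * G \<in> carrier_mat (m * L) n" by (rule minus_carrier_mat[OF TG])
  show "reval n X (R $$ (r, r)) = fm_eval s L D C A B Y m X"
  proof (rule block_matrix_eqI[of _ m s m s])
    show "reval n X (R $$ (r, r)) \<in> carrier_mat (m * s) (m * s)"
      using rep.h_dim[OF Rin] by (simp add: mult.commute)
    show "fm_eval s L D C A B Y m X \<in> carrier_mat (m * s) (m * s)"
      unfolding eval using KD KC BTG by (auto simp: mult.commute)
    fix i j p q assume ij: "i < m" "j < m" "p < s" "q < s"
    let ?a = "i * s + p" and ?b = "j * s + q"
    have ab: "?a < n" "?b < n" using ij by (auto intro: block_less)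
    have ab_eq: "?a = ?b \<longleftrightarrow> i = j \<and> p = q"
      using ij by (metis div_mult_self3 div_less add.right_neutral add_left_cancel gr_implies_not0)
    have G_blk: "blk n (reval n X) (W * P) $$ (e * n + ?a, r * n + ?b) = G $$ (e * n + ?a, ?b)" if e: "e < L" for e
    proof -
      have less: "e * n + ?a < L * n" "r * n + ?b < s * n"
        using e r ab by (auto intro: block_index_combine)
      have "blk n (reval n X) (W * P) $$ (e * n + ?a, r * n + ?b)
          = (\<Sum>y<L * n. WX $$ (e * n + ?a, y) * blk n (reval n X) P $$ (y, r * n + ?b))"
        unfolding rep.blk_mult[OF W_mats P_mats] WX_def[symmetric]
        by (rule index_mult_mat_sum[OF WX blk_carrier[OF QP_carrier(2)] less])
      also have "\<dots> = (\<Sum>y<L * n. WX $$ (e * n + ?a, y) * PX r $$ (y, ?b))"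
        using ab by (intro sum.cong refl) (simp add: PX_def)
      also have "\<dots> = G $$ (e * n + ?a, ?b)"
        unfolding G_def by (rule index_mult_mat_sum[OF WX PX less(1) ab(2), symmetric])
      finally show ?thesis .
    qed
    have "reval n X ((const_mat C * (W * P)) $$ (r, r)) $$ (?a, ?b)
        = blk n (reval n X) (const_mat C * (W * P)) $$ (r * n + ?a, r * n + ?b)"
      by (rule blk_index'[OF matsD(1)[OF CWP_mats] r r ab, symmetric])
    also have "\<dots> = (\<Sum>e<L. \<Sum>c<n. blk n (reval n X) (const_mat C) $$ (r * n + ?a, e * n + c)
        * blk n (reval n X) (W * P) $$ (e * n + c, r * n + ?b))"
      unfolding rep.blk_mult[OF C_mats WP_mats]
      by (rule index_mult_mat_blocks[OF blk_carrier[OF matsD(1)[OF C_mats]] blk_carrier[OF matsD(1)[OF WP_mats]]])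
        (use r ab in \<open>auto intro: block_index_combine\<close>)
    also have "\<dots> = (\<Sum>e<L. \<Sum>c<n. if c = ?a then C $$ (r, e) * blk n (reval n X) (W * P) $$ (e * n + c, r * n + ?b) else 0)"
    proof (intro sum.cong refl)
      fix e c assume "e \<in> {..<L}" "c \<in> {..<n}"
      then have ec: "e < L" "c < n" by auto
      have "blk n (reval n X) (const_mat C) $$ (r * n + ?a, e * n + c) = reval n X (const_mat C $$ (r, e)) $$ (?a, c)"
        by (rule blk_index'[OF matsD(1)[OF C_mats] r ec(1) ab(1) ec(2)])
      also have "const_mat C $$ (r, e) = rconst (C $$ (r, e))" using C r ec by simp
      also have "reval n X (rconst (C $$ (r, e))) $$ (?a, c) = (if c = ?a then C $$ (r, e) else 0)"
        unfolding d(2) using ab ec by auto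
      finally show "blk n (reval n X) (const_mat C) $$ (r * n + ?a, e * n + c) * blk n (reval n X) (W * P) $$ (e * n + c, r * n + ?b)
          = (if c = ?a then C $$ (r, e) * blk n (reval n X) (W * P) $$ (e * n + c, r * n + ?b) else 0)"
        by simp
    qed
    also have "\<dots> = (\<Sum>e<L. C $$ (r, e) * G $$ (e * n + ?a, ?b))"
      using ab G_blk by simp
    finally have lhs: "reval n X (R $$ (r, r)) $$ (?a, ?b)
        = (if ?a = ?b then D $$ (r, r) else 0) - (\<Sum>e<L. C $$ (r, e) * G $$ (e * n + ?a, ?b))"
      unfolding Rrr rep.h_minus[OF d(1) cwp] d(2) using ab rep.h_dim[OF cwp] by simp
    \<comment> \<open>In \<open>C BS(E_qr) = E_qr D - D E_qr\<close> the entry at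
      \<open>(p, r)\<close> contains \<open>- D_pq\<close>, which cancels the summand
      \<open>I \<otimes> D\<close> of the realization and leaves \<open>D_rr\<close> on the
      diagonal.\<close>
    note T' = T[OF unit_mat_carrier] and E = unit_mat_carrier[of s q r]
    have CB: "(\<Sum>l<L. C $$ (p, l) * BB r $$ (i * L + l, ?b))
        = (if i = j then (if p = q then D $$ (r, r) else 0) - D $$ (p, q) else 0)"
    proof -
      have "(\<Sum>l<L. C $$ (p, l) * BB r $$ (i * L + l, ?b))
          = (if j = i then \<Sum>l<L. C $$ (p, l) * BS (unit_mat s q r) $$ (l, r) else 0)"
        using ij by (auto simp: BB_index intro!: sum.cong)
      also have "(\<Sum>l<L. C $$ (p, l) * BS (unit_mat s q r) $$ (l, r)) = (C * BS (unit_mat s q r)) $$ (p, r)"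
        by (rule index_mult_mat_sum[OF C BS ij(3) r, symmetric])
      also have "\<dots> = (unit_mat s q r * D) $$ (p, r) - (D * unit_mat s q r) $$ (p, r)"
        unfolding C_BS[OF E] using ij r D by (simp del: index_mult_mat(1))
      also have "\<dots> = (if p = q then D $$ (r, r) else 0) - D $$ (p, q)"
        using unit_mat_mult_index[OF D r ij(3) r, of q] mult_unit_mat_index[OF D ij(4,3) r, of r] by simp
      finally show ?thesis by (simp only: eq_commute[of j i])
    qed
    have CTG: "(\<Sum>l<L. C $$ (p, l) * (TT r * G) $$ (i * L + l, ?b)) = (\<Sum>e<L. C $$ (r, e) * G $$ (e * n + ?a, ?b))"
    proof -
      have "(\<Sum>l<L. C $$ (p, l) * (TT r * G) $$ (i * L + l, ?b))
          = (\<Sum>l<L. \<Sum>e<L. \<Sum>p'<s. C $$ (p, l) * T (unit_mat s p' r) $$ (l, e) * G $$ (e * n + (i * s + p'), ?b))"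
        unfolding TT_def using ij ab
        by (intro sum.cong refl) (simp add: collapse_mult[OF G] sum_distrib_left mult.assoc)
      also have "\<dots> = (\<Sum>e<L. \<Sum>p'<s. (C * T (unit_mat s p' r)) $$ (p, e) * G $$ (e * n + (i * s + p'), ?b))"
        by (subst sum_rotate, intro sum.cong refl)
          (simp add: index_mult_mat_sum[OF C T' ij(3)] sum_distrib_right del: index_mult_mat(1))
      also have "\<dots> = (\<Sum>e<L. \<Sum>p'<s. if p' = p then C $$ (r, e) * G $$ (e * n + (i * s + p'), ?b) else 0)"
        unfolding C_T[OF unit_mat_carrier]
        using r ij by (intro sum.cong refl) (auto simp: unit_mat_mult_index[OF C] simp del: index_mult_mat(1))
      also have "\<dots> = (\<Sum>e<L. C $$ (r, e) * G $$ (e * n + ?a, ?b))" using ij by simp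
      finally show ?thesis .
    qed
    have "fm_eval s L D C A B Y m X $$ (?a, ?b)
        = kron (1\<^sub>m m) D $$ (?a, ?b) + (kron (1\<^sub>m m) C * (BB r - TT r * G)) $$ (?a, ?b)"
      unfolding eval by (rule index_add_mat(1)) (use ab carrier_matD[OF mult_carrier_mat[OF KC BTG]] in auto)
    also have "kron (1\<^sub>m m) D $$ (?a, ?b) = (if i = j then D $$ (p, q) else 0)"
      using ij ab D unfolding kron_def by (auto simp: mult.commute[of s m])
    also have "(kron (1\<^sub>m m) C * (BB r - TT r * G)) $$ (?a, ?b)
        = (\<Sum>l<L. C $$ (p, l) * (BB r - TT r * G) $$ (i * L + l, ?b))"
      by (rule index_kron_one_mult[OF C BTG ij(1,3) ab(2)])
    also have "\<dots> = (\<Sum>l<L. C $$ (p, l) * BB r $$ (i * L + l, ?b)) - (\<Sum>l<L. C $$ (p, l) * (TT r * G) $$ (i * L + l, ?b))"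
      unfolding sum_subtractf[symmetric] right_diff_distrib[symmetric]
      using block_index_combine[OF ij(1)] carrier_matD[OF TG] carrier_matD[OF BB[of r]] ab
      by (intro sum.cong refl) (simp del: index_mult_mat)
    finally show "reval n X (R $$ (r, r)) $$ (?a, ?b) = fm_eval s L D C A B Y m X $$ (?a, ?b)"
      unfolding lhs CB CTG ab_eq by auto
  qed
qed

end

theorem theorem4p4:
  fixes s L :: nat
    and D C :: "'a :: field mat"
    and A B :: "'d :: finite \<Rightarrow> 'a mat \<Rightarrow> 'a mat"
    and Y :: "'d \<Rightarrow> 'a mat"
  assumes "s \<ge> 1"
    and "fm_realization s L D C A B Y"
    and "fm_controllable s L A B"
    and "fm_observable s L C A"
    and "linearized_lost_abbey s L D C A B Y"
  shows "skew_delta s L A Y \<in> Units (rmat_ring free_skew_field L) \<and>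
    (\<exists>f \<in> carrier free_skew_field.
      skew_realization s L D C A B Y = rmat_scalar free_skew_field s f \<and>
      (\<forall>m\<ge>1. fm_Omega s L A Y m \<subseteq> ratfun_dom (s * m) f \<and>
        (\<forall>X \<in> fm_Omega s L A Y m. fm_eval s L D C A B Y m X = ratfun_eval (s * m) f X)) \<and>
      Y \<in> ratfun_dom s f)"
proof -
  interpret lost_abbey s L D C A B Y by unfold_locales (rule assms)+
  \<comment> \<open>At the centre all differences \<open>X k - Y k\<close> vanish. This puts
    \<open>Y\<close> into the domain of the realization and gives a point at which \<delta> can be
    inverted.\<close>
  have "fm_Lambda s L A Y 1 Y = 1\<^sub>m L"
  proof (rule eq_matI)
    fix i j assume "i < dim_row (1\<^sub>m L :: 'a mat)" "j < dim_col (1\<^sub>m L :: 'a mat)"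
    then have ij: "i < L" "j < L" by auto
    have "mat_block s (Y k) 0 0 = Y k" for k
      using Y[of k] unfolding mat_block_def by (intro eq_matI) auto
    then have "fm_pencil s L L A Y 1 Y $$ (0 * L + i, 0 * L + j) = 0"
      using Y ij by (subst fm_pencil_index[OF lin_A]) auto
    then show "fm_Lambda s L A Y 1 Y $$ (i, j) = 1\<^sub>m L $$ (i, j)"
      using ij fm_pencil_carrier[of s L L A Y 1 Y] unfolding fm_Lambda_def by simp
  qed (use fm_pencil_carrier[of s L L A Y 1 Y] in \<open>auto simp: fm_Lambda_def\<close>)
  then have Y_Omega: "Y \<in> fm_Omega s L A Y 1"
    using Y unfolding fm_Omega_def mat_tuples_def by simp
  have point: "lost_abbey_point s L D C A B Y m X" if "m \<ge> 1" "X \<in> fm_Omega s L A Y m" for m X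
    by unfold_locales (use assms(1) that in auto)
  \<comment> \<open>This inverse, found at \<open>Y\<close>, is fixed once and for all, so that the
    same \<open>f\<close> serves every \<open>m\<close> and every point \<open>X\<close>.\<close>
  obtain W where W_mats: "W \<in> mats (rdef (s * 1) Y) L L" and WQ: "W * Q = 1\<^sub>m L" and QW: "Q * W = 1\<^sub>m L"
    using lost_abbey_point.exists_inverse_Q[OF point[OF order_refl Y_Omega]] by blast
  note W = matsD(1)[OF W_mats]
  define R where "R = const_mat D - const_mat C * W * P"
  define f where "f = Rep_ratf (R $$ (0, 0))"
  have s0: "0 < s" using assms(1) by simp
  note eval = lost_abbey_point.reval_realization[OF point W WQ QW s0, folded R_def]
  have "R = mat s s (\<lambda>(i, j). if i = j then R $$ (0, 0) else 0)"
    unfolding R_def by (rule realization_scalar[OF assms(1) W QW WQ])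
  then have "Rep_mat R = rmat_scalar free_skew_field s f"
    unfolding f_def rmat_scalar_Rep by simp
  then have real: "skew_realization s L D C A B Y = rmat_scalar free_skew_field s f"
    using skew_realization_Rep(2)[OF W QW WQ] unfolding R_def by simp
  have dom: "X \<in> ratfun_dom (s * m) f" if "m \<ge> 1" "X \<in> fm_Omega s L A Y m" for m X
    using eval(1)[OF that] unfolding rdef_def f_def by simp
  have val: "fm_eval s L D C A B Y m X = ratfun_eval (s * m) f X" if "m \<ge> 1" "X \<in> fm_Omega s L A Y m" for m X
    using eval(2)[OF that] unfolding reval_def f_def by simp
  have "f \<in> carrier free_skew_field" unfolding f_def carrier_free_skew_field by simp
  moreover have "Y \<in> ratfun_dom s f" using dom[OF order_refl Y_Omega] by simp
  ultimately show ?thesis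
    using skew_realization_Rep(1)[OF W QW WQ] real dom val by blast
qed

end
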